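(* For every $\Delta\in(1,\infty)$ there exists $\delta>0$ such that $$\delta\,S\ \le\ \mathrm{gap}(\mathcal H^{(S)})\ \le\ \delta^{-1}S$$ for all $S\in\frac12\mathbb N=\{\frac12,1,\frac32,\dots\}$ and all integers $H\ge2$.
   Context: Let $S\in\frac12\mathbb N$, $H\in\mathbb N$, $\Delta\in(1,\infty)$. On $\mathfrak H=\otimes_{h=1}^H\mathbb C^{2S+1}$ consider the spin-$S$ XXZ chain on $[1,H]\cap\mathbb Z$ with kink boundary conditions $$\mathcal H^{(S)}=\sum_{h=1}^{H-1}\mathcal H^{(S)}_{h,h+1},$$ $$\mathcal H^{(S)}_{h,h+1}=S^2-\Delta^{-1}\big(S^1_hS^1_{h+1}+S^2_hS^2_{h+1}\big)-S^3_hS^3_{h+1}+S\sqrt{1-\Delta^{-2}}\,\big(S^3_{h+1}-S^3_h\big).$$ Here the first $S^2$ is the square of the number $S$ (times the identity), while $S^1_h,S^2_h,S^3_h$ are the spin-$S$ operators (the $(2S+1)$-dimensional irreducible representation of $SU(2)$) acting on the $h$-th tensor factor: with the orthonormal basis $|m\rangle$, $m\in\{-S,-S+1,\dots,S\}$, of $\mathbb C^{2S+1}$, $$S^3|m\rangle=m|m\rangle,\qquad S^{\pm}=S^1\pm iS^2,\qquad S^\pm|m\rangle=\sqrt{(S\mp m)(S\pm m+1)}\,|m\pm1\rangle .$$ $\mathcal H^{(S)}$ is a non-negative operator whose lowest eigenvalue is $0$; $\mathrm{gap}(\mathcal H^{(S)})$ denotes its smallest non-zero eigenvalue. *)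

theory Defs
  imports Complex_Main "Jordan_Normal_Form.Char_Poly"
begin

definition half_naturals :: "real set" where
  "half_naturals = {real k / 2 | k :: nat. k \<ge> 1}"

text \<open>For \<open>S\<close> a half-natural, \<open>spin_dim S = 2 S + 1\<close>. The orthonormal basis
  \<open>|m\<rangle>\<close>, \<open>m \<in> {-S, ..., S}\<close>, is numbered by \<open>i = 0, ..., 2 S\<close> via \<open>m = i - S\<close>.\<close>

definition spin_dim :: "real \<Rightarrow> nat" where
  "spin_dim S = nat \<lfloor>2 * S\<rfloor> + 1"

definition mag :: "real \<Rightarrow> nat \<Rightarrow> real" where
  "mag S i = real i - S"

text \<open>Column \<open>j\<close> of each matrix is the image of the \<open>j\<close>-th basis vector.\<close>

definition spin_plus :: "real \<Rightarrow> complex mat" where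
  "spin_plus S = mat (spin_dim S) (spin_dim S) (\<lambda>(i, j).
     if i = j + 1 then complex_of_real (sqrt ((S - mag S j) * (S + mag S j + 1))) else 0)"

definition spin_minus :: "real \<Rightarrow> complex mat" where
  "spin_minus S = mat (spin_dim S) (spin_dim S) (\<lambda>(i, j).
     if j = i + 1 then complex_of_real (sqrt ((S + mag S j) * (S - mag S j + 1))) else 0)"

text \<open>\<open>spin1\<close> and \<open>spin2\<close> solve \<open>spin_plus = spin1 + \<i> spin2\<close>, \<open>spin_minus = spin1 - \<i> spin2\<close>.\<close>

definition spin1 :: "real \<Rightarrow> complex mat" where
  "spin1 S = (1 / 2) \<cdot>\<^sub>m (spin_plus S + spin_minus S)"

definition spin2 :: "real \<Rightarrow> complex mat" where
  "spin2 S = (1 / (2 * \<i>)) \<cdot>\<^sub>m (spin_plus S - spin_minus S)"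

definition spin3 :: "real \<Rightarrow> complex mat" where
  "spin3 S = mat (spin_dim S) (spin_dim S) (\<lambda>(i, j).
     if i = j then complex_of_real (mag S j) else 0)"

text \<open>Kronecker product: the matrix of \<open>A \<otimes> B\<close> in the product basis, with the index of the
  first factor most significant.\<close>

definition kron :: "'a::semiring_1 mat \<Rightarrow> 'a mat \<Rightarrow> 'a mat" where
  "kron A B = mat (dim_row A * dim_row B) (dim_col A * dim_col B) (\<lambda>(i, j).
     A $$ (i div dim_row B, j div dim_col B) * B $$ (i mod dim_row B, j mod dim_col B))"

text \<open>The \<open>d \<times> d\<close> matrix \<open>A\<close> acting on the \<open>h\<close>-th of \<open>H\<close> tensor factors, \<open>1 \<le> h \<le> H\<close>.\<close>

definition at_site :: "nat \<Rightarrow> nat \<Rightarrow> 'a::semiring_1 mat \<Rightarrow> 'a mat" where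
  "at_site H h A =
     kron (1\<^sub>m (dim_row A ^ (h - 1))) (kron A (1\<^sub>m (dim_row A ^ (H - h))))"

definition bond_hamiltonian :: "real \<Rightarrow> real \<Rightarrow> nat \<Rightarrow> nat \<Rightarrow> complex mat" where
  "bond_hamiltonian \<Delta> S H h =
     complex_of_real (S\<^sup>2) \<cdot>\<^sub>m 1\<^sub>m (spin_dim S ^ H)
     - complex_of_real (1 / \<Delta>) \<cdot>\<^sub>m
         (at_site H h (spin1 S) * at_site H (h + 1) (spin1 S)
          + at_site H h (spin2 S) * at_site H (h + 1) (spin2 S))
     - at_site H h (spin3 S) * at_site H (h + 1) (spin3 S)
     + complex_of_real (S * sqrt (1 - 1 / \<Delta>\<^sup>2)) \<cdot>\<^sub>m
         (at_site H (h + 1) (spin3 S) - at_site H h (spin3 S))"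

text \<open>The sum over the bonds is taken entrywise, as matrices of unspecified dimension do not
  form a \<open>comm_monoid_add\<close>.\<close>

definition xxz_hamiltonian :: "real \<Rightarrow> real \<Rightarrow> nat \<Rightarrow> complex mat" where
  "xxz_hamiltonian \<Delta> S H = mat (spin_dim S ^ H) (spin_dim S ^ H) (\<lambda>(i, j).
     \<Sum>h = 1..H - 1. bond_hamiltonian \<Delta> S H h $$ (i, j))"

text \<open>Smallest non-zero eigenvalue; used for Hermitian matrices, whose eigenvalues are all real.
  Positivity of the eigenvalues is not built in.\<close>

definition spectral_gap :: "complex mat \<Rightarrow> real" where
  "spectral_gap A = Min {x :: real. x \<noteq> 0 \<and> eigenvalue A (complex_of_real x)}"

end

theory Submission
  imports Defs "HOL-Analysis.L2_Norm"
begin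

text \<open>Put \<open>N = 2 S\<close> and let \<open>0 < q < 1\<close> solve \<open>q + 1 / q = 2 \<Delta>\<close>. Conjugation with a product ground state
  turns the Hamiltonian into minus the generator of a reversible Markov process: \<open>\<omega> h \<in> {0..N}\<close>
  counts the particles at height \<open>h\<close> of an \<open>N \<times> H\<close> array, and a particle jumps from any site at
  height \<open>h\<close> to any empty site at height \<open>h + 1\<close> with rate \<open>q\<^sup>2 / (1 + q\<^sup>2)\<close>, and down with rate
  \<open>1 / (1 + q\<^sup>2)\<close>.

  As the state does not see permutations within a height, the Dirichlet form is \<open>N\<^sup>2\<close> times the form
  of the exclusion process in one row of the array chosen at random. The exclusion process has gap
  \<open>1 - 1 / \<Delta>\<close>, because it contracts a Lipschitz seminorm with exponential weights. It remains to
  bound from below, by a multiple of \<open>1 / N\<close>, the gap of the chain that brings a random row to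
  equilibrium. Two configurations that differ in the place of one particle, \<open>k\<close> against \<open>l\<close>, are coupled:
  with probability of order \<open>1 / N\<close> the discrepancy is caught by the chosen row and disappears, unless the
  occupation densities at \<open>k\<close> and \<open>l\<close> are nearly \<open>1\<close> and \<open>0\<close>; in this case one end of it moves to
  the edge of the row, which decreases a bounded correction of the distance. An eigenfunction with
  one particle gives the upper bound.\<close>

section \<open>Spectral bounds from contraction\<close>

text \<open>Let \<open>a\<close> and \<open>b\<close> be the densities at \<open>k\<close> and
  \<open>l\<close>, with \<open>b \<le> a\<close>, and put \<open>e = 1 / N\<close> and
  \<open>D = a - b\<close>. The coupling of the removed rows merges the two configurations with mass
  \<open>e * (1 - D)\<close> only. As \<open>D\<close> can be as large as \<open>1 - e\<close>, the
  unit distance alone would contract at order \<open>1 / N ^ 2\<close> and lose a factor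
  \<open>N\<close>. Mass \<open>2 * e * D\<close> replaces the pair \<open>k, l\<close>, half by
  \<open>k, x\<close> and half by \<open>x', l\<close>, where \<open>x\<close> and \<open>x'\<close>
  are the sites added when a row grows from \<open>m + 1\<close> to \<open>m + 2\<close> and from
  \<open>m\<close> to \<open>m + 1\<close> particles. For \<open>D\<close> near 1 the corrections of
  these pairs are about \<open>1 - u x\<close> and \<open>u x'\<close>, with \<open>u\<close> the
  density profile. Neither of them need be below the value 1 that they replace, but for
  \<open>x = x'\<close> they sum to 1 instead of 2. So the two laws of added sites must share mass,
  uniformly in \<open>H\<close> and \<open>m\<close>. They do, because the added site has a
  geometric law in its rank among the empty sites: both laws charge the same lowest empty
  site.\<close>

definition pair_lipschitz ::
  "'i set \<Rightarrow> ('i \<Rightarrow> 'x) \<Rightarrow> ('i \<Rightarrow> 'x) \<Rightarrow> ('i \<Rightarrow> real) \<Rightarrow> real \<Rightarrow> ('x \<Rightarrow> real) \<Rightarrow> bool" where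
  "pair_lipschitz I s t d M f \<longleftrightarrow> (\<forall>i\<in>I. \<bar>f (s i) - f (t i)\<bar> \<le> M * d i)"

text \<open>Stands for a finite path distance in the graph of the pairs; the dual form, through all
  Lipschitz functions at once, needs no paths.\<close>

definition lip_linked ::
  "'i set \<Rightarrow> ('i \<Rightarrow> 'x) \<Rightarrow> ('i \<Rightarrow> 'x) \<Rightarrow> ('i \<Rightarrow> real) \<Rightarrow> 'x \<Rightarrow> 'x \<Rightarrow> bool" where
  "lip_linked I s t d x y \<longleftrightarrow>
    (\<exists>C\<ge>0. \<forall>f M. 0 \<le> M \<longrightarrow> pair_lipschitz I s t d M f \<longrightarrow> \<bar>f x - f y\<bar> \<le> C * M)"

lemma lip_linked_refl: "lip_linked I s t d x x"
  unfolding lip_linked_def by (intro exI[of _ 0]) simp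

lemma lip_linked_sym: "lip_linked I s t d x y \<Longrightarrow> lip_linked I s t d y x"
  unfolding lip_linked_def by (simp add: abs_minus_commute)

lemma lip_linked_pair:
  assumes "i \<in> I"
  shows "lip_linked I s t d (s i) (t i)"
  unfolding lip_linked_def
proof (intro exI[of _ "\<bar>d i\<bar>"] conjI allI impI)
  fix f M assume "0 \<le> M" "pair_lipschitz I s t d M f"
  then have "\<bar>f (s i) - f (t i)\<bar> \<le> M * d i" "M * d i \<le> M * \<bar>d i\<bar>"
    using assms by (auto simp: pair_lipschitz_def intro: mult_left_mono)
  then show "\<bar>f (s i) - f (t i)\<bar> \<le> \<bar>d i\<bar> * M" by (simp add: mult.commute)
qed simp

lemma lip_linked_trans:
  assumes "lip_linked I s t d x y" "lip_linked I s t d y z"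
  shows "lip_linked I s t d x z"
proof -
  obtain C C' where C: "0 \<le> C" "0 \<le> C'"
    "\<And>f M. 0 \<le> M \<Longrightarrow> pair_lipschitz I s t d M f \<Longrightarrow> \<bar>f x - f y\<bar> \<le> C * M"
    "\<And>f M. 0 \<le> M \<Longrightarrow> pair_lipschitz I s t d M f \<Longrightarrow> \<bar>f y - f z\<bar> \<le> C' * M"
    using assms unfolding lip_linked_def by metis
  show ?thesis unfolding lip_linked_def
  proof (intro exI[of _ "C + C'"] conjI allI impI)
    fix f M assume f: "0 \<le> M" "pair_lipschitz I s t d M f"
    show "\<bar>f x - f z\<bar> \<le> (C + C') * M" using C(3)[OF f] C(4)[OF f] by (simp add: distrib_right)
  qed (use C in simp)
qed

lemma pair_lipschitz_exists:
  assumes "finite I" "\<And>i. i \<in> I \<Longrightarrow> 0 < d i"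
  shows "\<exists>M\<ge>0. pair_lipschitz I s t d M f"
proof (intro exI conjI)
  let ?M = "\<Sum>i\<in>I. \<bar>f (s i) - f (t i)\<bar> / d i"
  show "0 \<le> ?M" using assms(2) by (intro sum_nonneg divide_nonneg_pos) auto
  show "pair_lipschitz I s t d ?M f"
    unfolding pair_lipschitz_def
  proof
    fix i assume i: "i \<in> I"
    have "\<bar>f (s i) - f (t i)\<bar> / d i \<le> ?M"
      using assms i by (intro member_le_sum) (auto intro!: divide_nonneg_pos)
    then show "\<bar>f (s i) - f (t i)\<bar> \<le> ?M * d i"
      using assms(2)[OF i] by (simp add: divide_le_eq)
  qed
qed

lemma weighted_cauchy_schwarz:
  fixes p f g :: "'x \<Rightarrow> real"
  assumes "\<And>x. x \<in> X \<Longrightarrow> 0 \<le> p x"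
  shows "(\<Sum>x\<in>X. p x * f x * g x)\<^sup>2 \<le> (\<Sum>x\<in>X. p x * (f x)\<^sup>2) * (\<Sum>x\<in>X. p x * (g x)\<^sup>2)"
proof -
  have "(\<Sum>x\<in>X. (sqrt (p x) * f x) * (sqrt (p x) * g x))\<^sup>2
      \<le> (\<Sum>x\<in>X. (sqrt (p x) * f x)\<^sup>2) * (\<Sum>x\<in>X. (sqrt (p x) * g x)\<^sup>2)"
    (is "(sum ?h X)\<^sup>2 \<le> sum ?F X * sum ?G X")
  proof -
    have "\<bar>sum ?h X\<bar> \<le> sqrt (sum ?F X) * sqrt (sum ?G X)"
      using order_trans[OF sum_abs L2_set_mult_ineq[unfolded abs_mult[symmetric]]]
      by (simp add: L2_set_def)
    then have "\<bar>sum ?h X\<bar>\<^sup>2 \<le> (sqrt (sum ?F X) * sqrt (sum ?G X))\<^sup>2"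
      by (intro power_mono) auto
    then show ?thesis by (simp add: power_mult_distrib sum_nonneg)
  qed
  moreover have "(\<Sum>x\<in>X. (sqrt (p x) * f x) * (sqrt (p x) * g x)) = (\<Sum>x\<in>X. p x * f x * g x)"
    using assms by (intro sum.cong) (auto simp: algebra_simps)
  moreover have "(\<Sum>x\<in>X. (sqrt (p x) * h x)\<^sup>2) = (\<Sum>x\<in>X. p x * (h x)\<^sup>2)" for h
    using assms by (intro sum.cong) (auto simp: power_mult_distrib)
  ultimately show ?thesis by simp
qed

text \<open>As \<open>f\<close> has mean zero, \<open>f x\<close> is the weighted mean of the
  differences \<open>f x - f y\<close>.\<close>

lemma mean_zero_bound:
  fixes p f :: "'x \<Rightarrow> real"
  assumes "finite X" "\<And>x. x \<in> X \<Longrightarrow> 0 < p x" "(\<Sum>x\<in>X. p x * f x) = 0"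
    and osc: "\<And>x y. x \<in> X \<Longrightarrow> y \<in> X \<Longrightarrow> \<bar>f x - f y\<bar> \<le> B" and "x \<in> X"
  shows "\<bar>f x\<bar> \<le> B"
proof -
  let ?Z = "\<Sum>y\<in>X. p y"
  have Z: "0 < ?Z" using assms by (intro sum_pos) auto
  have "?Z * \<bar>f x\<bar> = \<bar>\<Sum>y\<in>X. p y * (f x - f y)\<bar>"
    using Z assms(3) by (simp add: right_diff_distrib sum_subtractf sum_distrib_right[symmetric] abs_mult)
  also have "\<dots> \<le> (\<Sum>y\<in>X. p y * B)"
  proof (intro order_trans[OF sum_abs] sum_mono)
    fix y assume "y \<in> X"
    then show "\<bar>p y * (f x - f y)\<bar> \<le> p y * B"
      using assms(2)[of y] osc[OF \<open>x \<in> X\<close>, of y] by (simp add: abs_mult)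
  qed
  also have "\<dots> = ?Z * B" by (simp add: sum_distrib_right)
  finally show ?thesis using Z by simp
qed

text \<open>The norms \<open>a t\<close> of the iterates \<open>K\<^sup>t f\<close> are log-convex because \<open>K\<close> is self-adjoint, so the
  asymptotic decay rate of \<open>a\<close> bounds already the first ratio \<open>a 1 / a 0\<close>.\<close>

lemma contraction_imp_spectral_bound:
  fixes p :: "'x \<Rightarrow> real" and K :: "('x \<Rightarrow> real) \<Rightarrow> 'x \<Rightarrow> real"
  assumes X: "finite X" and p: "\<And>x. x \<in> X \<Longrightarrow> 0 < p x"
    and selfadj: "\<And>f g. (\<Sum>x\<in>X. p x * K f x * g x) = (\<Sum>x\<in>X. p x * f x * K g x)"
    and one: "\<And>x. x \<in> X \<Longrightarrow> K (\<lambda>_. 1) x = 1"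
    and I: "finite I" and d: "\<And>i. i \<in> I \<Longrightarrow> 0 < d i"
    and contr: "\<And>f M. 0 \<le> M \<Longrightarrow> pair_lipschitz I s t d M f \<Longrightarrow> pair_lipschitz I s t d (\<rho> * M) (K f)"
    and conn: "\<And>x y. x \<in> X \<Longrightarrow> y \<in> X \<Longrightarrow> lip_linked I s t d x y"
    and \<rho>: "0 \<le> \<rho>"
    and mean: "(\<Sum>x\<in>X. p x * f x) = 0"
  shows "(\<Sum>x\<in>X. p x * f x * K f x) \<le> \<rho> * (\<Sum>x\<in>X. p x * (f x)\<^sup>2)"
proof -
  define F where "F t = (K ^^ t) f" for t
  define a where "a t = (\<Sum>x\<in>X. p x * (F t x)\<^sup>2)" for t
  have F0: "F 0 = f" and FS: "F (Suc t) = K (F t)" for t by (simp_all add: F_def)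
  have a_nonneg: "0 \<le> a t" for t unfolding a_def using p by (intro sum_nonneg mult_nonneg_nonneg) (auto simp: less_imp_le)
  have pnn: "0 \<le> p x" if "x \<in> X" for x using p[OF that] by simp
  have logconv: "(a (Suc t))\<^sup>2 \<le> a t * a (Suc (Suc t))" for t
  proof -
    have "a (Suc t) = (\<Sum>x\<in>X. p x * K (F t) x * F (Suc t) x)"
      unfolding a_def FS by (simp add: power2_eq_square mult.assoc)
    also have "\<dots> = (\<Sum>x\<in>X. p x * F t x * F (Suc (Suc t)) x)" unfolding FS[of "Suc t"] by (rule selfadj)
    finally show ?thesis unfolding a_def[of t] a_def[of "Suc (Suc t)"]
      using weighted_cauchy_schwarz[of X p "F t" "F (Suc (Suc t))"] pnn by auto
  qed
  have meanF: "(\<Sum>x\<in>X. p x * F t x) = 0" for t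
  proof (induction t)
    case (Suc t)
    have "(\<Sum>x\<in>X. p x * F (Suc t) x) = (\<Sum>x\<in>X. p x * K (F t) x * (\<lambda>_. 1) x)" by (simp add: FS)
    also have "\<dots> = (\<Sum>x\<in>X. p x * F t x * K (\<lambda>_. 1) x)" by (rule selfadj)
    also have "\<dots> = (\<Sum>x\<in>X. p x * F t x)" by (intro sum.cong) (auto simp: one)
    finally show ?case using Suc by simp
  qed (simp add: F0 mean)
  obtain M where M: "0 \<le> M" "pair_lipschitz I s t d M f" using pair_lipschitz_exists[of I d s t f, OF I d] by blast
  have lipF: "pair_lipschitz I s t d (\<rho> ^ n * M) (F n)" for n
  proof (induction n)
    case (Suc n)
    then show ?case using contr[of "\<rho> ^ n * M" "F n"] \<rho> M by (simp add: FS mult.assoc)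
  qed (simp add: F0 M)
  have "\<exists>c. \<forall>x\<in>X. \<forall>y\<in>X. 0 \<le> c x y \<and>
      (\<forall>f M. 0 \<le> M \<longrightarrow> pair_lipschitz I s t d M f \<longrightarrow> \<bar>f x - f y\<bar> \<le> c x y * M)"
    using conn unfolding lip_linked_def by metis
  then obtain c where c: "\<And>x y. x \<in> X \<Longrightarrow> y \<in> X \<Longrightarrow> 0 \<le> c x y"
    "\<And>x y f M. x \<in> X \<Longrightarrow> y \<in> X \<Longrightarrow> 0 \<le> M \<Longrightarrow> pair_lipschitz I s t d M f \<Longrightarrow> \<bar>f x - f y\<bar> \<le> c x y * M"
    by metis
  define C where "C = (\<Sum>x\<in>X. \<Sum>y\<in>X. c x y)"
  have cC: "c x y \<le> C" if "x \<in> X" "y \<in> X" for x y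
  proof -
    have "c x y \<le> (\<Sum>y\<in>X. c x y)" using that X c(1) by (intro member_le_sum) auto
    also have "\<dots> \<le> C" unfolding C_def
      using that X c(1) by (intro member_le_sum[where f = "\<lambda>x. \<Sum>y\<in>X. c x y"] sum_nonneg) auto
    finally show ?thesis .
  qed
  have Fbound: "\<bar>F n x\<bar> \<le> C * (\<rho> ^ n * M)" if "x \<in> X" for n x
  proof (rule mean_zero_bound[OF X p meanF _ that])
    fix y z assume yz: "y \<in> X" "z \<in> X"
    have "\<bar>F n y - F n z\<bar> \<le> c y z * (\<rho> ^ n * M)" using c(2)[OF yz _ lipF] \<rho> M by simp
    also have "\<dots> \<le> C * (\<rho> ^ n * M)" using cC[OF yz] \<rho> M by (intro mult_right_mono) auto
    finally show "\<bar>F n y - F n z\<bar> \<le> C * (\<rho> ^ n * M)" .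
  qed
  define B where "B = (\<Sum>x\<in>X. p x) * (C * M)\<^sup>2"
  have a_bound: "a n \<le> B * (\<rho>\<^sup>2) ^ n" for n
  proof -
    have "a n \<le> (\<Sum>x\<in>X. p x * (C * (\<rho> ^ n * M))\<^sup>2)" unfolding a_def
      using Fbound pnn by (intro sum_mono mult_left_mono) (metis abs_ge_zero power2_abs power_mono, auto)
    also have "\<dots> = B * (\<rho>\<^sup>2) ^ n"
      unfolding B_def sum_distrib_right[symmetric]
      by (simp add: power_mult_distrib power_mult[symmetric] mult.commute mult.left_commute)
    finally show ?thesis .
  qed
  have first: "a 1 \<le> \<rho>\<^sup>2 * a 0"
  proof (rule ccontr)
    assume neg: "\<not> a 1 \<le> \<rho>\<^sup>2 * a 0"
    then have a1: "0 < a 1" using a_nonneg[of 0] by (smt (verit) mult_nonneg_nonneg zero_le_power2)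
    have a0: "0 < a 0"
    proof (rule ccontr)
      assume "\<not> 0 < a 0"
      then have "a 0 = 0" using a_nonneg[of 0] by simp
      then show False using logconv[of 0] a1 by simp
    qed
    define r where "r = a 1 / a 0"
    have r: "\<rho>\<^sup>2 < r" using neg a0 by (simp add: r_def field_simps)
    have step: "0 < a t \<and> r * a t \<le> a (Suc t)" for t
    proof (induction t)
      case 0 then show ?case using a0 by (simp add: r_def)
    next
      case (Suc t)
      have rpos: "0 < r" using a0 a1 by (simp add: r_def)
      then have pos: "0 < a (Suc t)" using Suc by (smt (verit) mult_pos_pos)
      have "a t * (r * a (Suc t)) \<le> a (Suc t) * a (Suc t)"
        using Suc pos by (simp add: mult.commute mult.left_commute mult_right_mono)
      also have "\<dots> \<le> a t * a (Suc (Suc t))" using logconv[of t] by (simp add: power2_eq_square)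
      finally show ?case using Suc pos by simp
    qed
    have rpos: "0 < r" using a0 a1 by (simp add: r_def)
    have grow: "r ^ t * a 0 \<le> a t" for t
    proof (induction t)
      case (Suc t)
      have "r ^ Suc t * a 0 \<le> r * a t" using Suc rpos by (simp add: mult.assoc)
      then show ?case using step[of t] by linarith
    qed simp
    have "a 0 \<le> B * (\<rho>\<^sup>2 / r) ^ t" for t
      using order_trans[OF grow a_bound, of t] rpos by (simp add: power_divide field_simps)
    moreover have "(\<lambda>t. B * (\<rho>\<^sup>2 / r) ^ t) \<longlonglongrightarrow> B * 0"
      using r rpos by (intro tendsto_mult tendsto_const LIMSEQ_realpow_zero) (auto simp: field_simps)
    ultimately have "a 0 \<le> 0" by (intro LIMSEQ_le_const[where X = "\<lambda>t. B * (\<rho>\<^sup>2 / r) ^ t"]) auto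
    then show False using a0 by simp
  qed
  have "(\<Sum>x\<in>X. p x * f x * K f x)\<^sup>2 \<le> a 0 * a 1"
    using weighted_cauchy_schwarz[of X p f "K f"] pnn by (simp add: a_def F0 FS)
  also have "\<dots> \<le> a 0 * (\<rho>\<^sup>2 * a 0)" using first a_nonneg by (intro mult_left_mono) auto
  also have "\<dots> = (\<rho> * a 0)\<^sup>2" by (simp add: power2_eq_square)
  finally have "(\<Sum>x\<in>X. p x * f x * K f x) \<le> \<rho> * a 0"
    by (rule power2_le_imp_le) (simp add: \<rho> a_nonneg)
  then show ?thesis by (simp add: a_def F0)
qed

section \<open>The exclusion process in a row\<close>

text \<open>The preimage of \<open>A\<close> under the transposition of \<open>h\<close> and
  \<open>Suc h\<close>: an involution whatever the occupation of the two sites.\<close>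

definition sw :: "nat \<Rightarrow> nat set \<Rightarrow> nat set" where
  "sw h A = {x. (if x = h then Suc h else if x = Suc h then h else x) \<in> A}"

lemma mem_sw: "x \<in> sw h A \<longleftrightarrow> (if x = h then Suc h else if x = Suc h then h else x) \<in> A"
  by (simp add: sw_def)

lemma sw_sw [simp]: "sw h (sw h A) = A"
  by (auto simp: sw_def split: if_splits)

lemma sw_commute: "b \<noteq> h \<Longrightarrow> b \<noteq> Suc h \<Longrightarrow> h \<noteq> Suc b \<Longrightarrow> sw b (sw h A) = sw h (sw b A)"
  by (auto simp: sw_def)

lemma sw_up: "h \<in> A \<Longrightarrow> Suc h \<notin> A \<Longrightarrow> sw h A = insert (Suc h) (A - {h})"
  by (auto simp: sw_def split: if_splits)

lemma sw_down: "h \<notin> A \<Longrightarrow> Suc h \<in> A \<Longrightarrow> sw h A = insert h (A - {Suc h})"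
  by (auto simp: sw_def split: if_splits)

lemma sw_Int_below: "b \<le> h \<Longrightarrow> sw h A \<inter> {..<b} = A \<inter> {..<b}"
  by (auto simp: sw_def)

text \<open>The transposition permutes \<open>{..<b}\<close> unless \<open>b = Suc h\<close>
  separates the two sites.\<close>

lemma card_sw_below: "b \<noteq> Suc h \<Longrightarrow> card (sw h A \<inter> {..<b}) = card (A \<inter> {..<b})"
proof (cases "b \<le> h")
  case False
  assume "b \<noteq> Suc h"
  then have "Suc h < b" using False by simp
  then have "bij_betw (\<lambda>x. if x = h then Suc h else if x = Suc h then h else x)
      (sw h A \<inter> {..<b}) (A \<inter> {..<b})"
    by (intro bij_betw_byWitness[where f' = "\<lambda>x. if x = h then Suc h else if x = Suc h then h else x"])
      (auto simp: sw_def split: if_splits)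
  then show ?thesis by (rule bij_betw_same_card)
qed (simp add: sw_Int_below)

lemma card_Int_below_Suc:
  "card (A \<inter> {..<Suc h}) = card (A \<inter> {..<h}) + (if h \<in> A then 1 else 0)"
proof -
  have "A \<inter> {..<Suc h} = (if h \<in> A then insert h (A \<inter> {..<h}) else A \<inter> {..<h})"
    by (auto simp: less_Suc_eq)
  then show ?thesis by simp
qed

locale asymmetric_rows =
  fixes H :: nat and q :: real
  assumes q_pos: "0 < q" and q_less: "q < 1"
begin

definition w :: real where "w = q\<^sup>2"
definition up_rate :: real where "up_rate = w / (1 + w)"
definition down_rate :: real where "down_rate = 1 / (1 + w)"
text \<open>This is \<open>1 - 1 / \<Delta>\<close>, because
  \<open>q + 1 / q = 2 * \<Delta>\<close>.\<close>

definition row_gap :: real where "row_gap = 1 - 2 * q / (1 + w)"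

definition rows :: "nat \<Rightarrow> nat set set" where "rows m = {A. A \<subseteq> {1..H} \<and> card A = m}"
text \<open>The reversible weight: one particle moving up multiplies it by \<open>w\<close>, which
  is \<open>up_rate / down_rate\<close>.\<close>

definition rw :: "nat set \<Rightarrow> real" where "rw A = (\<Prod>h\<in>A. w ^ h)"
definition Z :: "nat \<Rightarrow> real" where "Z m = (\<Sum>A\<in>rows m. rw A)"
definition avg :: "nat \<Rightarrow> (nat set \<Rightarrow> real) \<Rightarrow> real" where
  "avg m G = (\<Sum>A\<in>rows m. rw A * G A) / Z m"

definition rate :: "nat \<Rightarrow> nat set \<Rightarrow> real" where
  "rate h A = (if h \<in> A \<and> Suc h \<notin> A then up_rate else if h \<notin> A \<and> Suc h \<in> A then down_rate else 0)"

definition exch :: "nat \<Rightarrow> (nat set \<Rightarrow> real) \<Rightarrow> nat set \<Rightarrow> real" where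
  "exch h g A = rate h A * (g (sw h A) - g A)"

definition row_form :: "nat \<Rightarrow> (nat set \<Rightarrow> real) \<Rightarrow> real" where
  "row_form m g = - (\<Sum>A\<in>rows m. rw A * g A * (\<Sum>h\<in>{1..<H}. exch h g A))"

lemma w_pos: "0 < w" and w_less: "w < 1"
  using q_pos q_less power_strict_mono[of q 1 2] by (auto simp: w_def)

lemma rates_sum: "up_rate + down_rate = 1" and up_rate_pos: "0 < up_rate" and down_rate_pos: "0 < down_rate"
  and up_rate_eq: "up_rate = w * down_rate"
  using w_pos by (auto simp: up_rate_def down_rate_def field_simps)

lemma row_gap_pos: "0 < row_gap"
proof -
  have "0 < (1 - q)\<^sup>2" using q_less by simp
  then have "2 * q < 1 + w" by (simp add: w_def power2_diff)
  then show ?thesis using w_pos by (simp add: row_gap_def)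
qed

lemma row_gap_le_1: "row_gap \<le> 1"
  using w_pos q_pos by (simp add: row_gap_def)

lemma rate_bounds: "0 \<le> rate h A" "rate h A \<le> 1"
  using up_rate_pos down_rate_pos rates_sum by (auto simp: rate_def)

lemma finite_rows [simp]: "finite (rows m)" unfolding rows_def by simp

lemma rowsD: "A \<in> rows m \<Longrightarrow> finite A" "A \<in> rows m \<Longrightarrow> A \<subseteq> {1..H}" "A \<in> rows m \<Longrightarrow> card A = m"
  by (auto simp: rows_def intro: finite_subset)

lemma rows_nonempty: "m \<le> H \<Longrightarrow> {1..m} \<in> rows m" by (auto simp: rows_def)

lemma rw_pos: "0 < rw A" unfolding rw_def using w_pos by (intro prod_pos) auto

lemma Z_pos: "m \<le> H \<Longrightarrow> 0 < Z m"
  unfolding Z_def using rw_pos rows_nonempty by (intro sum_pos) auto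

lemma rows_sw_up:
  assumes "A \<in> rows m" "h \<in> {1..<H}" "h \<in> A" "Suc h \<notin> A"
  shows "sw h A \<in> rows m" "rw (sw h A) = w * rw A"
proof -
  have fin: "finite A" using rowsD[OF assms(1)] by simp
  have "card (insert (Suc h) (A - {h})) = card A"
    using card_Suc_Diff1[OF fin assms(3)] fin assms(4) by simp
  then show "sw h A \<in> rows m" using assms by (auto simp: sw_up rows_def)
  have "rw (insert (Suc h) (A - {h})) = w ^ Suc h * rw (A - {h})"
    unfolding rw_def using fin assms by simp
  moreover have "rw A = w ^ h * rw (A - {h})"
    unfolding rw_def using fin assms by (simp add: prod.remove)
  ultimately show "rw (sw h A) = w * rw A" using assms by (simp add: sw_up)
qed

lemma rows_sw_down:
  assumes "A \<in> rows m" "h \<in> {1..<H}" "h \<notin> A" "Suc h \<in> A"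
  shows "sw h A \<in> rows m"
proof -
  have fin: "finite A" using rowsD[OF assms(1)] by simp
  have "card (insert h (A - {Suc h})) = card A"
    using card_Suc_Diff1[OF fin assms(4)] fin assms(3) by simp
  then show ?thesis using assms by (auto simp: sw_down rows_def)
qed

text \<open>Rows with an upward move on the bond are paired with their images under
  \<open>sw h\<close>; detailed balance merges the two terms of each pair into one expression
  symmetric in \<open>f\<close> and \<open>g\<close>. Self-adjointness and, with \<open>f\<close>
  constant, the vanishing mean of \<open>exch h g\<close> can be read off.\<close>

lemma exch_form:
  assumes "h \<in> {1..<H}"
  shows "(\<Sum>A\<in>rows m. rw A * f A * exch h g A) =
    - (\<Sum>A | A \<in> rows m \<and> h \<in> A \<and> Suc h \<notin> A. up_rate * rw A * ((g (sw h A) - g A) * (f (sw h A) - f A)))"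
proof -
  define Up where "Up = {A. A \<in> rows m \<and> h \<in> A \<and> Suc h \<notin> A}"
  define Down where "Down = {A. A \<in> rows m \<and> h \<notin> A \<and> Suc h \<in> A}"
  have fin: "finite Up" "finite Down" by (simp_all add: Up_def Down_def)
  have "(\<Sum>A\<in>rows m. rw A * f A * exch h g A) = (\<Sum>A\<in>Up \<union> Down. rw A * f A * exch h g A)"
    by (intro sum.mono_neutral_right) (auto simp: Up_def Down_def exch_def rate_def)
  also have "\<dots> = (\<Sum>A\<in>Up. rw A * f A * exch h g A) + (\<Sum>A\<in>Down. rw A * f A * exch h g A)"
    by (intro sum.union_disjoint fin) (auto simp: Up_def Down_def)
  also have "(\<Sum>A\<in>Down. rw A * f A * exch h g A) = (\<Sum>A\<in>Up. rw (sw h A) * f (sw h A) * exch h g (sw h A))"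
    using assms by (intro sum.reindex_bij_witness[where i = "sw h" and j = "sw h"])
      (auto simp: Up_def Down_def mem_sw rows_sw_up rows_sw_down)
  also have "(\<Sum>A\<in>Up. rw A * f A * exch h g A) + \<dots> =
      - (\<Sum>A\<in>Up. up_rate * rw A * ((g (sw h A) - g A) * (f (sw h A) - f A)))"
    unfolding sum.distrib[symmetric] sum_negf[symmetric]
  proof (intro sum.cong refl)
    fix A assume "A \<in> Up"
    then have a: "A \<in> rows m" "h \<in> A" "Suc h \<notin> A" by (auto simp: Up_def)
    have "exch h g (sw h A) = down_rate * (g A - g (sw h A))" "exch h g A = up_rate * (g (sw h A) - g A)"
      using a by (simp_all add: exch_def rate_def mem_sw)
    then show "rw A * f A * exch h g A + rw (sw h A) * f (sw h A) * exch h g (sw h A) =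
        - (up_rate * rw A * ((g (sw h A) - g A) * (f (sw h A) - f A)))"
      unfolding rows_sw_up(2)[OF a(1) assms a(2,3)] by (simp only: up_rate_eq) (simp add: algebra_simps)
  qed
  finally show ?thesis by (simp add: Up_def)
qed

lemma exch_selfadjoint:
  assumes "h \<in> {1..<H}"
  shows "(\<Sum>A\<in>rows m. rw A * f A * exch h g A) = (\<Sum>A\<in>rows m. rw A * g A * exch h f A)"
  unfolding exch_form[OF assms] by (simp add: mult.commute)

section \<open>A weighted Lipschitz seminorm contracted by the exclusion process\<close>

definition adjacent :: "nat \<Rightarrow> (nat set \<times> nat) set" where
  "adjacent m = {(A, h). A \<in> rows m \<and> h \<in> {1..<H} \<and> h \<in> A \<and> Suc h \<notin> A}"

text \<open>With \<open>c\<close> particles below \<open>h\<close> this is \<open>1 / q\<close> to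
  the power \<open>h - 2 * c\<close>, which is one more than the number of empty sites minus the
  number of particles below \<open>h\<close>. With this choice a jump on a neighbouring bond costs
  the same relative amount \<open>down_rate * q\<close> in each of the four possible
  situations.\<close>

definition adj_dist :: "nat set \<times> nat \<Rightarrow> real" where
  "adj_dist = (\<lambda>(A, h). (1 / q) ^ h * w ^ card (A \<inter> {..<h}))"

abbreviation row_lip :: "nat \<Rightarrow> real \<Rightarrow> (nat set \<Rightarrow> real) \<Rightarrow> bool" where
  "row_lip m \<equiv> pair_lipschitz (adjacent m) fst (\<lambda>(A, h). sw h A) adj_dist"

text \<open>At most \<open>H - 1\<close> bonds act, each at rate at most 1, so the time step
  \<open>1 / H\<close> leaves a nonnegative holding probability.\<close>

definition step :: "(nat set \<Rightarrow> real) \<Rightarrow> nat set \<Rightarrow> real" where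
  "step g A = g A + (\<Sum>h\<in>{1..<H}. exch h g A) / real H"

lemma row_lipD:
  assumes "row_lip m M g" "A \<in> rows m" "h \<in> {1..<H}" "h \<in> A" "Suc h \<notin> A"
  shows "\<bar>g A - g (sw h A)\<bar> \<le> M * ((1 / q) ^ h * w ^ card (A \<inter> {..<h}))"
  using assms unfolding pair_lipschitz_def adjacent_def adj_dist_def by fastforce

text \<open>If \<open>b\<close> is occupied, only the shifted row can jump on the bond
  \<open>b\<close>; the new discrepancy has one particle fewer below it, and its relative distance
  \<open>q / w\<close> meets the rate \<open>up_rate = w * down_rate\<close>. If \<open>b\<close> is
  empty, only \<open>A\<close> can jump, at rate \<open>down_rate\<close> and with relative distance
  \<open>q\<close>.\<close>

lemma exch_neighbour_below:
  assumes lip: "row_lip m M g" and a: "A \<in> rows m" "Suc b \<in> {1..<H}" "Suc b \<in> A" "Suc (Suc b) \<notin> A"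
    and b: "b \<in> {1..<H}"
  shows "\<bar>exch b g A - exch b g (sw (Suc b) A)\<bar> \<le> down_rate * q * (M * adj_dist (A, Suc b))"
proof (cases "b \<in> A")
  case True
  let ?B = "sw (Suc b) A"
  have card: "card (A \<inter> {..<Suc b}) = Suc (card (?B \<inter> {..<b}))"
    using True by (simp add: card_Int_below_Suc card_sw_below)
  have mem: "b \<in> ?B" "Suc b \<notin> ?B" using True a by (auto simp: mem_sw)
  have "exch b g A = 0" using True a by (simp add: exch_def rate_def)
  moreover have "exch b g ?B = up_rate * (g (sw b ?B) - g ?B)"
    using mem by (simp add: exch_def rate_def)
  ultimately have "\<bar>exch b g A - exch b g ?B\<bar> = up_rate * \<bar>g ?B - g (sw b ?B)\<bar>"
    using up_rate_pos by (simp add: abs_mult abs_minus_commute)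
  also have "\<dots> \<le> up_rate * (M * ((1 / q) ^ b * w ^ card (?B \<inter> {..<b})))"
    using up_rate_pos row_lipD[OF lip rows_sw_up(1)[OF a] b mem] by (intro mult_left_mono) auto
  also have "\<dots> = down_rate * q * (M * adj_dist (A, Suc b))"
    using q_pos by (simp add: adj_dist_def card up_rate_eq field_simps)
  finally show ?thesis .
next
  case False
  let ?B = "sw b A"
  have card: "card (A \<inter> {..<Suc b}) = card (?B \<inter> {..<b})"
    using False by (simp add: card_Int_below_Suc card_sw_below)
  have mem: "b \<in> ?B" "Suc b \<notin> ?B" using False a by (auto simp: mem_sw)
  have "exch b g A = down_rate * (g ?B - g A)" using False a by (simp add: exch_def rate_def)
  moreover have "exch b g (sw (Suc b) A) = 0"
    using False a by (simp add: exch_def rate_def mem_sw)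
  ultimately have "\<bar>exch b g A - exch b g (sw (Suc b) A)\<bar> = down_rate * \<bar>g ?B - g (sw b ?B)\<bar>"
    using down_rate_pos by (simp add: abs_mult)
  also have "\<dots> \<le> down_rate * (M * ((1 / q) ^ b * w ^ card (?B \<inter> {..<b})))"
    using down_rate_pos row_lipD[OF lip rows_sw_down[OF a(1) b False a(3)] b mem]
    by (intro mult_left_mono) auto
  also have "\<dots> = down_rate * q * (M * adj_dist (A, Suc b))"
    using q_pos by (simp add: adj_dist_def card field_simps)
  finally show ?thesis .
qed

lemma exch_neighbour_above:
  assumes lip: "row_lip m M g" and a: "A \<in> rows m" "h \<in> {1..<H}" "h \<in> A" "Suc h \<notin> A"
    and b: "Suc h \<in> {1..<H}"
  shows "\<bar>exch (Suc h) g A - exch (Suc h) g (sw h A)\<bar> \<le> down_rate * q * (M * adj_dist (A, h))"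
proof (cases "Suc (Suc h) \<in> A")
  case True
  let ?B = "sw (Suc h) A"
  have card: "card (?B \<inter> {..<Suc h}) = Suc (card (A \<inter> {..<h}))"
    using True a by (simp add: card_Int_below_Suc card_sw_below mem_sw)
  have mem: "Suc h \<in> ?B" "Suc (Suc h) \<notin> ?B" using True a by (auto simp: mem_sw)
  have "exch (Suc h) g (sw h A) = 0" using True a by (simp add: exch_def rate_def mem_sw)
  moreover have "exch (Suc h) g A = down_rate * (g ?B - g A)"
    using a True by (simp add: exch_def rate_def)
  ultimately have "\<bar>exch (Suc h) g A - exch (Suc h) g (sw h A)\<bar> = down_rate * \<bar>g ?B - g (sw (Suc h) ?B)\<bar>"
    using down_rate_pos by (simp add: abs_mult)
  also have "\<dots> \<le> down_rate * (M * ((1 / q) ^ Suc h * w ^ card (?B \<inter> {..<Suc h})))"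
    using down_rate_pos row_lipD[OF lip rows_sw_down[OF a(1) b a(4) True] b mem] 
    by (intro mult_left_mono) auto
  also have "\<dots> = down_rate * q * (M * adj_dist (A, h))"
    unfolding card using q_pos by (simp add: adj_dist_def field_simps w_def power2_eq_square)
  finally show ?thesis .
next
  case False
  let ?B = "sw h A"
  have card: "card (?B \<inter> {..<Suc h}) = card (A \<inter> {..<h})"
    using a by (simp add: card_Int_below_Suc card_sw_below mem_sw)
  have mem: "Suc h \<in> ?B" "Suc (Suc h) \<notin> ?B" using False a by (auto simp: mem_sw)
  have "exch (Suc h) g ?B = up_rate * (g (sw (Suc h) ?B) - g ?B)" using mem by (simp add: exch_def rate_def)
  moreover have "exch (Suc h) g A = 0"
    using False a by (simp add: exch_def rate_def)
  ultimately have "\<bar>exch (Suc h) g A - exch (Suc h) g ?B\<bar> = up_rate * \<bar>g ?B - g (sw (Suc h) ?B)\<bar>"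
    using up_rate_pos by (simp add: abs_mult abs_minus_commute)
  also have "\<dots> \<le> up_rate * (M * ((1 / q) ^ Suc h * w ^ card (?B \<inter> {..<Suc h})))"
    using up_rate_pos row_lipD[OF lip rows_sw_up(1)[OF a] b mem]
    by (intro mult_left_mono) auto
  also have "\<dots> = down_rate * q * (M * adj_dist (A, h))"
    unfolding card using q_pos by (simp add: adj_dist_def up_rate_eq field_simps w_def power2_eq_square)
  finally show ?thesis .
qed

text \<open>Both rows jump on \<open>b\<close> at the same rate, and the discrepancy keeps its
  distance. The loss term stays on the left so that it can later be merged with the identity part of
  \<open>step\<close>.\<close>

lemma exch_far:
  assumes lip: "row_lip m M g" and a: "A \<in> rows m" "h \<in> {1..<H}" "h \<in> A" "Suc h \<notin> A"
    and b: "b \<in> {1..<H}" "b \<noteq> h" "b \<noteq> Suc h" "h \<noteq> Suc b"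
  shows "\<bar>exch b g A - exch b g (sw h A) + rate b A * (g A - g (sw h A))\<bar> \<le> rate b A * (M * adj_dist (A, h))"
proof (cases "rate b A = 0")
  case True
  then have "rate b (sw h A) = 0"
    using b up_rate_pos down_rate_pos by (auto simp: rate_def mem_sw split: if_splits)
  then show ?thesis using True by (simp add: exch_def)
next
  case False
  have r: "rate b (sw h A) = rate b A" using b by (auto simp: rate_def mem_sw)
  have row: "sw b A \<in> rows m"
    using False a b rows_sw_up(1) rows_sw_down unfolding rate_def by (metis (full_types))
  have mem: "h \<in> sw b A" "Suc h \<notin> sw b A" using a b by (auto simp: mem_sw)
  have "exch b g A - exch b g (sw h A) + rate b A * (g A - g (sw h A))
      = rate b A * (g (sw b A) - g (sw h (sw b A)))"
    unfolding exch_def r sw_commute[OF b(2-4)] by (simp add: algebra_simps)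
  moreover have "\<bar>g (sw b A) - g (sw h (sw b A))\<bar> \<le> M * adj_dist (A, h)"
    using row_lipD[OF lip row a(2) mem] b by (simp add: adj_dist_def card_sw_below)
  ultimately show ?thesis using rate_bounds(1)[of b A] by (simp add: abs_mult mult_left_mono)
qed

lemma step_contraction:
  assumes M: "0 \<le> M" and lip: "row_lip m M g"
  shows "row_lip m ((1 - row_gap / real H) * M) (step g)"
  unfolding pair_lipschitz_def
proof (clarsimp simp: adjacent_def)
  fix A h assume a: "A \<in> rows m" "Suc 0 \<le> h" "h < H" "h \<in> A" "Suc h \<notin> A"
  then have h: "h \<in> {1..<H}" by simp
  have H: "0 < real H" using a by simp
  define D where "D = M * adj_dist (A, h)"
  define \<delta> where "\<delta> = g A - g (sw h A)"
  define x where "x b = exch b g A - exch b g (sw h A)" for b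
  \<comment> \<open>\<open>c b\<close> is the rate at which the bond \<open>b\<close> removes the
    present discrepancy, \<open>e b\<close> the relative rate at which it creates one. Far bonds
    balance, the bond \<open>h\<close> gains 1, and each neighbour costs
    \<open>down_rate * q\<close>.\<close>
  define c where "c b = (if b = h then 1 else if b = Suc h \<or> h = Suc b then 0 else rate b A)" for b
  define e where "e b = (if b = h then 0 else if b = Suc h \<or> h = Suc b then down_rate * q else rate b A)" for b
  have D0: "0 \<le> D" using M q_pos w_pos by (simp add: D_def adj_dist_def)
  have \<delta>D: "\<bar>\<delta>\<bar> \<le> D" using row_lipD[OF lip a(1) h a(4,5)] by (simp add: D_def \<delta>_def adj_dist_def)
  have xb: "\<bar>x b + c b * \<delta>\<bar> \<le> e b * D" if b: "b \<in> {1..<H}" for b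
  proof -
    consider "b = h" | "b = Suc h" | "h = Suc b" | "b \<noteq> h" "b \<noteq> Suc h" "h \<noteq> Suc b" by blast
    then show ?thesis
    proof cases
      case 1
      have "exch h g A = up_rate * (g (sw h A) - g A)" "exch h g (sw h A) = down_rate * (g A - g (sw h A))"
        using a by (simp_all add: exch_def rate_def mem_sw)
      then have "x b = - ((up_rate + down_rate) * \<delta>)" unfolding x_def \<delta>_def 1 by (simp add: algebra_simps)
      then show ?thesis using 1 by (simp add: c_def e_def rates_sum)
    next
      case 2
      then show ?thesis using exch_neighbour_above[OF lip a(1) h a(4,5)] b
        by (simp add: c_def e_def x_def D_def)
    next
      case 3
      then show ?thesis using exch_neighbour_below[OF lip a(1), of b] h a(4,5) b
        by (simp add: c_def e_def x_def D_def)
    next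
      case 4
      then show ?thesis using exch_far[OF lip a(1) h a(4,5) b]
        by (simp add: c_def e_def x_def D_def \<delta>_def)
    qed
  qed
  have c01: "0 \<le> c b" "c b \<le> 1" for b using rate_bounds by (auto simp: c_def)
  have csum: "(\<Sum>b\<in>{1..<H}. c b) \<le> real H"
    using sum_mono[of "{1..<H}" c "\<lambda>_. 1"] c01 by simp
  have ce: "row_gap \<le> (\<Sum>b\<in>{1..<H}. c b) - (\<Sum>b\<in>{1..<H}. e b)"
  proof -
    \<comment> \<open>The lower neighbour is tested as \<open>b = h - 1\<close> to obtain a delta
      sum; the inner test guards the truncated subtraction. A neighbour outside
      \<open>{1..<H}\<close> only improves the bound.\<close>
    have "(\<Sum>b\<in>{1..<H}. c b) - (\<Sum>b\<in>{1..<H}. e b) =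
        (\<Sum>b\<in>{1..<H}. (if b = h then 1 else 0) - (if b = Suc h then down_rate * q else 0)
          - (if b = h - 1 then if h = Suc b then down_rate * q else 0 else 0))"
      unfolding sum_subtractf[symmetric] by (intro sum.cong) (auto simp: c_def e_def)
    also have "\<dots> = 1 - (if Suc h \<in> {1..<H} then down_rate * q else 0)
        - (if h - 1 \<in> {1..<H} then if h = Suc (h - 1) then down_rate * q else 0 else 0)"
      unfolding sum_subtractf using h by (simp only: sum.delta finite_atLeastLessThan) simp
    also have "\<dots> \<ge> 1 - down_rate * q - down_rate * q"
      using down_rate_pos q_pos by auto
    finally show ?thesis by (simp add: row_gap_def down_rate_def)
  qed
  have "step g A - step g (sw h A) = \<delta> + (\<Sum>b\<in>{1..<H}. x b) / real H"
    by (simp add: step_def \<delta>_def x_def sum_subtractf diff_divide_distrib)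
  also have "\<dots> = (1 - (\<Sum>b\<in>{1..<H}. c b) / real H) * \<delta> + (\<Sum>b\<in>{1..<H}. x b + c b * \<delta>) / real H"
    by (simp only: sum.distrib sum_distrib_right[symmetric] left_diff_distrib add_divide_distrib) simp
  also have "\<bar>\<dots>\<bar> \<le> (1 - (\<Sum>b\<in>{1..<H}. c b) / real H) * D + (\<Sum>b\<in>{1..<H}. e b * D) / real H"
  proof (intro order_trans[OF abs_triangle_ineq] add_mono)
    have "0 \<le> 1 - (\<Sum>b\<in>{1..<H}. c b) / real H" using csum H by simp
    then show "\<bar>(1 - (\<Sum>b\<in>{1..<H}. c b) / real H) * \<delta>\<bar> \<le> (1 - (\<Sum>b\<in>{1..<H}. c b) / real H) * D"
      using \<delta>D by (simp add: abs_mult mult_left_mono)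
    have "\<bar>\<Sum>b\<in>{1..<H}. x b + c b * \<delta>\<bar> \<le> (\<Sum>b\<in>{1..<H}. e b * D)"
      using xb by (intro order_trans[OF sum_abs] sum_mono) auto
    then show "\<bar>(\<Sum>b\<in>{1..<H}. x b + c b * \<delta>) / real H\<bar> \<le> (\<Sum>b\<in>{1..<H}. e b * D) / real H"
      using H by (simp add: divide_right_mono)
  qed
  also have "\<dots> = (1 - ((\<Sum>b\<in>{1..<H}. c b) - (\<Sum>b\<in>{1..<H}. e b)) / real H) * D"
    by (simp only: sum_distrib_right[symmetric] left_diff_distrib diff_divide_distrib) simp
  also have "\<dots> \<le> (1 - row_gap / real H) * D"
    using ce H D0 by (intro mult_right_mono diff_left_mono divide_right_mono) auto
  finally show "\<bar>step g A - step g (sw h A)\<bar> \<le> (1 - row_gap / real H) * M * adj_dist (A, h)"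
    by (simp add: D_def mult.assoc)
qed

section \<open>Connectivity of the rows of a fixed size\<close>

lemma downward_closed_row:
  assumes "A \<in> rows m" "\<And>h. h \<in> {1..<H} \<Longrightarrow> Suc h \<in> A \<Longrightarrow> h \<in> A"
  shows "A = {1..m}"
proof (cases "A = {}")
  case True
  then show ?thesis using rowsD(3)[OF assms(1)] by simp
next
  case False
  have fin: "finite A" "A \<subseteq> {1..H}" using rowsD[OF assms(1)] by auto
  have down: "x - k \<in> A \<or> x \<le> k" if "x \<in> A" for x k
  proof (induction k)
    case (Suc k)
    then consider "x - k \<in> A" "Suc k < x" | "x \<le> Suc k" by linarith
    then show ?case
    proof cases
      case 1
      then have "x - k = Suc (x - Suc k)" "x - Suc k \<in> {1..<H}" using fin that by auto
      then show ?thesis using assms(2)[of "x - Suc k"] 1 by simp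
    qed simp
  qed (use that in simp)
  have "A = {1..Max A}"
  proof (intro equalityI subsetI)
    fix x assume "x \<in> A" then show "x \<in> {1..Max A}" using fin by auto
  next
    fix x assume x: "x \<in> {1..Max A}"
    then show "x \<in> A" using down[OF Max_in[OF fin(1) False], of "Max A - x"] by auto
  qed
  then show ?thesis using rowsD(3)[OF assms(1)] by (metis card_atLeastAtMost diff_Suc_1)
qed

abbreviation row_linked :: "nat \<Rightarrow> nat set \<Rightarrow> nat set \<Rightarrow> bool" where
  "row_linked m \<equiv> lip_linked (adjacent m) fst (\<lambda>(A, h). sw h A) adj_dist"

text \<open>A downward move lowers the sum of the positions, and only the packed row
  \<open>{1..m}\<close> admits none.\<close>

lemma rows_linked_to_bottom:
  assumes "A \<in> rows m"
  shows "row_linked m A {1..m}"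
  using assms
proof (induction "\<Sum>A" arbitrary: A rule: less_induct)
  case less
  show ?case
  proof (cases "\<exists>h\<in>{1..<H}. Suc h \<in> A \<and> h \<notin> A")
    case False
    then have "A = {1..m}" using downward_closed_row[OF less.prems] by blast
    then show ?thesis by (simp add: lip_linked_refl)
  next
    case True
    then obtain h where h: "h \<in> {1..<H}" "Suc h \<in> A" "h \<notin> A" by blast
    let ?B = "sw h A"
    have row: "?B \<in> rows m" using rows_sw_down[OF less.prems h(1,3,2)] .
    have fin: "finite A" using rowsD[OF less.prems] by simp
    have "\<Sum>?B = h + \<Sum>(A - {Suc h})" using h fin by (simp add: sw_down)
    moreover have "\<Sum>A = Suc h + \<Sum>(A - {Suc h})"
      using h fin sum.remove[of A "Suc h" "\<lambda>x. x"] by simp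
    ultimately have "row_linked m ?B {1..m}" using less.hyps[OF _ row] by simp
    moreover have "(?B, h) \<in> adjacent m" using row h by (simp add: adjacent_def mem_sw)
    from lip_linked_pair[OF this, of fst "\<lambda>(A, h). sw h A" adj_dist]
    have "row_linked m ?B A" by simp
    then have "row_linked m A ?B" by (rule lip_linked_sym)
    ultimately show ?thesis by (rule lip_linked_trans[rotated])
  qed
qed

lemma rows_linked: "A \<in> rows m \<Longrightarrow> B \<in> rows m \<Longrightarrow> row_linked m A B"
  by (rule lip_linked_trans[OF rows_linked_to_bottom lip_linked_sym[OF rows_linked_to_bottom]])

section \<open>The Poincare inequality for rows\<close>

lemma row_poincare_mean_zero:
  assumes H: "1 \<le> H" and mean: "(\<Sum>A\<in>rows m. rw A * g A) = 0"
  shows "row_gap * (\<Sum>A\<in>rows m. rw A * (g A)\<^sup>2) \<le> row_form m g"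
proof -
  have fin: "finite (adjacent m)"
    by (rule finite_subset[of _ "rows m \<times> {1..<H}"]) (auto simp: adjacent_def)
  have split: "(\<Sum>A\<in>rows m. rw A * f A * step g A) = (\<Sum>A\<in>rows m. rw A * f A * g A)
     + (\<Sum>h\<in>{1..<H}. \<Sum>A\<in>rows m. rw A * f A * exch h g A) / real H" for f g
  proof -
    have "(\<Sum>A\<in>rows m. rw A * f A * step g A) = (\<Sum>A\<in>rows m. rw A * f A * g A
        + (\<Sum>h\<in>{1..<H}. rw A * f A * exch h g A) / real H)"
      by (intro sum.cong refl) (simp add: step_def sum_distrib_left algebra_simps)
    also have "\<dots> = (\<Sum>A\<in>rows m. rw A * f A * g A)
        + (\<Sum>A\<in>rows m. \<Sum>h\<in>{1..<H}. rw A * f A * exch h g A) / real H"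
      by (simp only: sum.distrib sum_divide_distrib)
    also have "(\<Sum>A\<in>rows m. \<Sum>h\<in>{1..<H}. rw A * f A * exch h g A) =
        (\<Sum>h\<in>{1..<H}. \<Sum>A\<in>rows m. rw A * f A * exch h g A)"
      by (rule sum.swap)
    finally show ?thesis .
  qed
  have "(\<Sum>A\<in>rows m. rw A * g A * step g A) \<le> (1 - row_gap / real H) * (\<Sum>A\<in>rows m. rw A * (g A)\<^sup>2)"
  proof (rule contraction_imp_spectral_bound[where I = "adjacent m" and s = fst and
        t = "\<lambda>(A, h). sw h A" and d = adj_dist])
    show "(\<Sum>x\<in>rows m. rw x * step f x * g x) = (\<Sum>x\<in>rows m. rw x * f x * step g x)" for f g
    proof -
      have "(\<Sum>x\<in>rows m. rw x * step f x * g x) = (\<Sum>x\<in>rows m. rw x * g x * step f x)"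
        by (simp add: mult.commute mult.left_commute)
      also have "\<dots> = (\<Sum>x\<in>rows m. rw x * f x * step g x)"
      proof -
        have "(\<Sum>h\<in>{1..<H}. \<Sum>A\<in>rows m. rw A * g A * exch h f A) =
            (\<Sum>h\<in>{1..<H}. \<Sum>A\<in>rows m. rw A * f A * exch h g A)"
          by (intro sum.cong refl exch_selfadjoint)
        then show ?thesis unfolding split by (simp add: mult.commute mult.left_commute)
      qed
      finally show ?thesis .
    qed
    show "step (\<lambda>_. 1) x = 1" for x by (simp add: step_def exch_def)
    show "0 < adj_dist i" if "i \<in> adjacent m" for i
      using q_pos w_pos by (simp add: adj_dist_def split: prod.split)
    show "0 \<le> 1 - row_gap / real H" using row_gap_le_1 row_gap_pos H by (simp add: divide_le_eq)
    show "row_linked m x y" if "x \<in> rows m" "y \<in> rows m" for x y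
      by (rule rows_linked[OF that])
    show "row_lip m ((1 - row_gap / real H) * M) (step f)" if "0 \<le> M" "row_lip m M f" for f M
      by (rule step_contraction[OF that])
  qed (simp_all add: rw_pos fin mean)
  \<comment> \<open>Removing the common factor \<open>1 / H\<close> undoes the choice of the time
    step, so the constant depends on neither \<open>H\<close> nor \<open>m\<close>.\<close>
  then have scaled: "(\<Sum>h\<in>{1..<H}. \<Sum>A\<in>rows m. rw A * g A * exch h g A) / real H
      \<le> - (row_gap * (\<Sum>A\<in>rows m. rw A * (g A)\<^sup>2)) / real H"
    unfolding split by (simp add: power2_eq_square algebra_simps)
  have "(\<Sum>h\<in>{1..<H}. \<Sum>A\<in>rows m. rw A * g A * exch h g A) \<le> - (row_gap * (\<Sum>A\<in>rows m. rw A * (g A)\<^sup>2))"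
  proof -
    have "x \<le> y" if "x / real H \<le> y / real H" for x y
      using that H by (simp add: divide_le_cancel)
    from this[OF scaled] show ?thesis .
  qed
  moreover have "(\<Sum>h\<in>{1..<H}. \<Sum>A\<in>rows m. rw A * g A * exch h g A) = - row_form m g"
    unfolding row_form_def minus_minus sum_distrib_left by (rule sum.swap)
  ultimately show ?thesis by linarith
qed

lemma row_form_shift: "row_form m (\<lambda>A. g A - c) = row_form m g"
proof -
  have "exch h (\<lambda>A. g A - c) = exch h g" for h by (simp add: exch_def fun_eq_iff)
  moreover have "(\<Sum>A\<in>rows m. rw A * c * (\<Sum>h\<in>{1..<H}. exch h g A)) = 0"
  proof -
    have "(\<Sum>A\<in>rows m. rw A * c * exch h g A) = 0" if "h \<in> {1..<H}" for h
      using exch_form[OF that, where m = m and f = "\<lambda>_. c"] by simp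
    then have "(\<Sum>h\<in>{1..<H}. \<Sum>A\<in>rows m. rw A * c * exch h g A) = 0" by simp
    then show ?thesis unfolding sum_distrib_left by (subst sum.swap)
  qed
  ultimately show ?thesis
    unfolding row_form_def by (simp add: right_diff_distrib left_diff_distrib sum_subtractf)
qed

text \<open>The variance is written as \<open>g * (g - avg m g)\<close>: averaged over the rest of
  the configuration, it becomes the squared norm minus the quadratic form of
  \<open>resample\<close>.\<close>

lemma row_poincare:
  assumes H: "1 \<le> H"
  shows "row_gap * (\<Sum>A\<in>rows m. rw A * (g A * (g A - avg m g))) \<le> row_form m g"
proof (cases "m \<le> H")
  case True
  let ?g = "\<lambda>A. g A - avg m g"
  have mean: "(\<Sum>A\<in>rows m. rw A * ?g A) = 0"
  proof -
    have "(\<Sum>A\<in>rows m. rw A * ?g A) = (\<Sum>A\<in>rows m. rw A * g A) - Z m * avg m g"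
      by (simp only: right_diff_distrib sum_subtractf Z_def sum_distrib_right)
    then show ?thesis using Z_pos[OF True] by (simp add: avg_def)
  qed
  have "(\<Sum>A\<in>rows m. rw A * (?g A)\<^sup>2) = (\<Sum>A\<in>rows m. rw A * (g A * ?g A)) - avg m g * (\<Sum>A\<in>rows m. rw A * ?g A)"
    unfolding sum_distrib_left sum_subtractf[symmetric] by (intro sum.cong) (auto simp: power2_eq_square algebra_simps)
  then show ?thesis using row_poincare_mean_zero[OF H mean] mean by (simp add: row_form_shift)
next
  case False
  then have "rows m = {}" unfolding rows_def using card_mono[of "{1..H}"] by force
  then show ?thesis by (simp add: row_form_def)
qed

end

section \<open>Adding a particle to a row\<close>

text \<open>Turns sums over sites into geometric sums over ranks, for the empty sites of a row as
  well as for its particles.\<close>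

lemma sum_by_rank:
  fixes S :: "nat set" and \<phi> :: "nat \<Rightarrow> 'b::comm_monoid_add"
  assumes "finite S"
  shows "(\<Sum>x\<in>S. \<phi> (card (S \<inter> {..<x}))) = (\<Sum>i<card S. \<phi> i)"
  using assms
proof (induction S rule: finite_linorder_max_induct)
  case (insert b A)
  have b: "insert b A \<inter> {..<b} = A" "b \<notin> A" using insert.hyps by auto
  have "(\<Sum>x\<in>A. \<phi> (card (insert b A \<inter> {..<x}))) = (\<Sum>x\<in>A. \<phi> (card (A \<inter> {..<x})))"
  proof (intro sum.cong refl arg_cong[where f = "\<lambda>B. \<phi> (card B)"])
    fix x assume "x \<in> A"
    then have "x < b" using insert.hyps by auto
    then show "insert b A \<inter> {..<x} = A \<inter> {..<x}" by auto
  qed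
  then show ?case using insert.IH insert.hyps(1) b by (simp add: add.commute)
qed simp

context asymmetric_rows
begin

definition kern :: "nat set \<Rightarrow> nat \<Rightarrow> real" where
  "kern A x = w ^ card ({1..x} - A) / (\<Sum>j=1..H - card A. w ^ j)"

abbreviation site_mean :: "nat set \<Rightarrow> (nat \<Rightarrow> real) \<Rightarrow> real" where
  "site_mean A u \<equiv> \<Sum>x\<in>{1..H} - A. kern A x * u x"

text \<open>\<open>w / 2\<close> bounds from below the probability that an added site is not the
  lowest empty one, and \<open>1 - w\<close> the probability that the next one is.\<close>

definition overlap :: real where "overlap = w * (1 - w) / 2"

lemma overlap_pos: "0 < overlap" and overlap_le_1: "overlap \<le> 1"
proof -
  show "0 < overlap" using w_pos w_less by (simp add: overlap_def)
  have "w * (1 - w) \<le> 1 * 1" using w_pos w_less by (intro mult_mono) auto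
  then show "overlap \<le> 1" by (simp add: overlap_def)
qed

section \<open>Averages over the rows of a fixed size\<close>

lemma avg_mono:
  assumes "\<And>A. A \<in> rows m \<Longrightarrow> F A \<le> G A"
  shows "avg m F \<le> avg m G"
proof -
  have "0 \<le> Z m" unfolding Z_def using rw_pos by (intro sum_nonneg) (auto intro: less_imp_le)
  then show ?thesis unfolding avg_def using assms rw_pos
    by (intro divide_right_mono sum_mono mult_left_mono) (auto intro: less_imp_le)
qed

lemma avg_cong: "(\<And>A. A \<in> rows m \<Longrightarrow> F A = G A) \<Longrightarrow> avg m F = avg m G"
  by (intro antisym avg_mono) auto

lemma avg_add: "avg m (\<lambda>A. F A + G A) = avg m F + avg m G"
  by (simp add: avg_def distrib_left sum.distrib add_divide_distrib)

lemma avg_diff: "avg m (\<lambda>A. F A - G A) = avg m F - avg m G"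
  by (simp add: avg_def right_diff_distrib sum_subtractf diff_divide_distrib)

lemma avg_cmult: "avg m (\<lambda>A. c * G A) = c * avg m G"
  by (simp add: avg_def sum_distrib_left mult.left_commute)

lemma avg_const: "m \<le> H \<Longrightarrow> avg m (\<lambda>_. c) = c"
  using Z_pos[of m] by (simp add: avg_def sum_distrib_right[symmetric] flip: Z_def)

lemma abs_avg_diff_le:
  assumes "\<And>A. A \<in> rows m \<Longrightarrow> \<bar>F A - G A\<bar> \<le> B A"
  shows "\<bar>avg m F - avg m G\<bar> \<le> avg m B"
proof -
  have "avg m (\<lambda>A. F A - G A) \<le> avg m B" "avg m (\<lambda>A. G A - F A) \<le> avg m B"
    using assms by (auto intro!: avg_mono simp: abs_le_iff)
  then show ?thesis by (simp add: avg_diff abs_le_iff)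
qed

section \<open>The law of an added site\<close>

lemma card_gaps:
  assumes "x \<in> {1..H} - A"
  shows "card ({1..x} - A) = Suc (card (({1..H} - A) \<inter> {..<x}))"
proof -
  have "{1..x} - A = insert x (({1..H} - A) \<inter> {..<x})" using assms by auto
  then show ?thesis by simp
qed

lemma card_complement: "A \<in> rows m \<Longrightarrow> card ({1..H} - A) = H - m"
  using rowsD[of A m] by (simp add: card_Diff_subset)

lemma gap_weights_sum:
  assumes "A \<in> rows m"
  shows "(\<Sum>x\<in>{1..H} - A. w ^ card ({1..x} - A)) = (\<Sum>j=1..H - m. w ^ j)"
proof -
  have "(\<Sum>x\<in>{1..H} - A. w ^ card ({1..x} - A)) = (\<Sum>x\<in>{1..H} - A. w ^ Suc (card (({1..H} - A) \<inter> {..<x})))"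
    by (intro sum.cong refl) (simp only: card_gaps)
  also have "\<dots> = (\<Sum>i<H - m. w ^ Suc i)"
    using sum_by_rank[of "{1..H} - A" "\<lambda>i. w ^ Suc i"] unfolding card_complement[OF assms] by simp
  also have "\<dots> = (\<Sum>j=1..H - m. w ^ j)"
    using sum.shift_bounds_Suc_ivl[of "\<lambda>j. w ^ j" 0 "H - m"]
    by (simp add: atLeast0LessThan atLeastLessThanSuc_atLeastAtMost)
  finally show ?thesis .
qed

lemma geometric_pos: "m < H \<Longrightarrow> 0 < (\<Sum>j=1..H - m. w ^ j)"
  using w_pos by (intro sum_pos) auto

lemma geometric_le: "(\<Sum>j=1..n. w ^ j) \<le> w / (1 - w)"
proof -
  have "(\<Sum>j=1..n. w ^ j) * (1 - w) = w - w ^ Suc n"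
  proof (induction n)
    case (Suc n)
    have "(\<Sum>j=1..Suc n. w ^ j) * (1 - w) = (\<Sum>j=1..n. w ^ j) * (1 - w) + w ^ Suc n * (1 - w)"
      by (simp add: distrib_right)
    also have "\<dots> = w - w ^ Suc n + w ^ Suc n * (1 - w)" by (simp only: Suc)
    also have "\<dots> = w - w ^ Suc (Suc n)" by (simp add: algebra_simps)
    finally show ?case .
  qed simp
  then have "(\<Sum>j=1..n. w ^ j) * (1 - w) \<le> w" using w_pos by simp
  then show ?thesis using w_less by (simp add: pos_le_divide_eq)
qed

lemma kern_nonneg: "0 \<le> kern A x"
  unfolding kern_def using w_pos by (intro divide_nonneg_nonneg sum_nonneg) auto

lemma kern_sum:
  assumes "A \<in> rows m" "m < H"
  shows "(\<Sum>x\<in>{1..H} - A. kern A x) = 1"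
  using gap_weights_sum[OF assms(1)] geometric_pos[OF assms(2)] rowsD(3)[OF assms(1)]
  by (simp add: kern_def sum_divide_distrib[symmetric])

text \<open>Adding the \<open>j\<close>-th empty site with probability proportional to \<open>w ^ j\<close> turns the weighted
  measure on rows of size \<open>m\<close> into the one on rows of size \<open>m + 1\<close>: after removal of the \<open>i\<close>-th
  element \<open>x\<close> of the larger row, \<open>x\<close> is the empty site number \<open>j = x - (i - 1)\<close>.\<close>

lemma add_site_weights:
  "(\<Sum>A\<in>rows m. rw A * (\<Sum>x\<in>{1..H} - A. w ^ card ({1..x} - A) * G (insert x A)))
    = (\<Sum>i<Suc m. (1 / w) ^ i) * (\<Sum>B\<in>rows (Suc m). rw B * G B)"
proof -
  have "(\<Sum>A\<in>rows m. rw A * (\<Sum>x\<in>{1..H} - A. w ^ card ({1..x} - A) * G (insert x A)))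
      = (\<Sum>(A, x)\<in>(SIGMA A:rows m. {1..H} - A). rw A * w ^ card ({1..x} - A) * G (insert x A))"
    by (simp add: sum.Sigma sum_distrib_left mult.assoc)
  also have "\<dots> = (\<Sum>(B, x)\<in>(SIGMA B:rows (Suc m). B). rw B * (1 / w) ^ card (B \<inter> {..<x}) * G B)"
  proof (rule sum.reindex_bij_witness[where i = "\<lambda>(B, x). (B - {x}, x)" and j = "\<lambda>(A, x). (insert x A, x)"])
    fix a assume "a \<in> (SIGMA B:rows (Suc m). B)"
    then obtain B x where a: "a = (B, x)" and b: "B \<in> rows (Suc m)" "x \<in> B" by auto
    have fin: "finite B" "B \<subseteq> {1..H}" "card B = Suc m" using rowsD[OF b(1)] by auto
    then show "(case a of (B, x) \<Rightarrow> (B - {x}, x)) \<in> (SIGMA A:rows m. {1..H} - A)"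
      using b by (auto simp: a rows_def)
  next
    fix a assume "a \<in> (SIGMA A:rows m. {1..H} - A)"
    then obtain A x where a: "a = (A, x)" and b: "A \<in> rows m" "x \<in> {1..H}" "x \<notin> A" by auto
    have fin: "finite A" "A \<subseteq> {1..H}" "card A = m" using rowsD[OF b(1)] by auto
    then show "(case a of (A, x) \<Rightarrow> (insert x A, x)) \<in> (SIGMA B:rows (Suc m). B)"
      using b by (auto simp: a rows_def)
    have "{1..x} = ({1..x} - A) \<union> (insert x A \<inter> {..<x})"
      using fin(2) b(2,3) by (auto simp: le_less)
    moreover have "card (({1..x} - A) \<union> (insert x A \<inter> {..<x})) = card ({1..x} - A) + card (insert x A \<inter> {..<x})"
      using fin by (intro card_Un_disjoint) auto
    ultimately have x: "x = card ({1..x} - A) + card (insert x A \<inter> {..<x})" by (metis card_atLeastAtMost diff_Suc_1)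
    have "rw (insert x A) = w ^ x * rw A" using fin b by (simp add: rw_def)
    also have "w ^ x = w ^ card ({1..x} - A) * w ^ card (insert x A \<inter> {..<x})"
      using x by (metis power_add)
    finally have "rw (insert x A) * (1 / w) ^ card (insert x A \<inter> {..<x}) = rw A * w ^ card ({1..x} - A)"
      using w_pos by (simp add: power_divide)
    then show "(case (case a of (A, x) \<Rightarrow> (insert x A, x)) of (B, x) \<Rightarrow> rw B * (1 / w) ^ card (B \<inter> {..<x}) * G B)
       = (case a of (A, x) \<Rightarrow> rw A * w ^ card ({1..x} - A) * G (insert x A))"
      by (simp add: a)
  qed auto
  also have "\<dots> = (\<Sum>B\<in>rows (Suc m). rw B * G B * (\<Sum>x\<in>B. (1 / w) ^ card (B \<inter> {..<x})))"
    using rowsD(1) by (subst sum.Sigma[symmetric]) (auto simp: sum_distrib_left mult_ac intro!: sum.cong)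
  also have "\<dots> = (\<Sum>B\<in>rows (Suc m). rw B * G B * (\<Sum>i<Suc m. (1 / w) ^ i))"
  proof (intro sum.cong refl)
    fix B assume b: "B \<in> rows (Suc m)"
    show "rw B * G B * (\<Sum>x\<in>B. (1 / w) ^ card (B \<inter> {..<x})) = rw B * G B * (\<Sum>i<Suc m. (1 / w) ^ i)"
      using sum_by_rank[OF rowsD(1)[OF b], of "\<lambda>i. (1 / w) ^ i"] rowsD(3)[OF b] by simp
  qed
  finally show ?thesis unfolding sum_distrib_right[symmetric] by (simp only: mult.commute)
qed

text \<open>\<open>add_site_weights\<close> gives the identity up to normalization; testing it on
  the constant 1 yields \<open>Z m * W = V * Z (Suc m)\<close>.\<close>

lemma avg_Suc:
  assumes "m < H"
  shows "avg (Suc m) G = avg m (\<lambda>A. \<Sum>x\<in>{1..H} - A. kern A x * G (insert x A))"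
proof -
  define W where "W = (\<Sum>j=1..H - m. w ^ j)"
  define V where "V = (\<Sum>i<Suc m. (1 / w) ^ i)"
  have W: "0 < W" using geometric_pos[OF assms] by (simp add: W_def)
  have V: "0 < V" unfolding V_def using w_pos by (intro sum_pos) auto
  have Z: "Z m * W = V * Z (Suc m)"
  proof -
    have "(\<Sum>A\<in>rows m. rw A * (\<Sum>x\<in>{1..H} - A. w ^ card ({1..x} - A))) = Z m * W"
      unfolding Z_def W_def sum_distrib_right
      by (intro sum.cong refl) (simp only: gap_weights_sum sum_distrib_left)
    then show ?thesis using add_site_weights[where m = m and G = "\<lambda>_. 1"] by (simp add: V_def Z_def)
  qed
  have "avg m (\<lambda>A. \<Sum>x\<in>{1..H} - A. kern A x * G (insert x A))
      = (\<Sum>A\<in>rows m. rw A * (\<Sum>x\<in>{1..H} - A. w ^ card ({1..x} - A) * G (insert x A)) / W) / Z m"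
    unfolding avg_def
    by (intro arg_cong2[where f = "(/)"] sum.cong refl)
      (simp add: kern_def rowsD(3) W_def sum_divide_distrib sum_distrib_left)
  also have "\<dots> = V * (\<Sum>B\<in>rows (Suc m). rw B * G B) / (Z m * W)"
    by (simp only: sum_divide_distrib[symmetric] add_site_weights V_def) (simp add: mult.commute)
  also have "\<dots> = avg (Suc m) G" unfolding Z avg_def using V by simp
  finally show ?thesis by simp
qed

text \<open>The lowest empty site has rank one, and the full geometric series bounds the
  normalization uniformly in \<open>H\<close> and \<open>m\<close>.\<close>

lemma kern_Min:
  assumes "A \<in> rows m" "m < H"
  defines "y \<equiv> Min ({1..H} - A)"
  shows "y \<in> {1..H} - A" "kern A y = w / (\<Sum>j=1..H - m. w ^ j)" "1 - w \<le> kern A y"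
proof -
  have "card ({1..H} - A) \<noteq> 0" using card_complement[OF assms(1)] assms(2) by simp
  then have ne: "{1..H} - A \<noteq> {}" by auto
  show y: "y \<in> {1..H} - A" unfolding y_def using ne by (intro Min_in) auto
  have "x \<ge> y" if "x \<in> {1..H} - A" for x unfolding y_def using that by (intro Min_le) auto
  then have "({1..H} - A) \<inter> {..<y} = {}" by fastforce
  then show k: "kern A y = w / (\<Sum>j=1..H - m. w ^ j)"
    using card_gaps[OF y] rowsD(3)[OF assms(1)] by (simp add: kern_def)
  have "(1 - w) * (\<Sum>j=1..H - m. w ^ j) \<le> w"
    using geometric_le[of "H - m"] w_less by (simp add: pos_le_divide_eq mult.commute)
  then show "1 - w \<le> kern A y" unfolding k using geometric_pos[OF assms(2)] by (simp add: pos_le_divide_eq)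
qed

text \<open>As \<open>Suc m < H\<close> there is a second empty site, whose weight
  \<open>w\<^sup>2\<close> enters the normalization.\<close>

lemma kern_Min_le:
  assumes "A \<in> rows m" "Suc m < H"
  shows "w / 2 \<le> 1 - kern A (Min ({1..H} - A))"
proof -
  have "(\<Sum>j\<in>{1, 2}. w ^ j) \<le> (\<Sum>j=1..H - m. w ^ j)"
    using assms(2) w_pos by (intro sum_mono2) auto
  then have W: "w * (1 + w) \<le> (\<Sum>j=1..H - m. w ^ j)" by (simp add: power2_eq_square algebra_simps)
  have "kern A (Min ({1..H} - A)) \<le> w / (w * (1 + w))"
    unfolding kern_Min(2)[OF assms(1) Suc_lessD[OF assms(2)]]
    using W w_pos geometric_pos[OF Suc_lessD[OF assms(2)]] by (intro divide_left_mono mult_pos_pos) auto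
  also have "\<dots> = 1 - w / (1 + w)"
  proof -
    have "w * (1 + w) \<noteq> 0" "1 + w \<noteq> 0" using w_pos by auto
    then show ?thesis by (simp add: divide_simps)
  qed
  also have "\<dots> \<le> 1 - w / 2" using w_pos w_less by (intro diff_left_mono divide_left_mono) auto
  finally show ?thesis by simp
qed

text \<open>The laws of the sites added in the passages \<open>m \<rightarrow> m + 1\<close> and \<open>m + 1 \<rightarrow> m + 2\<close> share
  mass at least \<open>overlap\<close>, located at the first empty site of the row of size \<open>m\<close>.\<close>

lemma added_sites_overlap:
  assumes m: "Suc m < H" and u: "\<And>x. x \<in> {1..H} \<Longrightarrow> 0 \<le> u x \<and> u x \<le> 1"
  shows "avg m (\<lambda>A. site_mean A u)
    \<le> avg (Suc m) (\<lambda>A. site_mean A u) + 1 - overlap"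
proof -
  let ?y = "\<lambda>A. Min ({1..H} - A)"
  have "avg m (\<lambda>A. site_mean A u - overlap * u (?y A)) \<le> avg m (\<lambda>A. 1 - overlap)"
  proof (rule avg_mono)
    fix A assume a: "A \<in> rows m"
    note y = kern_Min[OF a Suc_lessD[OF m]]
    have "overlap \<le> 1 - w"
      using w_pos w_less mult_right_mono[of w 2 "1 - w"] by (simp add: overlap_def)
    then have "overlap * (1 - u (?y A)) \<le> kern A (?y A) * (1 - u (?y A))"
      using y u[of "?y A"] by (intro mult_right_mono) auto
    also have "\<dots> \<le> (\<Sum>x\<in>{1..H} - A. kern A x * (1 - u x))"
      using y(1) u kern_nonneg by (intro member_le_sum[where f = "\<lambda>x. kern A x * (1 - u x)"]) auto
    also have "\<dots> = 1 - site_mean A u"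
      using kern_sum[OF a Suc_lessD[OF m]] by (simp add: right_diff_distrib sum_subtractf)
    finally show "site_mean A u - overlap * u (?y A) \<le> 1 - overlap"
      by (simp add: algebra_simps)
  qed
  then have 1: "avg m (\<lambda>A. site_mean A u) - avg m (\<lambda>A. overlap * u (?y A)) \<le> 1 - overlap"
    using m by (simp add: avg_diff avg_const)
  \<comment> \<open>If the site \<open>x\<close> added first differs from \<open>?y A\<close>, then
    \<open>?y A\<close> is still the lowest empty site of \<open>insert x A\<close> and receives
    mass at least \<open>1 - w\<close> at the next addition.\<close>
  have "avg m (\<lambda>A. overlap * u (?y A)) \<le> avg (Suc m) (\<lambda>A. site_mean A u)"
    unfolding avg_Suc[OF Suc_lessD[OF m]]
  proof (rule avg_mono)
    fix A assume a: "A \<in> rows m"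
    note y = kern_Min[OF a Suc_lessD[OF m]]
    have "overlap * u (?y A) \<le> (1 - kern A (?y A)) * ((1 - w) * u (?y A))"
      using mult_right_mono[OF kern_Min_le[OF a m], of "(1 - w) * u (?y A)"] w_less u[of "?y A"] y(1)
      by (simp add: overlap_def)
    also have "1 - kern A (?y A) = (\<Sum>x\<in>{1..H} - A - {?y A}. kern A x)"
      using kern_sum[OF a Suc_lessD[OF m]] y(1) by (simp add: sum_diff1)
    also have "(\<Sum>x\<in>{1..H} - A - {?y A}. kern A x) * ((1 - w) * u (?y A))
        \<le> (\<Sum>x\<in>{1..H} - A - {?y A}. kern A x * site_mean (insert x A) u)"
      unfolding sum_distrib_right
    proof (intro sum_mono mult_left_mono kern_nonneg)
      fix x assume x: "x \<in> {1..H} - A - {?y A}"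
      have b: "insert x A \<in> rows (Suc m)" using a x rowsD[OF a] by (auto simp: rows_def)
      have "Min ({1..H} - insert x A) = ?y A"
        using x y(1) by (intro Min_eqI) auto
      then have k: "1 - w \<le> kern (insert x A) (?y A)" using kern_Min(3)[OF b m] by simp
      have yx: "?y A \<in> {1..H} - insert x A" using x y(1) by auto
      have "(1 - w) * u (?y A) \<le> kern (insert x A) (?y A) * u (?y A)"
        using k u yx by (intro mult_right_mono) auto
      also have "\<dots> \<le> site_mean (insert x A) u"
        using yx u kern_nonneg by (intro member_le_sum[where f = "\<lambda>z. kern (insert x A) z * u z"]) auto
      finally show "(1 - w) * u (?y A) \<le> site_mean (insert x A) u" .
    qed
    also have "\<dots> \<le> (\<Sum>x\<in>{1..H} - A. kern A x * site_mean (insert x A) u)"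
      using u kern_nonneg by (intro sum_mono2) (auto intro!: mult_nonneg_nonneg sum_nonneg)
    finally show "overlap * u (?y A) \<le> (\<Sum>x\<in>{1..H} - A. kern A x * site_mean (insert x A) u)" .
  qed
  then show ?thesis using 1 by simp
qed

end

section \<open>Removing and resampling a row\<close>

text \<open>For densities, the probability that independent bits with means \<open>a\<close> and
  \<open>b\<close> differ; on the unit square it is largest at the corners where one density is 1
  and the other 0.\<close>

definition dis :: "real \<Rightarrow> real \<Rightarrow> real" where
  "dis a b = a * (1 - b) + b * (1 - a)"

lemma dis_nonneg: "0 \<le> a \<Longrightarrow> a \<le> 1 \<Longrightarrow> 0 \<le> b \<Longrightarrow> b \<le> 1 \<Longrightarrow> 0 \<le> dis a b"
  by (simp add: dis_def)

lemma dis_le_1: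
  assumes "0 \<le> a" "a \<le> 1" "0 \<le> b" "b \<le> 1"
  shows "dis a b \<le> 1"
proof -
  have "1 - dis a b = a * b + (1 - a) * (1 - b)" by (simp add: dis_def algebra_simps)
  moreover have "0 \<le> a * b + (1 - a) * (1 - b)" using assms by simp
  ultimately show ?thesis by linarith
qed

lemma dis_commute: "dis a b = dis b a"
  by (simp add: dis_def)

lemma dis_le_add: "0 \<le> a \<Longrightarrow> 0 \<le> b \<Longrightarrow> dis a b \<le> a + b"
  by (simp add: dis_def algebra_simps)

lemma dis_le_compl:
  assumes "a \<le> 1" "b \<le> 1"
  shows "dis a b \<le> (1 - a) + (1 - b)"
proof -
  have "0 \<le> (1 - a) * (1 - b)" using assms by simp
  then show ?thesis by (simp add: dis_def algebra_simps)
qed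

text \<open>\<open>s\<close>, \<open>t\<close> are the bits of the inserted row at the two columns,
  \<open>i\<close>, \<open>j\<close> those of the removed row. \<open>dis\<close> is affine in each
  argument, so the change is computed exactly; the bound no longer involves \<open>s\<close> and
  \<open>t\<close>, because the inserted row is not controlled there.\<close>

lemma dis_shift:
  fixes a b e s t i j :: real
  assumes ab: "0 \<le> b" "b \<le> a" "a \<le> 1 - e" and e: "0 \<le> e"
    and st: "s \<in> {0, 1}" "t \<in> {0, 1}" "i \<in> {0, 1}" "j \<in> {0, 1}"
    and i: "i = 1 \<Longrightarrow> e \<le> a" and j: "j = 1 \<Longrightarrow> e \<le> b"
  shows "dis (a + e * (s - i)) (b + e * (t - j)) \<le> dis a b + e * ((1 - i) + 2 * b + (1 - a) + j)"
proof -
  let ?b = "b + e * (t - j)"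
  have "dis (a + e * (s - i)) ?b - dis a b = e * ((s - i) * (1 - 2 * ?b) + (t - j) * (1 - 2 * a))"
    by (simp add: dis_def algebra_simps)
  moreover have "(s - i) * (1 - 2 * ?b) \<le> (1 - i) + 2 * b"
  proof -
    have b0: "0 \<le> ?b" using ab(1) e j st(2,4) by auto
    have b1: "?b \<le> b + e" using e st(2,4) by auto
    consider "s = i" | "s = 1" "i = 0" | "s = 0" "i = 1" using st by auto
    then show ?thesis
    proof cases
      case 1 then show ?thesis using ab st by auto
    next
      case 2 then show ?thesis using b0 ab by simp
    next
      case 3 then show ?thesis using b1 i ab by simp
    qed
  qed
  moreover have "(t - j) * (1 - 2 * a) \<le> (1 - a) + j"
    using st ab e by (auto simp: algebra_simps)
  ultimately have "dis (a + e * (s - i)) ?b - dis a b \<le> e * (((1 - i) + 2 * b) + ((1 - a) + j))"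
    using e by (simp add: mult_left_mono)
  then show ?thesis by (simp add: algebra_simps)
qed

text \<open>In the following inequality \<open>a - b\<close> is the rate at which the discrepancy moves without
  being removed; there the overlap \<open>c\<close> provides the contraction.\<close>

lemma contraction_budget:
  fixes a b e c :: real
  assumes ab: "0 \<le> b" "b \<le> a" "a \<le> 1 - e" and e: "0 \<le> e" and c: "0 \<le> c" "c \<le> 1"
  shows "(a * b + b * e) * (1 + (dis a b + e * (2 * b + (1 - a) + 1)) / 14)
    + (1 - a - e) * (1 - b) * (1 + (dis a b + e * (1 + 2 * b + (1 - a))) / 14)
    + (1 - a - e) * b * (1 + (dis a b + e * (1 + 2 * b + (1 - a) + 1)) / 14)
    + a * (1 - b - e) * (1 + (dis a b + e * (2 * b + (1 - a))) / 14)
    + e * (a - b) * (2 + (3 * (1 - a) + b + 2 - c) / 14)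
    \<le> (1 - e * c / 28) * (1 + dis a b / 14)" (is "?L \<le> _")
proof -
  define B where "B = dis a b"
  define D where "D = a - b"
  \<comment> \<open>The mass for which the discrepancy stays at its pair of columns. Mass
    \<open>e * (1 - D)\<close> merges and mass \<open>2 * e * D\<close> moves, which makes 1 in
    total.\<close>
  define W where "W = 1 - e * (1 + D)"
  have D: "0 \<le> D" "D \<le> 1" using ab e by (auto simp: D_def)
  have "0 \<le> b * (1 - a)" using ab e by simp
  then have BD: "D \<le> B" by (simp add: B_def D_def dis_def algebra_simps)
  have B1: "B \<le> 1" unfolding B_def using ab e by (intro dis_le_1) auto
  have "e * D \<le> (1 - a) * 1" using ab e D by (intro mult_mono) auto
  then have W: "W \<le> 1" using e D by (simp add: W_def)
  have Weq: "W = (a * b + b * e) + (1 - a - e) * (1 - b) + (1 - a - e) * b + a * (1 - b - e)"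
    by (simp add: W_def D_def algebra_simps)
  have "?L = W * (1 + B / 14) + e / 14 * ((2 * b + (1 - a)) * W + (1 - a - e) + b)
      + e * D * (2 + (3 * (1 - a) + b + 2 - c) / 14)"
    unfolding Weq B_def[symmetric] D_def by (simp add: field_simps)
  also have "\<dots> \<le> W * (1 + B / 14) + e / 14 * ((2 * b + (1 - a)) * 1 + (1 - a) + b)
      + e * D * (2 + (3 * (1 - a) + b + 2 - c) / 14)"
    using ab e W by (intro add_mono mult_left_mono order_refl) auto
  also have "\<dots> \<le> W * (1 + B / 14) + e / 14 * (3 * (1 - D)) + e * D * (2 + (3 * (1 - D) + 2 - c) / 14)"
    using ab e D by (intro add_mono mult_left_mono order_refl) (auto simp: D_def)
  also have "\<dots> = (1 + B / 14) + e * (3 * (1 - D) / 14 + D * (2 + (3 * (1 - D) + 2 - c) / 14) - (1 + D) * (1 + B / 14))"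
    by (simp add: W_def field_simps)
  also have "\<dots> \<le> (1 + B / 14) + e * (- (c / 14))"
  proof (intro add_left_mono mult_left_mono e)
    have "(1 + D) * (1 + D / 14) \<le> (1 + D) * (1 + B / 14)" using BD D by (intro mult_left_mono) auto
    \<comment> \<open>With \<open>K\<close> in place of 14 the right side would be
      \<open>- ((1 - D) * (K - 3 - 4 * D) / K) - D * c / K\<close>. The first part must supply
      \<open>(1 - D) * c / K\<close> for every \<open>c \<le> 1\<close>, which holds as soon as
      \<open>K \<ge> 8\<close>.\<close>
    moreover have "3 * (1 - D) / 14 + D * (2 + (3 * (1 - D) + 2 - c) / 14) - (1 + D) * (1 + D / 14)
       = - ((1 - D) * (11 - 4 * D) / 14) - D * c / 14" by (simp add: field_simps)
    moreover have "(1 - D) * (c / 14) \<le> (1 - D) * ((11 - 4 * D) / 14)"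
      using D c by (intro mult_left_mono) auto
    moreover have "- ((1 - D) * (c / 14)) - D * c / 14 = - (c / 14)" by (simp add: field_simps)
    ultimately show "3 * (1 - D) / 14 + D * (2 + (3 * (1 - D) + 2 - c) / 14) - (1 + D) * (1 + B / 14) \<le> - (c / 14)"
      by simp
  qed
  also have "\<dots> \<le> (1 - e * c / 28) * (1 + B / 14)"
  proof -
    \<comment> \<open>The distance is at most 2; converting the additive gain into a factor
      therefore doubles 14 to 28.\<close>
    have "e * c / 28 * (1 + B / 14) \<le> e * c / 28 * 2" using e c B1 by (intro mult_left_mono) auto
    then show ?thesis by (simp add: algebra_simps)
  qed
  finally show ?thesis by (simp add: B_def)
qed

section \<open>Configurations and pairs that differ in one particle\<close>

definition with_row :: "(nat \<Rightarrow> nat) \<Rightarrow> nat set \<Rightarrow> nat \<Rightarrow> nat" where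
  "with_row \<omega> A h = \<omega> h + of_bool (h \<in> A)"

text \<open>For rows inside \<open>{1..H}\<close> the subtraction is truncated only when the row has
  probability zero under \<open>pr\<close>.\<close>

definition without_row :: "(nat \<Rightarrow> nat) \<Rightarrow> nat set \<Rightarrow> nat \<Rightarrow> nat" where
  "without_row \<omega> A h = \<omega> h - of_bool (h \<in> A)"

definition inc :: "(nat \<Rightarrow> nat) \<Rightarrow> nat \<Rightarrow> nat \<Rightarrow> nat" where
  "inc \<omega> k = \<omega>(k := Suc (\<omega> k))"

definition dec :: "(nat \<Rightarrow> nat) \<Rightarrow> nat \<Rightarrow> nat \<Rightarrow> nat" where
  "dec \<omega> k = \<omega>(k := \<omega> k - 1)"

locale spin_rows = asymmetric_rows H q for H :: nat and q :: real +
  fixes N :: nat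
  assumes N_pos: "1 \<le> N"
begin

definition tot :: "(nat \<Rightarrow> nat) \<Rightarrow> nat" where "tot \<omega> = (\<Sum>h\<in>{1..H}. \<omega> h)"

text \<open>Occupations outside \<open>{1..H}\<close> are forced to 0, so that configurations can be
  compared as functions and form a finite set.\<close>

definition conf :: "nat \<Rightarrow> nat \<Rightarrow> (nat \<Rightarrow> nat) set" where
  "conf M n = {\<omega>. (\<forall>h. \<omega> h \<le> (if h \<in> {1..H} then M else 0)) \<and> tot \<omega> = n}"

text \<open>Stores the common base with \<open>n - 1\<close> particles; the two neighbours are
  \<open>inc \<omega> k\<close> and \<open>inc \<omega> l\<close>.\<close>

definition pairs :: "nat \<Rightarrow> ((nat \<Rightarrow> nat) \<times> nat \<times> nat) set" where
  "pairs n = {(\<omega>, k, l). 1 \<le> n \<and> \<omega> \<in> conf N (n - 1) \<and> k \<in> {1..H} \<and> l \<in> {1..H} \<and> k \<noteq> l \<and> \<omega> k < N \<and> \<omega> l < N}"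

text \<open>The densities are those of the base, without the discrepant particle, which makes the
  distance symmetric in the two neighbours.\<close>

definition pair_dist :: "(nat \<Rightarrow> nat) \<times> nat \<times> nat \<Rightarrow> real" where
  "pair_dist = (\<lambda>(\<omega>, k, l). 1 + dis (real (\<omega> k) / N) (real (\<omega> l) / N) / 14)"

abbreviation conf_lip :: "nat \<Rightarrow> real \<Rightarrow> ((nat \<Rightarrow> nat) \<Rightarrow> real) \<Rightarrow> bool" where
  "conf_lip n \<equiv> pair_lipschitz (pairs n) (\<lambda>(\<omega>, k, l). inc \<omega> k) (\<lambda>(\<omega>, k, l). inc \<omega> l) pair_dist"

lemma conf_lipD:
  assumes "conf_lip n M f" "\<omega> \<in> conf N m" "n = Suc m" "k \<in> {1..H}" "l \<in> {1..H}" "k \<noteq> l" "\<omega> k < N" "\<omega> l < N"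
  shows "\<bar>f (inc \<omega> k) - f (inc \<omega> l)\<bar> \<le> M * (1 + dis (real (\<omega> k) / N) (real (\<omega> l) / N) / 14)"
proof -
  have "(\<omega>, k, l) \<in> pairs n" using assms by (simp add: pairs_def)
  then show ?thesis using assms(1) unfolding pair_lipschitz_def pair_dist_def by fastforce
qed

lemma tot_with_row: "A \<in> rows m \<Longrightarrow> tot (with_row \<omega> A) = tot \<omega> + m"
proof -
  assume a: "A \<in> rows m"
  then have "(\<Sum>h\<in>{1..H}. of_bool (h \<in> A) :: nat) = card ({1..H} \<inter> A)" by simp
  also have "{1..H} \<inter> A = A" using rowsD(2)[OF a] by auto
  finally show ?thesis using rowsD(3)[OF a] by (simp add: tot_def with_row_def sum.distrib)
qed

lemma tot_upd:
  assumes "k \<in> {1..H}"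
  shows "tot (\<omega>(k := v)) + \<omega> k = tot \<omega> + v"
proof -
  have "tot \<eta> = \<eta> k + sum \<eta> ({1..H} - {k})" for \<eta>
    unfolding tot_def using assms by (intro sum.remove) auto
  moreover have "sum (\<omega>(k := v)) ({1..H} - {k}) = sum \<omega> ({1..H} - {k})"
    by (intro sum.cong) auto
  ultimately show ?thesis by simp
qed

lemma tot_inc: "k \<in> {1..H} \<Longrightarrow> tot (inc \<omega> k) = Suc (tot \<omega>)"
  using tot_upd[of k \<omega> "Suc (\<omega> k)"] by (simp add: inc_def)

lemma tot_dec: "k \<in> {1..H} \<Longrightarrow> 1 \<le> \<omega> k \<Longrightarrow> Suc (tot (dec \<omega> k)) = tot \<omega>"
  using tot_upd[of k \<omega> "\<omega> k - 1"] by (simp add: dec_def)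

lemma avg_lip:
  assumes "j \<le> H" "\<And>A. A \<in> rows j \<Longrightarrow> \<bar>f (with_row X A) - f (with_row Y A)\<bar> \<le> R"
  shows "\<bar>avg j (\<lambda>A. f (with_row X A)) - avg j (\<lambda>A. f (with_row Y A))\<bar> \<le> R"
  using abs_avg_diff_le[of j "\<lambda>A. f (with_row X A)" "\<lambda>A. f (with_row Y A)" "\<lambda>_. R"] assms
  by (simp add: avg_const)

text \<open>The bound is affine in \<open>u x\<close>, so averaging over the added site and over the
  row only replaces \<open>u x\<close> by its mean.\<close>

lemma avg_moved_particle:
  assumes j: "j < H"
    and bound: "\<And>A x. A \<in> rows j \<Longrightarrow> x \<in> {1..H} - A \<Longrightarrow> \<bar>K A - G A x\<bar> \<le> M * (1 + (c + s * u x) / 14)"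
  shows "\<bar>avg j K - avg j (\<lambda>A. site_mean A (G A))\<bar> \<le> M * (1 + (c + s * avg j (\<lambda>A. site_mean A u)) / 14)"
proof -
  have "\<bar>avg j K - avg j (\<lambda>A. site_mean A (G A))\<bar> \<le> avg j (\<lambda>A. M * (1 + (c + s * site_mean A u) / 14))"
  proof (rule abs_avg_diff_le)
    fix A assume al: "A \<in> rows j"
    note ks = kern_sum[OF al j]
    have "K A - site_mean A (G A) = site_mean A (\<lambda>x. K A - G A x)"
      unfolding right_diff_distrib sum_subtractf sum_distrib_right[symmetric] ks by simp
    also have "\<bar>\<dots>\<bar> \<le> site_mean A (\<lambda>x. M * (1 + (c + s * u x) / 14))"
      using kern_nonneg bound[OF al]
      by (intro order_trans[OF sum_abs] sum_mono) (auto simp: abs_mult intro!: mult_left_mono)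
    also have "\<dots> = (\<Sum>x\<in>{1..H} - A. kern A x) * (M * (1 + c / 14)) + M * s / 14 * site_mean A u"
      unfolding sum_distrib_right sum_distrib_left sum.distrib[symmetric]
      by (intro sum.cong refl) (simp add: field_simps)
    also have "\<dots> = M * (1 + (c + s * site_mean A u) / 14)" unfolding ks by (simp add: field_simps)
    finally show "\<bar>K A - site_mean A (G A)\<bar> \<le> M * (1 + (c + s * site_mean A u) / 14)" .
  qed
  also have "\<dots> = avg j (\<lambda>A. M * (1 + c / 14) + M * s / 14 * site_mean A u)"
    by (intro avg_cong) (simp add: field_simps)
  also have "\<dots> = M * (1 + (c + s * avg j (\<lambda>A. site_mean A u)) / 14)"
    using j unfolding avg_add avg_cmult by (simp add: avg_const field_simps)
  finally show ?thesis .
qed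

text \<open>One row with \<open>m\<close> particles outside the columns \<open>k\<close>, \<open>l\<close> has been removed; \<open>\<xi>\<close> is what
  remains of the base configuration.\<close>

context
  fixes n m :: nat and f :: "(nat \<Rightarrow> nat) \<Rightarrow> real" and M :: real
    and \<xi> :: "nat \<Rightarrow> nat" and k l :: nat
  assumes M: "0 \<le> M" and lip: "conf_lip n M f"
    and \<xi>: "\<And>h. \<xi> h \<le> (if h \<in> {1..H} then N - 1 else 0)" and tot: "n = Suc (tot \<xi> + m)"
    and mH: "m + 2 \<le> H" and kl: "k \<in> {1..H}" "l \<in> {1..H}" "k \<noteq> l" and le: "\<xi> l \<le> \<xi> k"
begin

private definition "e = 1 / real N"
private definition "a = real (\<xi> k) / N"
private definition "b = real (\<xi> l) / N"
private definition "u h = real (\<xi> h) / N"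
private definition "Av j \<omega> = avg (m + j) (\<lambda>A. f (with_row \<omega> A))"

private lemma ab: "0 \<le> b" "b \<le> a" "a \<le> 1 - e" and e: "0 < e"
proof -
  have "real (\<xi> k) \<le> real N - 1" using \<xi>[of k] N_pos kl by (simp add: of_nat_diff[symmetric])
  then show "a \<le> 1 - e" using N_pos by (simp add: a_def e_def field_simps)
qed (use N_pos le in \<open>auto simp: a_def b_def e_def divide_right_mono\<close>)

private lemma u_bounds: "x \<in> {1..H} \<Longrightarrow> 0 \<le> u x \<and> u x \<le> 1"
proof -
  have "\<xi> x \<le> N" using \<xi>[of x] by (auto split: if_splits)
  then show ?thesis using N_pos by (simp add: u_def divide_le_eq)
qed

text \<open>The pair keeps its discrepancy at \<open>k\<close>, \<open>l\<close>; the removed row had \<open>i\<close> and \<open>j\<close> particles there.\<close>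

private lemma same_pair:
  assumes ij: "i \<le> 1" "j \<le> 1" "i \<le> \<xi> k" "j \<le> \<xi> l"
    and top: "Suc (\<xi> k) \<le> N - 1 + i" "Suc (\<xi> l) \<le> N - 1 + j" and al: "A \<in> rows (m + i + j)"
    and X: "X = inc (\<xi>(k := \<xi> k - i, l := \<xi> l - j)) k" and Y: "Y = inc (\<xi>(k := \<xi> k - i, l := \<xi> l - j)) l"
  shows "\<bar>f (with_row X A) - f (with_row Y A)\<bar> \<le> M * (1 + (dis a b + e * ((1 - real i) + 2 * b + (1 - a) + real j)) / 14)"
proof -
  let ?\<zeta> = "\<xi>(k := \<xi> k - i, l := \<xi> l - j)"
  let ?\<omega> = "with_row ?\<zeta> A"
  have "tot ?\<zeta> + (m + i + j) = tot \<xi> + m"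
    using tot_upd[of k \<xi> "\<xi> k - i"] tot_upd[of l "\<xi>(k := \<xi> k - i)" "\<xi> l - j"] ij kl by simp
  then have t: "tot ?\<omega> = tot \<xi> + m" using tot_with_row[OF al] by simp
  have bound: "?\<omega> h \<le> (if h \<in> {1..H} then N else 0)" for h
    using \<xi>[of h] rowsD(2)[OF al] kl N_pos by (auto simp: with_row_def split: if_splits)
  have "?\<omega> \<in> conf N (tot \<xi> + m)" using bound t by (simp add: conf_def)
  moreover have "?\<omega> k < N" "?\<omega> l < N" using top ij kl N_pos by (auto simp: with_row_def)
  ultimately have "\<bar>f (inc ?\<omega> k) - f (inc ?\<omega> l)\<bar> \<le> M * (1 + dis (real (?\<omega> k) / N) (real (?\<omega> l) / N) / 14)"
    using conf_lipD[OF lip _ tot kl] by simp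
  moreover have "inc ?\<omega> k = with_row X A" "inc ?\<omega> l = with_row Y A"
    by (auto simp: X Y inc_def with_row_def fun_eq_iff)
  moreover have "dis (real (?\<omega> k) / N) (real (?\<omega> l) / N) \<le> dis a b + e * ((1 - real i) + 2 * b + (1 - a) + real j)"
  proof -
    have "real (?\<omega> k) / N = a + e * (of_bool (k \<in> A) - real i)" "real (?\<omega> l) / N = b + e * (of_bool (l \<in> A) - real j)"
      using ij kl N_pos by (auto simp: with_row_def a_def b_def e_def of_nat_diff field_simps)
    moreover have "e \<le> a" if "real i = 1" using that ij N_pos by (simp add: e_def a_def divide_right_mono)
    moreover have "e \<le> b" if "real j = 1" using that ij N_pos by (simp add: e_def b_def divide_right_mono)
    moreover have "real i \<in> {0, 1}" "real j \<in> {0, 1}" using ij by auto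
    ultimately show ?thesis using dis_shift[OF ab less_imp_le[OF e]] by simp
  qed
  ultimately show ?thesis using M by (smt (verit, best) divide_right_mono mult_left_mono)
qed

private lemma same_pair_avg:
  assumes "i \<le> 1" "j \<le> 1" "i \<le> \<xi> k" "j \<le> \<xi> l"
    and "Suc (\<xi> k) \<le> N - 1 + i" "Suc (\<xi> l) \<le> N - 1 + j"
    and "X = inc (\<xi>(k := \<xi> k - i, l := \<xi> l - j)) k" and "Y = inc (\<xi>(k := \<xi> k - i, l := \<xi> l - j)) l"
  shows "\<bar>Av (i + j) X - Av (i + j) Y\<bar> \<le> M * (1 + (dis a b + e * ((1 - real i) + 2 * b + (1 - a) + real j)) / 14)"
  unfolding Av_def using assms mH
  by (intro avg_lip same_pair[where i = i and j = j]) (auto simp: add.assoc)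

text \<open>By \<open>avg_Suc\<close> a row of size \<open>m + 2\<close> is one of size
  \<open>m + 1\<close> with a random extra site \<open>x\<close>, so the second configuration is the
  first with a particle moved from \<open>k\<close> to \<open>x\<close>. The density at
  \<open>k\<close> is at least \<open>a - e\<close>, and \<open>e \<le> 1 - a\<close> turns
  \<open>(1 - a) + e\<close> into \<open>2 * (1 - a)\<close>.\<close>

private lemma moved_down:
  assumes lt: "\<xi> l < \<xi> k"
  shows "\<bar>Av 1 \<xi> - Av 2 (dec \<xi> k)\<bar> \<le> M * (1 + (2 * (1 - a) + 1 + - 1 * avg (Suc m) (\<lambda>A. site_mean A u)) / 14)"
proof -
  have A2: "Av 2 (dec \<xi> k) = avg (Suc m) (\<lambda>A. site_mean A (\<lambda>x. f (with_row (dec \<xi> k) (insert x A))))"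
    using avg_Suc[of "Suc m"] mH by (simp add: Av_def)
  show ?thesis
    unfolding A2 unfolding Av_def Suc_eq_plus1[symmetric]
  proof (rule avg_moved_particle)
    fix A x assume al: "A \<in> rows (Suc m)" and x: "x \<in> {1..H} - A"
    show "\<bar>f (with_row \<xi> A) - f (with_row (dec \<xi> k) (insert x A))\<bar> \<le> M * (1 + (2 * (1 - a) + 1 + - 1 * u x) / 14)"
    proof (cases "x = k")
      case True
      then have "with_row (dec \<xi> k) (insert x A) = with_row \<xi> A"
        using x lt by (auto simp: with_row_def dec_def fun_eq_iff)
      moreover have "u x \<le> 1" "a \<le> 1" using u_bounds x ab e by auto
      ultimately show ?thesis using M by simp
    next
      case False
      let ?\<omega> = "with_row (dec \<xi> k) A"
      have "Suc (tot (dec \<xi> k)) = tot \<xi>" using lt kl by (intro tot_dec) auto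
      then have t: "tot ?\<omega> = tot \<xi> + m" using tot_with_row[OF al] by simp
      have "?\<omega> h \<le> (if h \<in> {1..H} then N else 0)" for h
        using \<xi>[of h] rowsD(2)[OF al] kl N_pos by (auto simp: with_row_def dec_def split: if_splits)
      then have "?\<omega> \<in> conf N (tot \<xi> + m)" using t by (simp add: conf_def)
      moreover have "?\<omega> k < N" "?\<omega> x < N"
        using \<xi>[of k] \<xi>[of x] lt x kl N_pos False by (auto simp: with_row_def dec_def)
      moreover have "inc ?\<omega> k = with_row \<xi> A" "inc ?\<omega> x = with_row (dec \<xi> k) (insert x A)"
        using lt x False by (auto simp: inc_def with_row_def dec_def fun_eq_iff)
      ultimately have "\<bar>f (with_row \<xi> A) - f (with_row (dec \<xi> k) (insert x A))\<bar>
          \<le> M * (1 + dis (real (?\<omega> k) / N) (real (?\<omega> x) / N) / 14)"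
        using conf_lipD[OF lip _ tot kl(1), of ?\<omega> x] x False by simp
      moreover have "dis (real (?\<omega> k) / N) (real (?\<omega> x) / N) \<le> 2 * (1 - a) + 1 - u x"
      proof -
        have ux: "real (?\<omega> x) / N = u x" using x False by (simp add: with_row_def dec_def u_def)
        have "real (\<xi> k) - 1 \<le> real (?\<omega> k)" using lt by (simp add: with_row_def dec_def of_nat_diff)
        then have low: "a - e \<le> real (?\<omega> k) / N"
          using N_pos by (simp add: a_def e_def diff_divide_distrib[symmetric] divide_right_mono)
        define y where "y = real (?\<omega> k) / N"
        have "y \<le> 1" using \<open>?\<omega> k < N\<close> by (simp add: y_def divide_le_eq)
        then have "dis y (u x) \<le> (1 - y) + (1 - u x)"
          using u_bounds[of x] x by (intro dis_le_compl) auto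
        then show ?thesis unfolding ux using low ab unfolding y_def[symmetric] by (smt (verit))
      qed
      ultimately show ?thesis using M by (smt (verit, best) divide_right_mono mult_left_mono)
    qed
  qed (use mH in simp)
qed

text \<open>Now the particle at the random site \<open>x\<close> is compared with one at
  \<open>l\<close>. The inserted row may raise the density at \<open>l\<close> by \<open>e\<close>,
  which is absorbed by \<open>e \<le> 1 - a\<close>.\<close>

private lemma moved_up:
  assumes lt: "\<xi> l < \<xi> k"
  shows "\<bar>Av 1 \<xi> - Av 0 (inc \<xi> l)\<bar> \<le> M * (1 + (b + (1 - a) + 1 * avg m (\<lambda>A. site_mean A u)) / 14)"
proof -
  have A1: "Av 1 \<xi> = avg m (\<lambda>A. site_mean A (\<lambda>x. f (with_row \<xi> (insert x A))))"
    using avg_Suc[of m] mH by (simp add: Av_def)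
  show ?thesis
    unfolding A1 abs_minus_commute[of _ "Av 0 (inc \<xi> l)"] unfolding Av_def add_0_right
  proof (rule avg_moved_particle)
    fix A x assume al: "A \<in> rows m" and x: "x \<in> {1..H} - A"
    have "\<bar>f (with_row \<xi> (insert x A)) - f (with_row (inc \<xi> l) A)\<bar> \<le> M * (1 + (b + (1 - a) + 1 * u x) / 14)"
    proof (cases "x = l")
      case True
      then have "with_row \<xi> (insert x A) = with_row (inc \<xi> l) A"
        using x by (auto simp: with_row_def inc_def fun_eq_iff)
      moreover have "0 \<le> u x" "a \<le> 1" "0 \<le> b" using u_bounds x ab e by auto
      ultimately show ?thesis using M by simp
    next
      case False
      let ?\<omega> = "with_row \<xi> A"
      have t: "tot ?\<omega> = tot \<xi> + m" using tot_with_row[OF al] by simp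
      have "?\<omega> h \<le> (if h \<in> {1..H} then N else 0)" for h
        using \<xi>[of h] rowsD(2)[OF al] kl N_pos by (auto simp: with_row_def split: if_splits)
      then have "?\<omega> \<in> conf N (tot \<xi> + m)" using t by (simp add: conf_def)
      moreover have "?\<omega> l < N" "?\<omega> x < N"
        using \<xi>[of k] \<xi>[of x] lt x kl N_pos False by (auto simp: with_row_def)
      moreover have "inc ?\<omega> x = with_row \<xi> (insert x A)" "inc ?\<omega> l = with_row (inc \<xi> l) A"
        using x False by (auto simp: inc_def with_row_def fun_eq_iff)
      ultimately have "\<bar>f (with_row \<xi> (insert x A)) - f (with_row (inc \<xi> l) A)\<bar>
          \<le> M * (1 + dis (real (?\<omega> x) / N) (real (?\<omega> l) / N) / 14)"
        using conf_lipD[OF lip _ tot _ kl(2), of ?\<omega> x] x False by simp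
      moreover have "dis (real (?\<omega> x) / N) (real (?\<omega> l) / N) \<le> b + (1 - a) + u x"
      proof -
        have ux: "real (?\<omega> x) / N = u x" using x False by (simp add: with_row_def u_def)
        have "real (?\<omega> l) \<le> real (\<xi> l) + 1" by (simp add: with_row_def)
        then have up: "real (?\<omega> l) / N \<le> b + e"
          using N_pos by (simp add: b_def e_def add_divide_distrib[symmetric] divide_right_mono)
        have "dis (u x) (real (?\<omega> l) / N) \<le> u x + real (?\<omega> l) / N"
          using u_bounds[of x] x by (intro dis_le_add) auto
        then show ?thesis unfolding ux using up ab by linarith
      qed
      ultimately show ?thesis using M by (smt (verit, best) divide_right_mono mult_left_mono)
    qed
    then show "\<bar>f (with_row (inc \<xi> l) A) - f (with_row \<xi> (insert x A))\<bar> \<le> M * (1 + (b + (1 - a) + 1 * u x) / 14)"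
      by (simp only: abs_minus_commute)
  qed (use mH in simp)
qed

private lemma moved_total:
  "e * (a - b) * (\<bar>Av 1 \<xi> - Av 2 (dec \<xi> k)\<bar> + \<bar>Av 1 \<xi> - Av 0 (inc \<xi> l)\<bar>)
    \<le> M * (e * (a - b) * (2 + (3 * (1 - a) + b + 2 - overlap) / 14))"
proof (cases "\<xi> l < \<xi> k")
  case True
  have "avg m (\<lambda>A. site_mean A u)
      \<le> avg (Suc m) (\<lambda>A. site_mean A u) + 1 - overlap"
    using mH u_bounds by (intro added_sites_overlap) auto
  then have "1 + (2 * (1 - a) + 1 + - 1 * avg (Suc m) (\<lambda>A. site_mean A u)) / 14
      + (1 + (b + (1 - a) + 1 * avg m (\<lambda>A. site_mean A u)) / 14)
      \<le> 2 + (3 * (1 - a) + b + 2 - overlap) / 14" by (simp add: field_simps)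
  from mult_left_mono[OF this M]
  have "\<bar>Av 1 \<xi> - Av 2 (dec \<xi> k)\<bar> + \<bar>Av 1 \<xi> - Av 0 (inc \<xi> l)\<bar> \<le> M * (2 + (3 * (1 - a) + b + 2 - overlap) / 14)"
    unfolding distrib_left[of M "1 + (2 * (1 - a) + 1 + - 1 * avg (Suc m) (\<lambda>A. site_mean A u)) / 14"]
    by (rule order_trans[OF add_mono[OF moved_down[OF True] moved_up[OF True]]])
  then have "e * (a - b) * (\<bar>Av 1 \<xi> - Av 2 (dec \<xi> k)\<bar> + \<bar>Av 1 \<xi> - Av 0 (inc \<xi> l)\<bar>)
      \<le> e * (a - b) * (M * (2 + (3 * (1 - a) + b + 2 - overlap) / 14))"
    using ab e by (intro mult_left_mono) auto
  then show ?thesis by (simp add: mult.left_commute mult.assoc)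
next
  case False
  then have "a = b" using le by (simp add: a_def b_def)
  then show ?thesis by simp
qed

lemma one_row_contraction:
  defines "\<epsilon> \<equiv> 1 / real N"
  defines "p \<equiv> real (\<xi> k) / N"
  defines "r \<equiv> real (\<xi> l) / N"
  defines "R j \<omega> \<equiv> avg (m + j) (\<lambda>A. f (with_row \<omega> A))"
  shows "\<bar>((1 - (p + \<epsilon>)) * (1 - r) * R 0 (inc \<xi> k) + (p + \<epsilon>) * (1 - r) * R 1 \<xi>
      + (1 - (p + \<epsilon>)) * r * R 1 (inc (dec \<xi> l) k) + (p + \<epsilon>) * r * R 2 (dec \<xi> l))
    - ((1 - (r + \<epsilon>)) * (1 - p) * R 0 (inc \<xi> l) + (r + \<epsilon>) * (1 - p) * R 1 \<xi>
      + (1 - (r + \<epsilon>)) * p * R 1 (inc (dec \<xi> k) l) + (r + \<epsilon>) * p * R 2 (dec \<xi> k))\<bar>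
    \<le> (1 - \<epsilon> * overlap / 28) * (M * (1 + dis p r / 14))" (is "\<bar>?X - ?Y\<bar> \<le> _")
proof -
  have defs: "\<epsilon> = e" "p = a" "r = b" "R = Av" by (simp_all add: \<epsilon>_def p_def r_def R_def e_def a_def b_def Av_def fun_eq_iff)
  define T11 where "T11 = Av 2 (dec \<xi> l) - Av 2 (dec \<xi> k)"
  define T00 where "T00 = Av 0 (inc \<xi> k) - Av 0 (inc \<xi> l)"
  define T01 where "T01 = Av 1 (inc (dec \<xi> l) k) - Av 1 \<xi>"
  define T10 where "T10 = Av 1 \<xi> - Av 1 (inc (dec \<xi> k) l)"
  define E1 where "E1 = Av 1 \<xi> - Av 2 (dec \<xi> k)"
  define E2 where "E2 = Av 1 \<xi> - Av 0 (inc \<xi> l)"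
  have N: "0 < real N" using N_pos by simp
  have kN: "\<xi> k \<le> N - 1" "\<xi> l \<le> N - 1" using \<xi>[of k] \<xi>[of l] kl by auto
  \<comment> \<open>A coupling of the removed rows. The four \<open>T\<close> terms keep the
    discrepancy at \<open>k\<close>, \<open>l\<close>. Of what is left of \<open>Av 1 \<xi>\<close>,
    mass \<open>e * (1 - a + b)\<close> is common to both sides and cancels; the surplus
    \<open>2 * e * (a - b)\<close> in \<open>?X\<close> faces equal surpluses of
    \<open>Av 2 (dec \<xi> k)\<close> and \<open>Av 0 (inc \<xi> l)\<close> in
    \<open>?Y\<close>.\<close>
  have decomp: "?X - ?Y = (a * b + b * e) * T11 + (1 - a - e) * (1 - b) * T00 + (1 - a - e) * b * T01
      + a * (1 - b - e) * T10 + e * (a - b) * (E1 + E2)"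
    unfolding defs T11_def T00_def T01_def T10_def E1_def E2_def by (simp add: algebra_simps)
  have nonneg: "0 \<le> a * b + b * e" "0 \<le> (1 - a - e) * (1 - b)" "0 \<le> (1 - a - e) * b" "0 \<le> a * (1 - b - e)" "0 \<le> e * (a - b)"
    using ab e by auto
  \<comment> \<open>The occupation bounds asked for by \<open>same_pair_avg\<close> can fail only
    where the coefficient of the term vanishes; this and the next three facts record it.\<close>
  have ltk: "Suc (\<xi> k) \<le> N - 1" if "1 - a - e \<noteq> 0"
  proof (rule ccontr)
    assume "\<not> Suc (\<xi> k) \<le> N - 1"
    then have "Suc (\<xi> k) = N" using kN N_pos by simp
    then have "real (\<xi> k) + 1 = real N" by (metis of_nat_Suc add.commute)
    moreover have "1 - a - e = (real N - (real (\<xi> k) + 1)) / N" using N by (simp add: a_def e_def field_simps)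
    ultimately show False using that by simp
  qed
  have ltl: "Suc (\<xi> l) \<le> N - 1" if "1 - b - e \<noteq> 0"
  proof (rule ccontr)
    assume "\<not> Suc (\<xi> l) \<le> N - 1"
    then have "Suc (\<xi> l) = N" using kN N_pos by simp
    then have "real (\<xi> l) + 1 = real N" by (metis of_nat_Suc add.commute)
    moreover have "1 - b - e = (real N - (real (\<xi> l) + 1)) / N" using N by (simp add: b_def e_def field_simps)
    ultimately show False using that by simp
  qed
  have gtl: "1 \<le> \<xi> l" if "b \<noteq> 0" using that by (cases "\<xi> l") (auto simp: b_def)
  have gtk: "1 \<le> \<xi> k" if "a \<noteq> 0" using that by (cases "\<xi> k") (auto simp: a_def)
  have b11: "(a * b + b * e) * \<bar>T11\<bar> \<le> M * ((a * b + b * e) * (1 + (dis a b + e * (2 * b + (1 - a) + 1)) / 14))"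
  proof (cases "b = 0")
    case False
    have "\<bar>Av (1 + 1) (dec \<xi> l) - Av (1 + 1) (dec \<xi> k)\<bar>
        \<le> M * (1 + (dis a b + e * ((1 - real 1) + 2 * b + (1 - a) + real 1)) / 14)"
      using gtl[OF False] le kN kl by (intro same_pair_avg) (auto simp: inc_def dec_def fun_eq_iff)
    then have "\<bar>T11\<bar> \<le> M * (1 + (dis a b + e * (2 * b + (1 - a) + 1)) / 14)" by (simp add: T11_def numeral_2_eq_2)
    from mult_left_mono[OF this nonneg(1)] show ?thesis by (simp only: mult.left_commute)
  qed simp
  have b00: "(1 - a - e) * (1 - b) * \<bar>T00\<bar> \<le> M * ((1 - a - e) * (1 - b) * (1 + (dis a b + e * (1 + 2 * b + (1 - a))) / 14))"
  proof (cases "1 - a - e = 0")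
    case False
    have "\<bar>Av (0 + 0) (inc \<xi> k) - Av (0 + 0) (inc \<xi> l)\<bar>
        \<le> M * (1 + (dis a b + e * ((1 - real 0) + 2 * b + (1 - a) + real 0)) / 14)"
      using ltk[OF False] le kN kl by (intro same_pair_avg) (auto simp: inc_def dec_def fun_eq_iff)
    then have "\<bar>T00\<bar> \<le> M * (1 + (dis a b + e * (1 + 2 * b + (1 - a))) / 14)" by (simp add: T00_def)
    from mult_left_mono[OF this nonneg(2)] show ?thesis by (simp only: mult.left_commute)
  qed simp
  have b01: "(1 - a - e) * b * \<bar>T01\<bar> \<le> M * ((1 - a - e) * b * (1 + (dis a b + e * (1 + 2 * b + (1 - a) + 1)) / 14))"
  proof (cases "1 - a - e = 0 \<or> b = 0")
    case False
    then have nz: "1 - a - e \<noteq> 0" "b \<noteq> 0" by auto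
    have "\<bar>Av (0 + 1) (inc (dec \<xi> l) k) - Av (0 + 1) \<xi>\<bar>
        \<le> M * (1 + (dis a b + e * ((1 - real 0) + 2 * b + (1 - a) + real 1)) / 14)"
      using ltk[OF nz(1)] gtl[OF nz(2)] le kN kl by (intro same_pair_avg) (auto simp: inc_def dec_def fun_eq_iff)
    then have "\<bar>T01\<bar> \<le> M * (1 + (dis a b + e * (1 + 2 * b + (1 - a) + 1)) / 14)" by (simp add: T01_def)
    from mult_left_mono[OF this nonneg(3)] show ?thesis by (simp only: mult.left_commute)
  qed auto
  have b10: "a * (1 - b - e) * \<bar>T10\<bar> \<le> M * (a * (1 - b - e) * (1 + (dis a b + e * (2 * b + (1 - a))) / 14))"
  proof (cases "a = 0 \<or> 1 - b - e = 0")
    case False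
    then have nz: "a \<noteq> 0" "1 - b - e \<noteq> 0" by auto
    have "\<bar>Av (1 + 0) \<xi> - Av (1 + 0) (inc (dec \<xi> k) l)\<bar>
        \<le> M * (1 + (dis a b + e * ((1 - real 1) + 2 * b + (1 - a) + real 0)) / 14)"
      using ltl[OF nz(2)] gtk[OF nz(1)] le kN kl by (intro same_pair_avg) (auto simp: inc_def dec_def fun_eq_iff)
    then have "\<bar>T10\<bar> \<le> M * (1 + (dis a b + e * (2 * b + (1 - a))) / 14)" by (simp add: T10_def)
    from mult_left_mono[OF this nonneg(4)] show ?thesis by (simp only: mult.left_commute)
  qed auto
  have bE: "e * (a - b) * \<bar>E1 + E2\<bar> \<le> M * (e * (a - b) * (2 + (3 * (1 - a) + b + 2 - overlap) / 14))"
    using mult_left_mono[OF abs_triangle_ineq[of E1 E2] nonneg(5)] moved_total by (simp add: E1_def E2_def)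
  have abs_w: "\<bar>v * T\<bar> \<le> v * \<bar>T\<bar>" if "0 \<le> v" for v T :: real
    using that by (simp add: abs_mult)
  have "\<bar>?X - ?Y\<bar> \<le> (a * b + b * e) * \<bar>T11\<bar> + (1 - a - e) * (1 - b) * \<bar>T00\<bar> + (1 - a - e) * b * \<bar>T01\<bar>
      + a * (1 - b - e) * \<bar>T10\<bar> + e * (a - b) * \<bar>E1 + E2\<bar>"
    unfolding decomp
    by (intro order_trans[OF abs_triangle_ineq] add_mono abs_w nonneg)
  also have "\<dots> \<le> M * ((1 - e * overlap / 28) * (1 + dis a b / 14))"
    using b11 b00 b01 b10 bE
      mult_left_mono[OF contraction_budget[OF ab less_imp_le[OF e] less_imp_le[OF overlap_pos] overlap_le_1] M]
    by (simp only: distrib_left)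
  finally show ?thesis unfolding defs by (simp only: mult.left_commute)
qed

end

end

section \<open>The gap of the occupation number process\<close>

lemma sum_Pow_insert:
  fixes G :: "'a set \<Rightarrow> 'b::comm_monoid_add"
  assumes "finite U" "x \<notin> U"
  shows "(\<Sum>A\<in>Pow (insert x U). G A) = (\<Sum>A\<in>Pow U. G A + G (insert x A))"
proof -
  have "(\<Sum>A\<in>Pow (insert x U). G A) = (\<Sum>A\<in>Pow U. G A) + (\<Sum>A\<in>insert x ` Pow U. G A)"
    unfolding Pow_insert using assms by (intro sum.union_disjoint) auto
  also have "(\<Sum>A\<in>insert x ` Pow U. G A) = (\<Sum>A\<in>Pow U. G (insert x A))"
    using assms by (subst sum.reindex) (auto simp: inj_on_def)
  finally show ?thesis by (simp add: sum.distrib)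
qed

context spin_rows
begin

text \<open>The law of one row of the array when each column is uniformly shuffled: independent bits
  with means \<open>\<omega> h / N\<close>.\<close>

definition pr :: "(nat \<Rightarrow> nat) \<Rightarrow> nat set \<Rightarrow> nat set \<Rightarrow> real" where
  "pr \<omega> U A = (\<Prod>h\<in>U. if h \<in> A then real (\<omega> h) / N else 1 - real (\<omega> h) / N)"

definition resample :: "((nat \<Rightarrow> nat) \<Rightarrow> real) \<Rightarrow> (nat \<Rightarrow> nat) \<Rightarrow> real" where
  "resample f \<omega> = (\<Sum>A\<in>Pow {1..H}. pr \<omega> {1..H} A * avg (card A) (\<lambda>B. f (with_row (without_row \<omega> A) B)))"

lemma pr_insert:
  assumes "finite U" "x \<notin> U" "A \<subseteq> U"
  shows "pr \<omega> (insert x U) A = (1 - real (\<omega> x) / N) * pr \<omega> U A"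
    and "pr \<omega> (insert x U) (insert x A) = real (\<omega> x) / N * pr \<omega> U A"
proof -
  have "x \<notin> A" using assms by auto
  then show "pr \<omega> (insert x U) A = (1 - real (\<omega> x) / N) * pr \<omega> U A"
    using assms by (simp add: pr_def)
  have "pr \<omega> U (insert x A) = pr \<omega> U A" unfolding pr_def using assms by (intro prod.cong) auto
  then show "pr \<omega> (insert x U) (insert x A) = real (\<omega> x) / N * pr \<omega> U A"
    using assms by (simp add: pr_def)
qed

lemma sum_pr:
  assumes "finite U"
  shows "(\<Sum>A\<in>Pow U. pr \<omega> U A) = 1"
  using assms
proof (induction U)
  case (insert x U)
  have "(\<Sum>A\<in>Pow (insert x U). pr \<omega> (insert x U) A) = (\<Sum>A\<in>Pow U. pr \<omega> U A)"
    unfolding sum_Pow_insert[OF insert.hyps]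
    using insert.hyps by (intro sum.cong) (auto simp: pr_insert algebra_simps)
  then show ?case using insert.IH by simp
qed (simp add: pr_def)

lemma pr_cong: "(\<And>h. h \<in> U \<Longrightarrow> \<omega> h = \<eta> h) \<Longrightarrow> pr \<omega> U A = pr \<eta> U A"
  unfolding pr_def by (intro prod.cong) auto

lemma pr_nonneg: "(\<And>h. h \<in> U \<Longrightarrow> \<omega> h \<le> N) \<Longrightarrow> 0 \<le> pr \<omega> U A"
  unfolding pr_def using N_pos by (intro prod_nonneg) (auto simp: divide_le_eq)

lemma pr_nonzeroD:
  assumes "pr \<omega> U A \<noteq> 0" "finite U" "h \<in> U"
  shows "h \<in> A \<Longrightarrow> 1 \<le> \<omega> h" "h \<notin> A \<Longrightarrow> \<omega> h \<noteq> N"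
proof -
  have nz: "(if h \<in> A then real (\<omega> h) / N else 1 - real (\<omega> h) / N) \<noteq> 0"
    using assms unfolding pr_def by (simp add: prod_zero_iff)
  show "1 \<le> \<omega> h" if "h \<in> A" using nz that by (cases "\<omega> h") auto
  show "\<omega> h \<noteq> N" if "h \<notin> A" using nz that N_pos by auto
qed

lemma sum_Pow_two_sites:
  fixes G :: "nat set \<Rightarrow> real"
  assumes "k \<in> {1..H}" "l \<in> {1..H}" "k \<noteq> l"
  defines "U \<equiv> {1..H} - {k, l}"
  shows "(\<Sum>A\<in>Pow {1..H}. pr \<omega> {1..H} A * G A) = (\<Sum>B\<in>Pow U. pr \<omega> U B *
     ((1 - real (\<omega> k) / N) * (1 - real (\<omega> l) / N) * G B
      + real (\<omega> k) / N * (1 - real (\<omega> l) / N) * G (insert k B)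
      + (1 - real (\<omega> k) / N) * (real (\<omega> l) / N) * G (insert l B)
      + real (\<omega> k) / N * (real (\<omega> l) / N) * G (insert k (insert l B))))"
proof -
  have fin: "finite U" "l \<notin> U" "finite (insert l U)" "k \<notin> insert l U" using assms by auto
  have H: "{1..H} = insert k (insert l U)" using assms(1,2) unfolding U_def by blast
  show ?thesis
    unfolding H sum_Pow_insert[OF fin(3,4)] sum_Pow_insert[OF fin(1,2)]
  proof (intro sum.cong refl)
    fix B assume "B \<in> Pow U"
    then have b: "B \<subseteq> U" "B \<subseteq> insert l U" "insert l B \<subseteq> insert l U" by auto
    define s where "s = real (\<omega> k) / N"
    define r where "r = real (\<omega> l) / N"
    show "pr \<omega> (insert k (insert l U)) B * G B + pr \<omega> (insert k (insert l U)) (insert k B) * G (insert k B)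
      + (pr \<omega> (insert k (insert l U)) (insert l B) * G (insert l B)
        + pr \<omega> (insert k (insert l U)) (insert k (insert l B)) * G (insert k (insert l B)))
      = pr \<omega> U B *
     ((1 - real (\<omega> k) / N) * (1 - real (\<omega> l) / N) * G B
      + real (\<omega> k) / N * (1 - real (\<omega> l) / N) * G (insert k B)
      + (1 - real (\<omega> k) / N) * (real (\<omega> l) / N) * G (insert l B)
      + real (\<omega> k) / N * (real (\<omega> l) / N) * G (insert k (insert l B)))"
      unfolding pr_insert[OF fin(3,4) b(2)] pr_insert[OF fin(3,4) b(3)] pr_insert[OF fin(1,2) b(1)]
        s_def[symmetric] r_def[symmetric] by (simp add: algebra_simps)
  qed
qed

lemma with_without_row:
  assumes "\<omega> \<in> conf N n" "pr \<omega> {1..H} A \<noteq> 0" "A \<subseteq> {1..H}"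
  shows "with_row (without_row \<omega> A) A = \<omega>"
proof
  fix h
  show "with_row (without_row \<omega> A) A h = \<omega> h"
  proof (cases "h \<in> A")
    case True
    then have "1 \<le> \<omega> h" using pr_nonzeroD(1)[OF assms(2), of h] assms(3) by auto
    then show ?thesis using True by (simp add: with_row_def without_row_def)
  qed (simp add: with_row_def without_row_def)
qed

lemma confD:
  assumes "\<omega> \<in> conf K n" "h \<in> {1..H}"
  shows "\<omega> h \<le> K"
proof -
  have "\<omega> h \<le> (if h \<in> {1..H} then K else 0)" using assms(1) unfolding conf_def by blast
  then show ?thesis using assms(2) by simp
qed

text \<open>\<open>B\<close> is the part of the removed row outside \<open>k\<close> and
  \<open>l\<close>. Its law does not feel the extra particle, so conditioning on it leaves the four
  cases treated by \<open>one_row_contraction\<close>.\<close>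

lemma resample_inc:
  fixes f :: "(nat \<Rightarrow> nat) \<Rightarrow> real" and \<omega> :: "nat \<Rightarrow> nat"
  assumes kl: "k \<in> {1..H}" "l \<in> {1..H}" "k \<noteq> l"
  defines "U \<equiv> {1..H} - {k, l}" and "s \<equiv> real (\<omega> k) / N" and "r \<equiv> real (\<omega> l) / N" and "e \<equiv> 1 / real N"
    and "R \<equiv> \<lambda>B j \<eta>. avg (card B + j) (\<lambda>A. f (with_row \<eta> A))"
  shows "resample f (inc \<omega> k) = (\<Sum>B\<in>Pow U. pr \<omega> U B *
    ((1 - (s + e)) * (1 - r) * R B 0 (inc (without_row \<omega> B) k) + (s + e) * (1 - r) * R B 1 (without_row \<omega> B)
      + (1 - (s + e)) * r * R B 1 (inc (dec (without_row \<omega> B) l) k) + (s + e) * r * R B 2 (dec (without_row \<omega> B) l)))"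
proof -
  have U: "finite U" "k \<notin> U" "l \<notin> U" by (auto simp: U_def)
  have occ: "real (inc \<omega> k k) / N = s + e" "real (inc \<omega> k l) / N = r"
    using kl by (auto simp: inc_def s_def r_def e_def add_divide_distrib)
  show ?thesis
    unfolding resample_def sum_Pow_two_sites[OF kl] U_def[symmetric] occ
  proof (intro sum.cong refl arg_cong2[where f = "(*)"])
    fix B assume b: "B \<in> Pow U"
    have nb: "k \<notin> B" "l \<notin> B" "finite B" using b U finite_subset[of B U] by auto
    have card: "card (insert k B) = card B + 1" "card (insert l B) = card B + 1"
      "card (insert k (insert l B)) = card B + 2" using nb kl(3) by simp_all
    show "pr (inc \<omega> k) U B = pr \<omega> U B" using U by (intro pr_cong) (auto simp: inc_def)
    have "without_row (inc \<omega> k) B = inc (without_row \<omega> B) k" "without_row (inc \<omega> k) (insert k B) = without_row \<omega> B"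
      "without_row (inc \<omega> k) (insert l B) = inc (dec (without_row \<omega> B) l) k"
      "without_row (inc \<omega> k) (insert k (insert l B)) = dec (without_row \<omega> B) l"
      using nb kl by (auto simp: without_row_def inc_def dec_def fun_eq_iff)
    then show "(1 - (s + e)) * (1 - r) * avg (card B) (\<lambda>A. f (with_row (without_row (inc \<omega> k) B) A))
      + (s + e) * (1 - r) * avg (card (insert k B)) (\<lambda>A. f (with_row (without_row (inc \<omega> k) (insert k B)) A))
      + (1 - (s + e)) * r * avg (card (insert l B)) (\<lambda>A. f (with_row (without_row (inc \<omega> k) (insert l B)) A))
      + (s + e) * r * avg (card (insert k (insert l B))) (\<lambda>A. f (with_row (without_row (inc \<omega> k) (insert k (insert l B))) A))
      = (1 - (s + e)) * (1 - r) * R B 0 (inc (without_row \<omega> B) k) + (s + e) * (1 - r) * R B 1 (without_row \<omega> B)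
      + (1 - (s + e)) * r * R B 1 (inc (dec (without_row \<omega> B) l) k) + (s + e) * r * R B 2 (dec (without_row \<omega> B) l)"
      unfolding card R_def by simp
  qed
qed

lemma resample_contraction_ordered:
  assumes M: "0 \<le> M" and lip: "conf_lip n M f" and p: "(\<omega>, k, l) \<in> pairs n" and le: "\<omega> l \<le> \<omega> k"
  shows "\<bar>resample f (inc \<omega> k) - resample f (inc \<omega> l)\<bar>
    \<le> (1 - overlap / (28 * real N)) * M * pair_dist (\<omega>, k, l)"
proof -
  have kl: "k \<in> {1..H}" "l \<in> {1..H}" "k \<noteq> l" and top: "\<omega> k < N" "\<omega> l < N"
    and \<omega>: "\<omega> \<in> conf N (n - 1)" and n: "1 \<le> n" using p by (auto simp: pairs_def)
  define U where "U = {1..H} - {k, l}"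
  have U: "finite U" "k \<notin> U" "l \<notin> U" by (auto simp: U_def)
  define r where "r = real (\<omega> l) / N"
  define s where "s = real (\<omega> k) / N"
  define e where "e = 1 / real N"
  define R where "R B j \<eta> = avg (card B + j) (\<lambda>A. f (with_row \<eta> A))" for B :: "nat set" and j \<eta>
  define X where "X B = (1 - (s + e)) * (1 - r) * R B 0 (inc (without_row \<omega> B) k) + (s + e) * (1 - r) * R B 1 (without_row \<omega> B)
      + (1 - (s + e)) * r * R B 1 (inc (dec (without_row \<omega> B) l) k) + (s + e) * r * R B 2 (dec (without_row \<omega> B) l)" for B
  define Y where "Y B = (1 - (r + e)) * (1 - s) * R B 0 (inc (without_row \<omega> B) l) + (r + e) * (1 - s) * R B 1 (without_row \<omega> B)
      + (1 - (r + e)) * s * R B 1 (inc (dec (without_row \<omega> B) k) l) + (r + e) * s * R B 2 (dec (without_row \<omega> B) k)" for B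
  let ?B = "(1 - e * overlap / 28) * (M * (1 + dis s r / 14))"
  have X: "resample f (inc \<omega> k) = (\<Sum>B\<in>Pow U. pr \<omega> U B * X B)"
    unfolding resample_inc[OF kl] U_def X_def R_def s_def r_def e_def ..
  have Y: "resample f (inc \<omega> l) = (\<Sum>B\<in>Pow U. pr \<omega> U B * Y B)"
    unfolding resample_inc[OF kl(2,1) kl(3)[symmetric]] insert_commute[of l k]
    unfolding U_def Y_def R_def s_def r_def e_def ..
  have le_N: "\<omega> h \<le> (if h \<in> {1..H} then N else 0)" for h using \<omega> by (simp add: conf_def)
  \<comment> \<open>Sets \<open>B\<close> of probability zero are set aside, since for them the
    remainder may exceed \<open>N - 1\<close> in some column or the row cannot be restored.\<close>
  have bound: "\<bar>pr \<omega> U B * X B - pr \<omega> U B * Y B\<bar> \<le> pr \<omega> U B * ?B" if b: "B \<in> Pow U" for B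
  proof (cases "pr \<omega> U B = 0")
    case False
    let ?\<xi> = "without_row \<omega> B"
    note nz = pr_nonzeroD[OF False U(1)]
    have \<xi>: "?\<xi> h \<le> (if h \<in> {1..H} then N - 1 else 0)" for h
    proof (cases "h \<in> U")
      case True
      then show ?thesis using nz[OF True] le_N[of h] by (auto simp: without_row_def U_def)
    next
      case False
      then have "h \<notin> B" using b by auto
      then show ?thesis using False le_N[of h] top by (cases "h = k \<or> h = l") (auto simp: without_row_def U_def split: if_splits)
    qed
    have row: "B \<in> rows (card B)" using b by (auto simp: rows_def U_def)
    have "with_row ?\<xi> B = \<omega>" using nz(1) b by (fastforce simp: with_row_def without_row_def fun_eq_iff)
    then have "tot ?\<xi> + card B = n - 1" using tot_with_row[OF row, of ?\<xi>] \<omega> by (simp add: conf_def)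
    then have tot: "n = Suc (tot ?\<xi> + card B)" using n by simp
    have "card B \<le> card U" using b U(1) by (intro card_mono) auto
    moreover have "card U = H - 2" using kl by (simp add: U_def card_Diff_subset)
    moreover have "2 \<le> H" using kl by auto
    ultimately have cardb: "card B + 2 \<le> H" by simp
    have kl0: "?\<xi> k = \<omega> k" "?\<xi> l = \<omega> l" using b U by (auto simp: without_row_def)
    have "\<bar>X B - Y B\<bar> \<le> ?B"
      using one_row_contraction[OF M lip \<xi> tot cardb kl] le
      unfolding kl0 X_def Y_def R_def s_def r_def e_def by simp
    then have "pr \<omega> U B * \<bar>X B - Y B\<bar> \<le> pr \<omega> U B * ?B"
      by (intro mult_left_mono pr_nonneg confD[OF \<omega>]) (auto simp: U_def)
    moreover have "0 \<le> pr \<omega> U B" by (intro pr_nonneg confD[OF \<omega>]) (auto simp: U_def)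
    ultimately show ?thesis by (simp add: right_diff_distrib[symmetric] abs_mult)
  qed simp
  have "\<bar>resample f (inc \<omega> k) - resample f (inc \<omega> l)\<bar> \<le> (\<Sum>B\<in>Pow U. pr \<omega> U B * ?B)"
    unfolding X Y sum_subtractf[symmetric] using bound
    by (intro order_trans[OF sum_abs] sum_mono) auto
  also have "\<dots> = ?B" using sum_pr[OF U(1)] by (simp add: sum_distrib_right[symmetric])
  also have "\<dots> = (1 - overlap / (28 * real N)) * M * pair_dist (\<omega>, k, l)"
    by (simp add: pair_dist_def e_def s_def r_def)
  finally show ?thesis .
qed

lemma resample_contraction:
  assumes M: "0 \<le> M" and lip: "conf_lip n M f"
  shows "conf_lip n ((1 - overlap / (28 * real N)) * M) (resample f)"
  unfolding pair_lipschitz_def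
proof (rule ballI)
  fix i assume i: "i \<in> pairs n"
  obtain \<omega> k l where ikl: "i = (\<omega>, k, l)" by (cases i)
  then have p: "(\<omega>, k, l) \<in> pairs n" using i by simp
  have "\<bar>resample f (inc \<omega> k) - resample f (inc \<omega> l)\<bar> \<le> (1 - overlap / (28 * real N)) * M * pair_dist (\<omega>, k, l)"
  proof (cases "\<omega> l \<le> \<omega> k")
    case True
    then show ?thesis using resample_contraction_ordered[OF M lip p] by simp
  next
    case False
    have "(\<omega>, l, k) \<in> pairs n" using p by (auto simp: pairs_def)
    moreover have "pair_dist (\<omega>, l, k) = pair_dist (\<omega>, k, l)" by (simp add: pair_dist_def dis_commute)
    ultimately show ?thesis using resample_contraction_ordered[OF M lip, of \<omega> l k] False
      by (simp add: abs_minus_commute)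
  qed
  then show "\<bar>resample f (case i of (\<omega>, k, l) \<Rightarrow> inc \<omega> k) - resample f (case i of (\<omega>, k, l) \<Rightarrow> inc \<omega> l)\<bar>
      \<le> (1 - overlap / (28 * real N)) * M * pair_dist i" by (simp add: ikl)
qed

section \<open>Reversible weights and their disintegration along a row\<close>

definition wt :: "nat \<Rightarrow> (nat \<Rightarrow> nat) \<Rightarrow> real" where
  "wt K \<omega> = (\<Prod>h\<in>{1..H}. real (K choose \<omega> h) * (w ^ h) ^ \<omega> h)"

definition remainders :: "nat \<Rightarrow> (nat \<Rightarrow> nat) set" where
  "remainders n = {\<zeta>. (\<forall>h. \<zeta> h \<le> (if h \<in> {1..H} then N - 1 else 0)) \<and> tot \<zeta> \<le> n}"

lemma finite_bounded_confs: "finite {\<omega>. \<forall>h. \<omega> h \<le> (if h \<in> {1..H} then K else (0::nat))}"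
proof -
  have "{\<omega>. \<forall>h. \<omega> h \<le> (if h \<in> {1..H} then K else 0)} \<subseteq> {\<omega>. \<forall>h. (h \<in> {1..H} \<longrightarrow> \<omega> h \<in> {..K}) \<and> (h \<notin> {1..H} \<longrightarrow> \<omega> h = 0)}"
    by (auto split: if_splits)
  then show ?thesis by (rule finite_subset) (intro finite_set_of_finite_funs; simp)
qed

lemma finite_conf [simp]: "finite (conf K n)"
  by (rule finite_subset[OF _ finite_bounded_confs[of K]]) (auto simp: conf_def)

lemma finite_remainders [simp]: "finite (remainders n)"
  by (rule finite_subset[OF _ finite_bounded_confs[of "N - 1"]]) (auto simp: remainders_def)

lemma wt_pos: "(\<And>h. h \<in> {1..H} \<Longrightarrow> \<omega> h \<le> K) \<Longrightarrow> 0 < wt K \<omega>"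
  unfolding wt_def using w_pos by (intro prod_pos) (auto intro!: mult_pos_pos)

lemma remaindersD:
  assumes "\<zeta> \<in> remainders n" "h \<in> {1..H}"
  shows "\<zeta> h \<le> N - 1"
proof -
  have "\<zeta> h \<le> (if h \<in> {1..H} then N - 1 else 0)" using assms(1) unfolding remainders_def by blast
  then show ?thesis using assms(2) by simp
qed


lemma wt_conf_pos: "\<omega> \<in> conf K n \<Longrightarrow> 0 < wt K \<omega>"
  by (rule wt_pos) (rule confD)

text \<open>The identities \<open>(N choose x) x / N = (N - 1 choose x - 1)\<close> and
  \<open>(N choose x) (1 - x / N) = (N - 1 choose x)\<close>, multiplied over the columns.\<close>

lemma wt_pr:
  assumes A: "A \<subseteq> {1..H}" and \<zeta>: "\<And>h. h \<in> {1..H} \<Longrightarrow> \<zeta> h \<le> N - 1"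
  shows "wt N (with_row \<zeta> A) * pr (with_row \<zeta> A) {1..H} A = wt (N - 1) \<zeta> * rw A"
proof -
  have "rw A = (\<Prod>h\<in>{1..H}. if h \<in> A then w ^ h else 1)"
    unfolding rw_def using A by (simp add: prod.If_cases Int_absorb1)
  then have "wt (N - 1) \<zeta> * rw A = (\<Prod>h\<in>{1..H}. real (N - 1 choose \<zeta> h) * (w ^ h) ^ \<zeta> h * (if h \<in> A then w ^ h else 1))"
    by (simp add: wt_def prod.distrib)
  also have "\<dots> = (\<Prod>h\<in>{1..H}. real (N choose with_row \<zeta> A h) * (w ^ h) ^ with_row \<zeta> A h *
      (if h \<in> A then real (with_row \<zeta> A h) / N else 1 - real (with_row \<zeta> A h) / N))"
  proof (intro prod.cong refl)
    fix h assume h: "h \<in> {1..H}"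
    obtain K where K: "N = Suc K" using N_pos by (cases N) auto
    show "real (N - 1 choose \<zeta> h) * (w ^ h) ^ \<zeta> h * (if h \<in> A then w ^ h else 1) =
      real (N choose with_row \<zeta> A h) * (w ^ h) ^ with_row \<zeta> A h *
      (if h \<in> A then real (with_row \<zeta> A h) / N else 1 - real (with_row \<zeta> A h) / N)"
    proof (cases "h \<in> A")
      case True
      have "real (Suc (\<zeta> h)) * real (N choose Suc (\<zeta> h)) = real N * real (K choose \<zeta> h)"
        unfolding K using Suc_times_binomial[of "\<zeta> h" K] by (metis of_nat_mult)
      then have "real (N choose Suc (\<zeta> h)) * (real (Suc (\<zeta> h)) / N) = real (K choose \<zeta> h)"
        using N_pos by (simp add: field_simps)
      moreover have "real (N choose Suc (\<zeta> h)) * (w ^ h) ^ Suc (\<zeta> h) * (real (Suc (\<zeta> h)) / N)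
          = (real (N choose Suc (\<zeta> h)) * (real (Suc (\<zeta> h)) / N)) * ((w ^ h) ^ \<zeta> h * w ^ h)"
        by simp
      ultimately show ?thesis using True by (simp only: with_row_def) (simp add: K)
    next
      case False
      have "(N - \<zeta> h) * (N choose \<zeta> h) = N * (K choose \<zeta> h)"
        using binomial_absorb_comp[of N "\<zeta> h"] K by simp
      then have "real (N - \<zeta> h) * real (N choose \<zeta> h) = real N * real (K choose \<zeta> h)"
        by (metis of_nat_mult)
      then have "real (N choose \<zeta> h) * (1 - real (\<zeta> h) / N) = real (K choose \<zeta> h)"
        using \<zeta>[OF h] N_pos by (simp add: of_nat_diff field_simps)
      moreover have "real (N choose \<zeta> h) * (w ^ h) ^ \<zeta> h * (1 - real (\<zeta> h) / N)
          = (real (N choose \<zeta> h) * (1 - real (\<zeta> h) / N)) * (w ^ h) ^ \<zeta> h"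
        by simp
      ultimately show ?thesis using False by (simp only: with_row_def) (simp add: K)
    qed
  qed
  also have "\<dots> = wt N (with_row \<zeta> A) * pr (with_row \<zeta> A) {1..H} A"
    by (simp add: wt_def pr_def prod.distrib)
  finally show ?thesis by simp
qed

text \<open>A configuration with a row in it and a remainder with a row determine each other, with
  weights matched by \<open>wt_pr\<close>. Pairs of probability zero are dropped first, because for
  them adding the row back need not restore the configuration.\<close>

lemma disintegration:
  "(\<Sum>\<omega>\<in>conf N n. wt N \<omega> * (\<Sum>A\<in>Pow {1..H}. pr \<omega> {1..H} A * F (without_row \<omega> A) A))
    = (\<Sum>\<zeta>\<in>remainders n. wt (N - 1) \<zeta> * (\<Sum>A\<in>rows (n - tot \<zeta>). rw A * F \<zeta> A))"
proof -
  define S where "S = {(\<omega>, A). \<omega> \<in> conf N n \<and> A \<in> Pow {1..H} \<and> pr \<omega> {1..H} A \<noteq> 0}"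
  have "(\<Sum>\<omega>\<in>conf N n. wt N \<omega> * (\<Sum>A\<in>Pow {1..H}. pr \<omega> {1..H} A * F (without_row \<omega> A) A))
      = (\<Sum>(\<omega>, A)\<in>conf N n \<times> Pow {1..H}. wt N \<omega> * pr \<omega> {1..H} A * F (without_row \<omega> A) A)"
    by (simp add: sum_distrib_left sum.cartesian_product mult.assoc)
  also have "\<dots> = (\<Sum>(\<omega>, A)\<in>S. wt N \<omega> * pr \<omega> {1..H} A * F (without_row \<omega> A) A)"
    by (intro sum.mono_neutral_right) (auto simp: S_def)
  also have "\<dots> = (\<Sum>(\<zeta>, A)\<in>(SIGMA \<zeta>:remainders n. rows (n - tot \<zeta>)). wt (N - 1) \<zeta> * rw A * F \<zeta> A)"
  proof (rule sum.reindex_bij_witness[where i = "\<lambda>(\<zeta>, A). (with_row \<zeta> A, A)" and j = "\<lambda>(\<omega>, A). (without_row \<omega> A, A)"])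
    fix a assume "a \<in> S"
    then obtain \<omega> A where a: "a = (\<omega>, A)" and w: "\<omega> \<in> conf N n" "A \<subseteq> {1..H}" "pr \<omega> {1..H} A \<noteq> 0"
      by (auto simp: S_def)
    have ar: "with_row (without_row \<omega> A) A = \<omega>" using with_without_row[OF w(1,3,2)] .
    have row: "A \<in> rows (card A)" using w by (simp add: rows_def)
    have tot: "tot (without_row \<omega> A) + card A = n" using tot_with_row[OF row, of "without_row \<omega> A"] w(1) by (simp add: ar conf_def)
    have \<omega>: "\<omega> h \<le> (if h \<in> {1..H} then N else 0)" for h using w(1) by (simp add: conf_def)
    have low: "without_row \<omega> A h \<le> (if h \<in> {1..H} then N - 1 else 0)" for h
    proof (cases "h \<in> {1..H}")
      case True
      then show ?thesis using pr_nonzeroD[OF w(3) _ True] \<omega>[of h] by (cases "h \<in> A") (auto simp: without_row_def)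
    next
      case False
      then show ?thesis using \<omega>[of h] by (auto simp: without_row_def)
    qed
    show "(case (case a of (\<omega>, A) \<Rightarrow> (without_row \<omega> A, A)) of (\<zeta>, A) \<Rightarrow> (with_row \<zeta> A, A)) = a" by (simp add: a ar)
    have "n - tot (without_row \<omega> A) = card A" using tot by simp
    then show "(case a of (\<omega>, A) \<Rightarrow> (without_row \<omega> A, A)) \<in> (SIGMA \<zeta>:remainders n. rows (n - tot \<zeta>))"
      using tot low row by (auto simp: a remainders_def)
    have "without_row \<omega> A h \<le> N - 1" if "h \<in> {1..H}" for h using low[of h] that by simp
    from wt_pr[OF w(2), of "without_row \<omega> A", OF this]
    have "wt (N - 1) (without_row \<omega> A) * rw A = wt N \<omega> * pr \<omega> {1..H} A" by (simp add: ar)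
    then show "(case (case a of (\<omega>, A) \<Rightarrow> (without_row \<omega> A, A)) of (\<zeta>, A) \<Rightarrow> wt (N - 1) \<zeta> * rw A * F \<zeta> A)
        = (case a of (\<omega>, A) \<Rightarrow> wt N \<omega> * pr \<omega> {1..H} A * F (without_row \<omega> A) A)"
      by (simp add: a)
  next
    fix a assume "a \<in> (SIGMA \<zeta>:remainders n. rows (n - tot \<zeta>))"
    then obtain \<zeta> A where a: "a = (\<zeta>, A)" and z: "\<zeta> \<in> remainders n" "A \<in> rows (n - tot \<zeta>)" by auto
    have A: "A \<subseteq> {1..H}" using rowsD(2)[OF z(2)] .
    have \<zeta>: "\<zeta> h \<le> (if h \<in> {1..H} then N - 1 else 0)" for h using z(1) by (simp add: remainders_def)
    have tot: "tot (with_row \<zeta> A) = n" using tot_with_row[OF z(2), of \<zeta>] z(1) by (simp add: remainders_def)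
    have ra: "without_row (with_row \<zeta> A) A = \<zeta>" by (simp add: without_row_def with_row_def fun_eq_iff)
    have "with_row \<zeta> A h \<le> (if h \<in> {1..H} then N else 0)" for h
      using \<zeta>[of h] A N_pos by (auto simp: with_row_def split: if_splits)
    then have c: "with_row \<zeta> A \<in> conf N n" using tot by (simp add: conf_def)
    have "0 < wt (N - 1) \<zeta> * rw A" by (intro mult_pos_pos wt_pos rw_pos remaindersD[OF z(1)])
    then have "pr (with_row \<zeta> A) {1..H} A \<noteq> 0" using wt_pr[OF A, of \<zeta>, OF remaindersD[OF z(1)]] by auto
    then show "(case a of (\<zeta>, A) \<Rightarrow> (with_row \<zeta> A, A)) \<in> S" using c A by (simp add: S_def a)
    show "(case (case a of (\<zeta>, A) \<Rightarrow> (with_row \<zeta> A, A)) of (\<omega>, A) \<Rightarrow> (without_row \<omega> A, A)) = a" by (simp add: a ra)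
  qed
  also have "\<dots> = (\<Sum>\<zeta>\<in>remainders n. wt (N - 1) \<zeta> * (\<Sum>A\<in>rows (n - tot \<zeta>). rw A * F \<zeta> A))"
    by (subst sum.Sigma[symmetric]) (auto simp: sum_distrib_left mult.assoc)
  finally show ?thesis .
qed

lemma disintegration_product:
  "(\<Sum>\<omega>\<in>conf N n. wt N \<omega> * g \<omega> * (\<Sum>A\<in>Pow {1..H}. pr \<omega> {1..H} A * F (without_row \<omega> A) A))
    = (\<Sum>\<zeta>\<in>remainders n. wt (N - 1) \<zeta> * (\<Sum>A\<in>rows (n - tot \<zeta>). rw A * (g (with_row \<zeta> A) * F \<zeta> A)))"
proof -
  have key: "pr \<omega> {1..H} A * (g \<omega> * F (without_row \<omega> A) A) = pr \<omega> {1..H} A * (g (with_row (without_row \<omega> A) A) * F (without_row \<omega> A) A)"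
    if "\<omega> \<in> conf N n" "A \<in> Pow {1..H}" for \<omega> A
    using with_without_row[OF that(1), of A] that(2) by (cases "pr \<omega> {1..H} A = 0") auto
  have "(\<Sum>\<omega>\<in>conf N n. wt N \<omega> * g \<omega> * (\<Sum>A\<in>Pow {1..H}. pr \<omega> {1..H} A * F (without_row \<omega> A) A))
    = (\<Sum>\<omega>\<in>conf N n. wt N \<omega> * (\<Sum>A\<in>Pow {1..H}. pr \<omega> {1..H} A * (g (with_row (without_row \<omega> A) A) * F (without_row \<omega> A) A)))"
  proof (intro sum.cong refl)
    fix \<omega> assume \<omega>: "\<omega> \<in> conf N n"
    have "g \<omega> * (\<Sum>A\<in>Pow {1..H}. pr \<omega> {1..H} A * F (without_row \<omega> A) A)
        = (\<Sum>A\<in>Pow {1..H}. pr \<omega> {1..H} A * (g \<omega> * F (without_row \<omega> A) A))"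
      unfolding sum_distrib_left by (intro sum.cong refl) simp
    also have "\<dots> = (\<Sum>A\<in>Pow {1..H}. pr \<omega> {1..H} A * (g (with_row (without_row \<omega> A) A) * F (without_row \<omega> A) A))"
      by (rule sum.cong[OF refl]) (rule key[OF \<omega>])
    finally show "wt N \<omega> * g \<omega> * (\<Sum>A\<in>Pow {1..H}. pr \<omega> {1..H} A * F (without_row \<omega> A) A)
        = wt N \<omega> * (\<Sum>A\<in>Pow {1..H}. pr \<omega> {1..H} A * (g (with_row (without_row \<omega> A) A) * F (without_row \<omega> A) A))"
      by (simp only: mult.assoc)
  qed
  also have "\<dots> = (\<Sum>\<zeta>\<in>remainders n. wt (N - 1) \<zeta> * (\<Sum>A\<in>rows (n - tot \<zeta>). rw A * (g (with_row \<zeta> A) * F \<zeta> A)))"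
    by (rule disintegration)
  finally show ?thesis .
qed

lemma sum_rows_avg: "(\<Sum>A\<in>rows m. rw A * g A) = Z m * avg m g"
proof (cases "m \<le> H")
  case True
  then show ?thesis using Z_pos[OF True] by (simp add: avg_def)
next
  case False
  then have "rows m = {}" unfolding rows_def using card_mono[of "{1..H}"] by force
  then show ?thesis by (simp add: Z_def)
qed

text \<open>In the coordinates remainder and row, \<open>resample\<close> averages out the row;
  written this way the form is visibly symmetric in \<open>f\<close> and \<open>g\<close>.\<close>

lemma resample_form:
  "(\<Sum>\<omega>\<in>conf N n. wt N \<omega> * g \<omega> * resample f \<omega>) = (\<Sum>\<zeta>\<in>remainders n. wt (N - 1) \<zeta> *
    (Z (n - tot \<zeta>) * avg (n - tot \<zeta>) (\<lambda>A. g (with_row \<zeta> A)) * avg (n - tot \<zeta>) (\<lambda>A. f (with_row \<zeta> A))))"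
proof -
  have "(\<Sum>\<omega>\<in>conf N n. wt N \<omega> * g \<omega> * resample f \<omega>) = (\<Sum>\<zeta>\<in>remainders n. wt (N - 1) \<zeta> *
     (\<Sum>A\<in>rows (n - tot \<zeta>). rw A * (g (with_row \<zeta> A) * avg (card A) (\<lambda>B. f (with_row \<zeta> B)))))"
    unfolding resample_def
    by (rule disintegration_product[where F = "\<lambda>\<zeta> A. avg (card A) (\<lambda>B. f (with_row \<zeta> B))"])
  also have "\<dots> = (\<Sum>\<zeta>\<in>remainders n. wt (N - 1) \<zeta> *
    (Z (n - tot \<zeta>) * avg (n - tot \<zeta>) (\<lambda>A. g (with_row \<zeta> A)) * avg (n - tot \<zeta>) (\<lambda>A. f (with_row \<zeta> A))))"
    by (intro sum.cong refl arg_cong2[where f = "(*)"])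
      (simp add: rowsD(3) sum_rows_avg[symmetric] sum_distrib_right mult.assoc)
  finally show ?thesis .
qed

section \<open>The spectral gap of the row resampling\<close>

abbreviation conf_linked :: "nat \<Rightarrow> (nat \<Rightarrow> nat) \<Rightarrow> (nat \<Rightarrow> nat) \<Rightarrow> bool" where
  "conf_linked n \<equiv> lip_linked (pairs n) (\<lambda>(\<omega>, k, l). inc \<omega> k) (\<lambda>(\<omega>, k, l). inc \<omega> l) pair_dist"

text \<open>A particle moves from a column with an excess over \<open>\<eta>\<close> to one with a
  deficit. The truncated differences count the excess only, and it decreases.\<close>

lemma confs_linked:
  assumes "\<omega> \<in> conf N n" "\<eta> \<in> conf N n"
  shows "conf_linked n \<omega> \<eta>"
  using assms(1)
proof (induction "\<Sum>h\<in>{1..H}. \<omega> h - \<eta> h" arbitrary: \<omega> rule: less_induct)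
  case less
  have \<omega>: "\<omega> h \<le> (if h \<in> {1..H} then N else 0)" "tot \<omega> = n" for h using less.prems by (auto simp: conf_def)
  have \<eta>: "\<eta> h \<le> (if h \<in> {1..H} then N else 0)" "tot \<eta> = n" for h using assms(2) by (auto simp: conf_def)
  show ?case
  proof (cases "\<omega> = \<eta>")
    case True
    then show ?thesis by (simp add: lip_linked_refl)
  next
    case False
    then obtain x where x: "\<omega> x \<noteq> \<eta> x" by auto
    then have xH: "x \<in> {1..H}" using \<omega>(1)[of x] \<eta>(1)[of x] by (auto split: if_splits)
    have "\<exists>k\<in>{1..H}. \<eta> k < \<omega> k"
    proof (rule ccontr)
      assume "\<not> (\<exists>k\<in>{1..H}. \<eta> k < \<omega> k)"
      then have "tot \<omega> < tot \<eta>" unfolding tot_def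
        using x xH by (intro sum_strict_mono_ex1) (auto simp: not_less intro!: bexI[of _ x] le_neq_implies_less)
      then show False using \<omega>(2) \<eta>(2) by simp
    qed
    then obtain k where k: "k \<in> {1..H}" "\<eta> k < \<omega> k" by blast
    have "\<exists>l\<in>{1..H}. \<omega> l < \<eta> l"
    proof (rule ccontr)
      assume "\<not> (\<exists>l\<in>{1..H}. \<omega> l < \<eta> l)"
      then have "tot \<eta> < tot \<omega>" unfolding tot_def
        using k by (intro sum_strict_mono_ex1) (auto simp: not_less)
      then show False using \<omega>(2) \<eta>(2) by simp
    qed
    then obtain l where l: "l \<in> {1..H}" "\<omega> l < \<eta> l" by blast
    have kl: "k \<noteq> l" using k l by auto
    let ?b = "dec \<omega> k"
    let ?\<omega>' = "inc ?b l"
    have tb: "Suc (tot ?b) = n" using tot_dec[OF k(1), of \<omega>] k \<omega>(2) by simp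
    have b: "?b h \<le> (if h \<in> {1..H} then N else 0)" for h using \<omega>(1)[of h] k(1) by (auto simp: dec_def)
    have lt: "?b k < N" "?b l < N" using \<omega>(1)[of k] \<eta>(1)[of l] k l kl by (auto simp: dec_def split: if_splits)
    have p: "(?b, k, l) \<in> pairs n" using tb b lt k l kl by (auto simp: pairs_def conf_def)
    have "?\<omega>' h \<le> (if h \<in> {1..H} then N else 0)" for h
      using b[of h] lt(2) l(1) by (auto simp: inc_def)
    then have "?\<omega>' \<in> conf N n" using tb tot_inc[OF l(1), of ?b] by (simp add: conf_def)
    moreover have "(\<Sum>h\<in>{1..H}. ?\<omega>' h - \<eta> h) < (\<Sum>h\<in>{1..H}. \<omega> h - \<eta> h)"
      using k l kl by (intro sum_strict_mono_ex1) (auto simp: inc_def dec_def intro!: bexI[of _ k])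
    ultimately have "conf_linked n ?\<omega>' \<eta>" using less.hyps by blast
    moreover have "inc ?b k = \<omega>" using k by (auto simp: inc_def dec_def fun_eq_iff)
    then have "conf_linked n \<omega> ?\<omega>'"
      using lip_linked_pair[OF p, of "\<lambda>(\<omega>, k, l). inc \<omega> k" "\<lambda>(\<omega>, k, l). inc \<omega> l" pair_dist] by simp
    ultimately show ?thesis by (rule lip_linked_trans[rotated])
  qed
qed

lemma resample_gap:
  assumes "(\<Sum>\<omega>\<in>conf N n. wt N \<omega> * F \<omega>) = 0"
  shows "(\<Sum>\<omega>\<in>conf N n. wt N \<omega> * F \<omega> * resample F \<omega>) \<le> (1 - overlap / (28 * real N)) * (\<Sum>\<omega>\<in>conf N n. wt N \<omega> * (F \<omega>)\<^sup>2)"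
proof (rule contraction_imp_spectral_bound[where I = "pairs n" and s = "\<lambda>(\<omega>, k, l). inc \<omega> k" and
      t = "\<lambda>(\<omega>, k, l). inc \<omega> l" and d = pair_dist])
  show "(\<Sum>x\<in>conf N n. wt N x * resample f x * g x) = (\<Sum>x\<in>conf N n. wt N x * f x * resample g x)" for f g
  proof -
    have "(\<Sum>x\<in>conf N n. wt N x * resample f x * g x) = (\<Sum>x\<in>conf N n. wt N x * g x * resample f x)"
      by (simp add: mult.commute mult.left_commute)
    also have "\<dots> = (\<Sum>x\<in>conf N n. wt N x * f x * resample g x)"
      unfolding resample_form by (intro sum.cong refl) simp
    finally show ?thesis .
  qed
  show "resample (\<lambda>_. 1) x = 1" for x
  proof -
    have "resample (\<lambda>_. 1) x = (\<Sum>A\<in>Pow {1..H}. pr x {1..H} A)"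
      unfolding resample_def
    proof (intro sum.cong refl)
      fix A assume "A \<in> Pow {1..H}"
      then have "card A \<le> card {1..H}" by (intro card_mono) auto
      then show "pr x {1..H} A * avg (card A) (\<lambda>B. 1) = pr x {1..H} A" by (simp add: avg_const)
    qed
    then show ?thesis using sum_pr[of "{1..H}" x] by simp
  qed
  show "finite (pairs n)"
    by (rule finite_subset[of _ "conf N (n - 1) \<times> {1..H} \<times> {1..H}"]) (auto simp: pairs_def)
  show "0 < pair_dist i" if "i \<in> pairs n" for i
  proof -
    obtain \<omega> k l where i: "i = (\<omega>, k, l)" by (cases i)
    have "0 \<le> dis (real (\<omega> k) / N) (real (\<omega> l) / N)"
      using that N_pos by (intro dis_nonneg) (auto simp: i pairs_def divide_le_eq)
    then show ?thesis by (simp add: i pair_dist_def)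
  qed
  show "conf_lip n ((1 - overlap / (28 * real N)) * M) (resample f)" if "0 \<le> M" "conf_lip n M f" for f M
    by (rule resample_contraction[OF that])
  show "conf_linked n x y" if "x \<in> conf N n" "y \<in> conf N n" for x y
    by (rule confs_linked[OF that])
  show "0 \<le> 1 - overlap / (28 * real N)" using overlap_le_1 overlap_pos N_pos by (simp add: divide_le_eq)
qed (simp_all add: wt_conf_pos assms)

section \<open>The jump process as an average over rows\<close>

definition mv :: "nat \<Rightarrow> nat \<Rightarrow> (nat \<Rightarrow> nat) \<Rightarrow> nat \<Rightarrow> nat" where
  "mv k l \<omega> = inc (dec \<omega> k) l"

definition jump :: "nat \<Rightarrow> nat \<Rightarrow> (nat \<Rightarrow> nat) \<Rightarrow> real" where
  "jump k l \<omega> = real (\<omega> k) * (real N - real (\<omega> l))"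

definition gen :: "((nat \<Rightarrow> nat) \<Rightarrow> real) \<Rightarrow> (nat \<Rightarrow> nat) \<Rightarrow> real" where
  "gen F \<omega> = (\<Sum>h\<in>{1..<H}. up_rate * jump h (Suc h) \<omega> * (F (mv h (Suc h) \<omega>) - F \<omega>)
     + down_rate * jump (Suc h) h \<omega> * (F (mv (Suc h) h \<omega>) - F \<omega>))"

lemma jump_probability:
  assumes "k \<in> {1..H}" "l \<in> {1..H}" "k \<noteq> l"
  shows "(\<Sum>A\<in>Pow {1..H}. pr \<omega> {1..H} A * (if k \<in> A \<and> l \<notin> A then c else 0)) = jump k l \<omega> / (real N)\<^sup>2 * c"
proof -
  define U where "U = {1..H} - {k, l}"
  have "(\<Sum>A\<in>Pow {1..H}. pr \<omega> {1..H} A * (if k \<in> A \<and> l \<notin> A then c else 0))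
      = (\<Sum>B\<in>Pow U. pr \<omega> U B * (real (\<omega> k) / N * (1 - real (\<omega> l) / N) * c))"
    unfolding sum_Pow_two_sites[OF assms] U_def[symmetric]
    using assms(3) by (intro sum.cong refl) (auto simp: U_def subset_iff)
  also have "\<dots> = real (\<omega> k) / N * (1 - real (\<omega> l) / N) * c"
    unfolding sum_distrib_right[symmetric] using sum_pr[of U \<omega>] by (simp add: U_def)
  also have "\<dots> = jump k l \<omega> / (real N)\<^sup>2 * c"
    using N_pos by (simp add: jump_def power2_eq_square field_simps)
  finally show ?thesis .
qed

text \<open>\<open>jump k l \<omega> / (real N)\<^sup>2\<close> is the probability that the random
  row is occupied at \<open>k\<close> and empty at \<open>l\<close>, so every hop is an exchange
  inside that row.\<close>

lemma gen_eq_row_average: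
  assumes \<omega>: "\<omega> \<in> conf N n"
  shows "gen F \<omega> = (real N)\<^sup>2 * (\<Sum>A\<in>Pow {1..H}. pr \<omega> {1..H} A *
    (\<Sum>h\<in>{1..<H}. exch h (\<lambda>B. F (with_row (without_row \<omega> A) B)) A))"
proof -
  have bond: "(\<Sum>A\<in>Pow {1..H}. pr \<omega> {1..H} A * exch h (\<lambda>B. F (with_row (without_row \<omega> A) B)) A)
      = jump h (Suc h) \<omega> / (real N)\<^sup>2 * (up_rate * (F (mv h (Suc h) \<omega>) - F \<omega>))
        + jump (Suc h) h \<omega> / (real N)\<^sup>2 * (down_rate * (F (mv (Suc h) h \<omega>) - F \<omega>))"
    if h: "h \<in> {1..<H}" for h
  proof -
    have hH: "h \<in> {1..H}" "Suc h \<in> {1..H}" "h \<noteq> Suc h" "Suc h \<noteq> h" using h by auto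
    have key: "pr \<omega> {1..H} A * exch h (\<lambda>B. F (with_row (without_row \<omega> A) B)) A
       = pr \<omega> {1..H} A * (if h \<in> A \<and> Suc h \<notin> A then up_rate * (F (mv h (Suc h) \<omega>) - F \<omega>) else 0)
       + pr \<omega> {1..H} A * (if Suc h \<in> A \<and> h \<notin> A then down_rate * (F (mv (Suc h) h \<omega>) - F \<omega>) else 0)"
      if A: "A \<in> Pow {1..H}" for A
    proof (cases "pr \<omega> {1..H} A = 0")
      case False
      have ar: "with_row (without_row \<omega> A) A = \<omega>" using with_without_row[OF \<omega> False] A by simp
      note nz = pr_nonzeroD(1)[OF False]
      consider "h \<in> A" "Suc h \<notin> A" | "h \<notin> A" "Suc h \<in> A" | "h \<in> A \<longleftrightarrow> Suc h \<in> A" by blast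
      then show ?thesis
      proof cases
        case 1
        have "1 \<le> \<omega> h" using nz[of h] hH 1 by simp
        then have "with_row (without_row \<omega> A) (sw h A) = mv h (Suc h) \<omega>"
          using 1 fun_cong[OF ar] by (auto simp: sw_up fun_eq_iff mv_def inc_def dec_def with_row_def without_row_def)
        then show ?thesis using 1 by (simp add: exch_def rate_def ar)
      next
        case 2
        have "1 \<le> \<omega> (Suc h)" using nz[of "Suc h"] hH 2 by simp
        then have "with_row (without_row \<omega> A) (sw h A) = mv (Suc h) h \<omega>"
          using 2 fun_cong[OF ar] by (auto simp: sw_down fun_eq_iff mv_def inc_def dec_def with_row_def without_row_def)
        then show ?thesis using 2 by (simp add: exch_def rate_def ar)
      next
        case 3
        then show ?thesis by (simp add: exch_def rate_def)
      qed
    qed simp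
    have "(\<Sum>A\<in>Pow {1..H}. pr \<omega> {1..H} A * exch h (\<lambda>B. F (with_row (without_row \<omega> A) B)) A) =
        (\<Sum>A\<in>Pow {1..H}. pr \<omega> {1..H} A * (if h \<in> A \<and> Suc h \<notin> A then up_rate * (F (mv h (Suc h) \<omega>) - F \<omega>) else 0)
       + pr \<omega> {1..H} A * (if Suc h \<in> A \<and> h \<notin> A then down_rate * (F (mv (Suc h) h \<omega>) - F \<omega>) else 0))"
      by (rule sum.cong[OF refl]) (rule key)
    then show ?thesis
      unfolding sum.distrib jump_probability[OF hH(1,2,3)] jump_probability[OF hH(2,1,4)] .
  qed
  have "(\<Sum>A\<in>Pow {1..H}. pr \<omega> {1..H} A * (\<Sum>h\<in>{1..<H}. exch h (\<lambda>B. F (with_row (without_row \<omega> A) B)) A))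
      = (\<Sum>h\<in>{1..<H}. \<Sum>A\<in>Pow {1..H}. pr \<omega> {1..H} A * exch h (\<lambda>B. F (with_row (without_row \<omega> A) B)) A)"
    unfolding sum_distrib_left by (rule sum.swap)
  also have "\<dots> = (\<Sum>h\<in>{1..<H}. jump h (Suc h) \<omega> / (real N)\<^sup>2 * (up_rate * (F (mv h (Suc h) \<omega>) - F \<omega>))
        + jump (Suc h) h \<omega> / (real N)\<^sup>2 * (down_rate * (F (mv (Suc h) h \<omega>) - F \<omega>)))"
    by (intro sum.cong refl bond)
  finally have eq: "(\<Sum>A\<in>Pow {1..H}. pr \<omega> {1..H} A * (\<Sum>h\<in>{1..<H}. exch h (\<lambda>B. F (with_row (without_row \<omega> A) B)) A)) = \<dots>" .
  show ?thesis
    unfolding eq unfolding gen_def sum_distrib_left using N_pos by (intro sum.cong refl) (simp add: field_simps)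
qed

text \<open>The row inequality contributes \<open>N\<^sup>2 * row_gap\<close> and the resampling
  \<open>overlap / (28 * N)\<close>, whence a bound linear in \<open>N\<close>. No sign of
  \<open>x\<close> is assumed; it comes out of the bound.\<close>

theorem generator_gap:
  assumes H: "1 \<le> H" and eig: "\<And>\<omega>. \<omega> \<in> conf N n \<Longrightarrow> gen F \<omega> = - x * F \<omega>"
    and x: "x \<noteq> 0" and \<omega>0: "\<omega>0 \<in> conf N n" "F \<omega>0 \<noteq> 0"
  shows "row_gap * overlap / 28 * N \<le> x"
proof -
  define S where "S = (\<Sum>\<omega>\<in>conf N n. wt N \<omega> * (F \<omega>)\<^sup>2)"
  have form: "(\<Sum>\<omega>\<in>conf N n. wt N \<omega> * g \<omega> * gen F \<omega>) = (real N)\<^sup>2 * (\<Sum>\<zeta>\<in>remainders n. wt (N - 1) \<zeta> *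
      (\<Sum>A\<in>rows (n - tot \<zeta>). rw A * (g (with_row \<zeta> A) * (\<Sum>h\<in>{1..<H}. exch h (\<lambda>B. F (with_row \<zeta> B)) A))))" for g
  proof -
    have "(\<Sum>\<omega>\<in>conf N n. wt N \<omega> * g \<omega> * gen F \<omega>) = (real N)\<^sup>2 * (\<Sum>\<omega>\<in>conf N n. wt N \<omega> * g \<omega> * (\<Sum>A\<in>Pow {1..H}. pr \<omega> {1..H} A *
      (\<Sum>h\<in>{1..<H}. exch h (\<lambda>B. F (with_row (without_row \<omega> A) B)) A)))"
      unfolding sum_distrib_left[of "(real N)\<^sup>2"] by (intro sum.cong refl) (simp add: gen_eq_row_average)
    then show ?thesis
      unfolding disintegration_product[where F = "\<lambda>\<zeta> A. \<Sum>h\<in>{1..<H}. exch h (\<lambda>B. F (with_row \<zeta> B)) A"] .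
  qed
  \<comment> \<open>By reversibility \<open>gen F\<close> has mean zero, hence so has an
    eigenfunction with \<open>x \<noteq> 0\<close>.\<close>
  have mean: "(\<Sum>\<omega>\<in>conf N n. wt N \<omega> * F \<omega>) = 0"
  proof -
    have "(\<Sum>A\<in>rows m. rw A * (1 * (\<Sum>h\<in>{1..<H}. exch h g A))) = 0" for m g
    proof -
      have "(\<Sum>A\<in>rows m. rw A * (1 * (\<Sum>h\<in>{1..<H}. exch h g A))) = (\<Sum>h\<in>{1..<H}. \<Sum>A\<in>rows m. rw A * 1 * exch h g A)"
        unfolding sum_distrib_left mult.assoc by (rule sum.swap)
      also have "\<dots> = 0"
      proof (rule sum.neutral, rule ballI)
        fix h assume h: "h \<in> {1..<H}"
        show "(\<Sum>A\<in>rows m. rw A * 1 * exch h g A) = 0"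
          using exch_form[OF h, where f = "\<lambda>_. 1" and g = g and m = m] by simp
      qed
      finally show ?thesis .
    qed
    then have "(\<Sum>\<omega>\<in>conf N n. wt N \<omega> * 1 * gen F \<omega>) = 0" unfolding form by simp
    moreover have "(\<Sum>\<omega>\<in>conf N n. wt N \<omega> * 1 * gen F \<omega>) = - x * (\<Sum>\<omega>\<in>conf N n. wt N \<omega> * F \<omega>)"
      unfolding sum_distrib_left by (intro sum.cong refl) (simp add: eig)
    ultimately show ?thesis using x by simp
  qed
  have "x * S = - (\<Sum>\<omega>\<in>conf N n. wt N \<omega> * F \<omega> * gen F \<omega>)"
    unfolding S_def sum_distrib_left sum_negf[symmetric]
    by (intro sum.cong refl) (simp add: eig power2_eq_square)
  also have "\<dots> = (real N)\<^sup>2 * (\<Sum>\<zeta>\<in>remainders n. wt (N - 1) \<zeta> * row_form (n - tot \<zeta>) (\<lambda>B. F (with_row \<zeta> B)))"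
    unfolding form row_form_def by (simp add: sum_negf mult.assoc)
  also have "\<dots> \<ge> (real N)\<^sup>2 * (\<Sum>\<zeta>\<in>remainders n. wt (N - 1) \<zeta> * (row_gap *
      (\<Sum>A\<in>rows (n - tot \<zeta>). rw A * (F (with_row \<zeta> A) * (F (with_row \<zeta> A) - avg (n - tot \<zeta>) (\<lambda>B. F (with_row \<zeta> B)))))))"
    (is "?L \<le> _")
  proof (rule mult_left_mono[OF sum_mono])
    fix \<zeta> assume z: "\<zeta> \<in> remainders n"
    have "0 \<le> wt (N - 1) \<zeta>" by (intro less_imp_le wt_pos remaindersD[OF z])
    then show "wt (N - 1) \<zeta> * (row_gap * (\<Sum>A\<in>rows (n - tot \<zeta>). rw A * (F (with_row \<zeta> A) * (F (with_row \<zeta> A) - avg (n - tot \<zeta>) (\<lambda>B. F (with_row \<zeta> B))))))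
        \<le> wt (N - 1) \<zeta> * row_form (n - tot \<zeta>) (\<lambda>B. F (with_row \<zeta> B))"
      by (rule mult_left_mono[OF row_poincare[OF H]])
  qed simp
  finally have lower: "?L \<le> x * S" .
  have "?L = (real N)\<^sup>2 * row_gap * (S - (\<Sum>\<omega>\<in>conf N n. wt N \<omega> * F \<omega> * resample F \<omega>))"
  proof -
    have S: "S = (\<Sum>\<zeta>\<in>remainders n. wt (N - 1) \<zeta> * (\<Sum>A\<in>rows (n - tot \<zeta>). rw A * (F (with_row \<zeta> A) * F (with_row \<zeta> A))))"
    proof -
      have "S = (\<Sum>\<omega>\<in>conf N n. wt N \<omega> * F \<omega> * (\<Sum>A\<in>Pow {1..H}. pr \<omega> {1..H} A * F \<omega>))"
        unfolding S_def using sum_pr[of "{1..H}"] by (simp add: sum_distrib_right[symmetric] power2_eq_square mult.assoc)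
      also have "\<dots> = (\<Sum>\<omega>\<in>conf N n. wt N \<omega> * F \<omega> * (\<Sum>A\<in>Pow {1..H}. pr \<omega> {1..H} A * F (with_row (without_row \<omega> A) A)))"
      proof (rule sum.cong[OF refl], rule arg_cong2[where f = "(*)"], rule refl, rule sum.cong[OF refl])
        fix \<omega> A assume "\<omega> \<in> conf N n" "A \<in> Pow {1..H}"
        then show "pr \<omega> {1..H} A * F \<omega> = pr \<omega> {1..H} A * F (with_row (without_row \<omega> A) A)"
          using with_without_row[of \<omega> n A] by (cases "pr \<omega> {1..H} A = 0") auto
      qed
      finally show ?thesis unfolding disintegration_product[where F = "\<lambda>\<zeta> A. F (with_row \<zeta> A)"] .
    qed
    define P where "P \<zeta> = (\<Sum>A\<in>rows (n - tot \<zeta>). rw A * (F (with_row \<zeta> A) * F (with_row \<zeta> A)))" for \<zeta>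
    define Q where "Q \<zeta> = Z (n - tot \<zeta>) * avg (n - tot \<zeta>) (\<lambda>A. F (with_row \<zeta> A)) * avg (n - tot \<zeta>) (\<lambda>A. F (with_row \<zeta> A))" for \<zeta>
    have "(\<Sum>A\<in>rows (n - tot \<zeta>). rw A * (F (with_row \<zeta> A) * (F (with_row \<zeta> A) - avg (n - tot \<zeta>) (\<lambda>B. F (with_row \<zeta> B)))))
        = P \<zeta> - Q \<zeta>" for \<zeta>
    proof -
      let ?m = "n - tot \<zeta>"
      let ?a = "avg ?m (\<lambda>B. F (with_row \<zeta> B))"
      have "(\<Sum>A\<in>rows ?m. rw A * (F (with_row \<zeta> A) * (F (with_row \<zeta> A) - ?a)))
          = P \<zeta> - (\<Sum>A\<in>rows ?m. rw A * F (with_row \<zeta> A)) * ?a"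
        unfolding P_def sum_distrib_right sum_subtractf[symmetric] by (intro sum.cong refl) (simp add: algebra_simps)
      then show ?thesis by (simp only: sum_rows_avg Q_def)
    qed
    then have "?L = (real N)\<^sup>2 * (\<Sum>\<zeta>\<in>remainders n. wt (N - 1) \<zeta> * (row_gap * (P \<zeta> - Q \<zeta>)))"
      by simp
    also have "\<dots> = (real N)\<^sup>2 * row_gap * ((\<Sum>\<zeta>\<in>remainders n. wt (N - 1) \<zeta> * P \<zeta>) - (\<Sum>\<zeta>\<in>remainders n. wt (N - 1) \<zeta> * Q \<zeta>))"
      unfolding sum_subtractf[symmetric] sum_distrib_left by (intro sum.cong refl) (simp add: algebra_simps)
    finally show ?thesis unfolding S resample_form P_def Q_def .
  qed
  also have "\<dots> \<ge> (real N)\<^sup>2 * row_gap * (overlap / (28 * real N) * S)"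
    using resample_gap[OF mean] row_gap_pos
    by (intro mult_left_mono) (auto simp: S_def algebra_simps)
  finally have "(real N)\<^sup>2 * row_gap * (overlap / (28 * real N) * S) \<le> x * S" using lower by linarith
  moreover have "(real N)\<^sup>2 * row_gap * (overlap / (28 * real N) * S) = row_gap * overlap / 28 * N * S"
    using N_pos by (simp add: power2_eq_square field_simps)
  moreover have "0 < S"
    unfolding S_def
  proof (rule sum_pos2[OF finite_conf \<omega>0(1)])
    show "0 < wt N \<omega>0 * (F \<omega>0)\<^sup>2" using wt_conf_pos[OF \<omega>0(1)] \<omega>0(2) by simp
    show "0 \<le> wt N \<omega> * (F \<omega>)\<^sup>2" if "\<omega> \<in> conf N n" for \<omega>
      using wt_conf_pos[OF that] by simp
  qed
  ultimately have "row_gap * overlap / 28 * N * S \<le> x * S" "0 < S" by linarith+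
  then show ?thesis by (rule mult_right_le_imp_le)
qed

end

section \<open>The matrix of the Hamiltonian\<close>

text \<open>Base \<open>d\<close> digits with site 1 the most significant, as in the order of the
  factors of \<open>kron\<close>.\<close>

primrec enc :: "nat \<Rightarrow> nat \<Rightarrow> (nat \<Rightarrow> nat) \<Rightarrow> nat" where
  "enc d 0 \<omega> = 0"
| "enc d (Suc H) \<omega> = enc d H \<omega> * d + \<omega> (Suc H)"

lemma enc_cong: "(\<And>k. k \<in> {1..H} \<Longrightarrow> \<omega> k = \<eta> k) \<Longrightarrow> enc d H \<omega> = enc d H \<eta>"
  by (induction H) auto

lemma enc_append: "enc d (a + b) \<omega> = enc d a \<omega> * d ^ b + enc d b (\<lambda>k. \<omega> (a + k))"
  by (induction b) (auto simp: algebra_simps)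

lemma enc_less: "\<forall>k\<in>{1..H}. \<omega> k < d \<Longrightarrow> enc d H \<omega> < d ^ H"
proof (induction H)
  case (Suc H)
  have "enc d H \<omega> < d ^ H" "\<omega> (Suc H) < d" using Suc by auto
  then have "enc d (Suc H) \<omega> < (enc d H \<omega> + 1) * d" by simp
  also have "\<dots> \<le> d ^ H * d" using \<open>enc d H \<omega> < d ^ H\<close> by (intro mult_right_mono) auto
  finally show ?case by (simp add: mult.commute)
qed simp

lemma enc_surj:
  assumes "i < d ^ H"
  shows "\<exists>\<omega>. (\<forall>k. \<omega> k \<le> (if k \<in> {1..H} then d - 1 else 0)) \<and> enc d H \<omega> = i"
  using assms
proof (induction H arbitrary: i)
  case 0
  then show ?case by (intro exI[of _ "\<lambda>_. 0"]) auto
next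
  case (Suc H)
  then have d: "0 < d" by (cases d) auto
  have "i div d < d ^ H" using Suc.prems by (simp add: less_mult_imp_div_less mult.commute)
  from Suc.IH[OF this] obtain \<omega> where w: "\<And>k. \<omega> k \<le> (if k \<in> {1..H} then d - 1 else 0)" "enc d H \<omega> = i div d"
    by auto
  let ?\<omega> = "\<omega>(Suc H := i mod d)"
  have "enc d H ?\<omega> = i div d" using enc_cong[of H ?\<omega> \<omega> d] w(2) by simp
  then have "enc d (Suc H) ?\<omega> = i" by simp
  moreover have "?\<omega> k \<le> (if k \<in> {1..Suc H} then d - 1 else 0)" for k
  proof (cases "k = Suc H")
    case True
    have "i mod d < d" using d by simp
    then show ?thesis using True by simp
  next
    case False
    then show ?thesis using w(1)[of k] by auto
  qed
  ultimately show ?case by blast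
qed

lemma enc_inj:
  assumes "enc d H \<omega> = enc d H \<eta>" "\<And>k. k \<in> {1..H} \<Longrightarrow> \<omega> k < d" "\<And>k. k \<in> {1..H} \<Longrightarrow> \<eta> k < d" "k \<in> {1..H}"
  shows "\<omega> k = \<eta> k"
  using assms
proof (induction H arbitrary: k)
  case (Suc H)
  have lt: "\<omega> (Suc H) < d" "\<eta> (Suc H) < d" using Suc.prems by auto
  have "enc d (Suc H) \<omega> mod d = \<omega> (Suc H)" "enc d (Suc H) \<eta> mod d = \<eta> (Suc H)" using lt by simp_all
  then have top: "\<omega> (Suc H) = \<eta> (Suc H)" using Suc.prems(1) by metis
  have "enc d (Suc H) \<omega> div d = enc d H \<omega>" "enc d (Suc H) \<eta> div d = enc d H \<eta>" using lt by simp_all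
  then have "enc d H \<omega> = enc d H \<eta>" using Suc.prems(1) by metis
  then show ?case using Suc.IH[of k] Suc.prems top by (cases "k = Suc H") auto
qed simp

section \<open>Matrices acting on functions of the index\<close>

definition app :: "nat \<Rightarrow> complex mat \<Rightarrow> (nat \<Rightarrow> complex) \<Rightarrow> nat \<Rightarrow> complex" where
  "app n M v i = (\<Sum>j<n. M $$ (i, j) * v j)"

lemma mult_mat_vec_app:
  assumes "M \<in> carrier_mat n n" "v \<in> carrier_vec n" "i < n"
  shows "(M *\<^sub>v v) $ i = app n M (\<lambda>j. v $ j) i"
  using assms by (auto simp: app_def scalar_prod_def row_def lessThan_atLeast0 intro!: sum.cong)

lemma app_add: "A \<in> carrier_mat n n \<Longrightarrow> B \<in> carrier_mat n n \<Longrightarrow> i < n \<Longrightarrow> app n (A + B) v i = app n A v i + app n B v i"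
  by (simp add: app_def distrib_right sum.distrib)

lemma app_diff: "A \<in> carrier_mat n n \<Longrightarrow> B \<in> carrier_mat n n \<Longrightarrow> i < n \<Longrightarrow> app n (A - B) v i = app n A v i - app n B v i"
  by (simp add: app_def left_diff_distrib sum_subtractf)

lemma app_smult: "A \<in> carrier_mat n n \<Longrightarrow> i < n \<Longrightarrow> app n (c \<cdot>\<^sub>m A) v i = c * app n A v i"
  by (simp add: app_def sum_distrib_left mult.assoc)

lemma app_one: "i < n \<Longrightarrow> app n (1\<^sub>m n) v i = v i"
proof -
  assume i: "i < n"
  have "app n (1\<^sub>m n) v i = (\<Sum>j<n. if j = i then v j else 0)"
    unfolding app_def using i by (intro sum.cong) auto
  then show ?thesis using i by simp
qed

lemma app_mult:
  assumes "A \<in> carrier_mat n n" "B \<in> carrier_mat n n" "i < n"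
  shows "app n (A * B) v i = app n A (app n B v) i"
proof -
  have "app n (A * B) v i = (\<Sum>j<n. \<Sum>k<n. A $$ (i, k) * B $$ (k, j) * v j)"
    unfolding app_def using assms
    by (intro sum.cong refl) (auto simp: scalar_prod_def lessThan_atLeast0 sum_distrib_right intro!: sum.cong)
  also have "\<dots> = (\<Sum>k<n. \<Sum>j<n. A $$ (i, k) * B $$ (k, j) * v j)" by (rule sum.swap)
  finally show ?thesis by (simp add: app_def sum_distrib_left mult.assoc)
qed

lemma kron_carrier: "A \<in> carrier_mat a a \<Longrightarrow> B \<in> carrier_mat b b \<Longrightarrow> kron A B \<in> carrier_mat (a * b) (a * b)"
  by (auto simp: kron_def)

lemma kron_index:
  assumes "A \<in> carrier_mat a a" "B \<in> carrier_mat b b" "i < a * b" "j < a * b"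
  shows "kron A B $$ (i, j) = A $$ (i div b, j div b) * B $$ (i mod b, j mod b)"
  using assms by (simp add: kron_def)

lemma at_site_dim: "1 \<le> h \<Longrightarrow> h \<le> H \<Longrightarrow> d ^ (h - 1) * (d * d ^ (H - h)) = (d::nat) ^ H"
proof -
  assume "1 \<le> h" "h \<le> H"
  then have "h - 1 + Suc (H - h) = H" by simp
  then show ?thesis by (metis power_Suc power_add)
qed

lemma at_site_carrier:
  assumes "A \<in> carrier_mat d d" "1 \<le> h" "h \<le> H"
  shows "at_site H h (A :: complex mat) \<in> carrier_mat (d ^ H) (d ^ H)"
proof -
  have "dim_row A = d" using assms by auto
  then have "at_site H h A \<in> carrier_mat (d ^ (h - 1) * (d * d ^ (H - h))) (d ^ (h - 1) * (d * d ^ (H - h)))"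
    unfolding at_site_def using assms(1) by (intro kron_carrier) auto
  then show ?thesis by (simp only: at_site_dim[OF assms(2,3)])
qed

text \<open>\<open>div (d * R)\<close> reads the digits before site \<open>h\<close> and
  \<open>mod R\<close> those after it; the identity factors force both to agree.\<close>

lemma at_site_index:
  assumes A: "(A :: complex mat) \<in> carrier_mat d d" and h: "1 \<le> h" "h \<le> H" and ij: "i < d ^ H" "j < d ^ H"
  defines "R \<equiv> d ^ (H - h)"
  shows "at_site H h A $$ (i, j) = (if i div (d * R) = j div (d * R) \<and> i mod R = j mod R
    then A $$ (i div R mod d, j div R mod d) else 0)"
proof -
  have dim: "dim_row A = d" using A by auto
  have d: "0 < d" using ij h by (cases d) (auto simp: zero_power)
  have R: "0 < R" using d by (simp add: R_def)
  have eq: "d ^ (h - 1) * (d * R) = d ^ H" unfolding R_def by (rule at_site_dim[OF h])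
  have lt: "i div (d * R) < d ^ (h - 1)" "j div (d * R) < d ^ (h - 1)"
    using ij eq by (simp_all add: less_mult_imp_div_less)
  have md: "i mod (d * R) < d * R" "j mod (d * R) < d * R" using d R by simp_all
  have dv: "i mod (d * R) div R = i div R mod d" for i
    using mod_mult2_eq[of i R d] R by (simp add: mult.commute)
  have mm: "i mod (d * R) mod R = i mod R" for i by (simp add: mod_mod_cancel)
  have "at_site H h A $$ (i, j) = 1\<^sub>m (d ^ (h - 1)) $$ (i div (d * R), j div (d * R)) *
      kron A (1\<^sub>m R) $$ (i mod (d * R), j mod (d * R))"
    unfolding at_site_def dim R_def[symmetric]
    using A ij eq by (intro kron_index[where a = "d ^ (h - 1)"] kron_carrier) auto
  also have "kron A (1\<^sub>m R) $$ (i mod (d * R), j mod (d * R)) =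
      A $$ (i div R mod d, j div R mod d) * 1\<^sub>m R $$ (i mod R, j mod R)"
    using kron_index[OF A, of "1\<^sub>m R" R "i mod (d * R)" "j mod (d * R)"] md by (simp add: dv mm)
  finally show ?thesis using lt R by simp
qed

lemma enc_site:
  assumes "1 \<le> h" "h \<le> H" and d: "\<forall>k\<in>{1..H}. \<omega> k < d"
  obtains p s where "s < d ^ (H - h)"
    "\<And>b. enc d H (\<omega>(h := b)) = (p * d + b) * d ^ (H - h) + s"
proof
  let ?p = "enc d (h - 1) \<omega>" and ?s = "enc d (H - h) (\<lambda>k. \<omega> (h + k))"
  show "?s < d ^ (H - h)" using assms by (intro enc_less) auto
  fix b
  have H: "H = (h - 1 + 1) + (H - h)" using assms by simp
  have "enc d H (\<omega>(h := b)) = enc d (h - 1 + 1) (\<omega>(h := b)) * d ^ (H - h) + enc d (H - h) (\<lambda>k. (\<omega>(h := b)) ((h - 1 + 1) + k))"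
    by (subst H) (rule enc_append)
  also have "enc d (H - h) (\<lambda>k. (\<omega>(h := b)) ((h - 1 + 1) + k)) = ?s" using assms by (intro enc_cong) auto
  also have "enc d (h - 1 + 1) (\<omega>(h := b)) = enc d (h - 1) (\<omega>(h := b)) * d + b"
    using enc.simps(2)[of d "h - 1" "\<omega>(h := b)"] assms(1) by simp
  also have "enc d (h - 1) (\<omega>(h := b)) = ?p" by (intro enc_cong) auto
  finally show "enc d H (\<omega>(h := b)) = (?p * d + b) * d ^ (H - h) + ?s" .
qed

lemma app_at_site:
  assumes A: "A \<in> carrier_mat d d" and h: "1 \<le> h" "h \<le> H" and d: "\<forall>k\<in>{1..H}. \<omega> k < d"
  shows "app (d ^ H) (at_site H h A) v (enc d H \<omega>) = (\<Sum>b<d. A $$ (\<omega> h, b) * v (enc d H (\<omega>(h := b))))"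
proof -
  define R where "R = d ^ (H - h)"
  obtain p s where s: "s < R" and e: "\<And>b. enc d H (\<omega>(h := b)) = (p * d + b) * R + s"
    unfolding R_def using enc_site[OF h d] by blast
  define i where "i = enc d H \<omega>"
  have lt: "enc d H (\<omega>(h := b)) < d ^ H" if "b < d" for b using d that by (intro enc_less) auto
  have wh: "\<omega> h < d" using d h by simp
  have parts: "((p * d + b) * R + s) div R = p * d + b" "((p * d + b) * R + s) mod R = s"
    "((p * d + b) * R + s) div (d * R) = p" if "b < d" for b
  proof -
    show 1: "((p * d + b) * R + s) div R = p * d + b" "((p * d + b) * R + s) mod R = s" using s by auto
    have "((p * d + b) * R + s) div (d * R) = ((p * d + b) * R + s) div R div d"
      by (simp add: div_mult2_eq mult.commute)
    then show "((p * d + b) * R + s) div (d * R) = p" using that by (simp add: 1)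
  qed
  have i: "i = (p * d + \<omega> h) * R + s" using e[of "\<omega> h"] by (simp add: i_def)
  have iH: "i < d ^ H" using lt[OF wh] by (simp add: i_def)
  let ?I = "(\<lambda>b. (p * d + b) * R + s) ` {..<d}"
  have "app (d ^ H) (at_site H h A) v i = (\<Sum>j\<in>?I. at_site H h A $$ (i, j) * v j)"
    unfolding app_def
  proof (rule sum.mono_neutral_right)
    show "?I \<subseteq> {..<d ^ H}" using lt by (auto simp: e)
    show "\<forall>j\<in>{..<d ^ H} - ?I. at_site H h A $$ (i, j) * v j = 0"
    proof
      fix j assume j: "j \<in> {..<d ^ H} - ?I"
      have "\<not> (i div (d * R) = j div (d * R) \<and> i mod R = j mod R)"
      proof
        assume a: "i div (d * R) = j div (d * R) \<and> i mod R = j mod R"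
        have jd: "j div R div d = p" using a parts(3)[OF wh] by (simp add: i div_mult2_eq mult.commute)
        have "j = (j div R) * R + s" using a parts(2)[OF wh] by (metis i div_mult_mod_eq)
        also have "j div R = p * d + j div R mod d" using jd by (metis div_mult_mod_eq)
        finally have "j = (p * d + j div R mod d) * R + s" .
        moreover have "j div R mod d < d" using wh by simp
        ultimately show False using j by blast
      qed
      then show "at_site H h A $$ (i, j) * v j = 0"
        using at_site_index[OF A h iH, of j] j by (auto simp: R_def)
    qed
  qed simp
  also have "\<dots> = (\<Sum>b<d. at_site H h A $$ (i, (p * d + b) * R + s) * v ((p * d + b) * R + s))"
    using s by (subst sum.reindex) (auto simp: inj_on_def)
  also have "\<dots> = (\<Sum>b<d. A $$ (\<omega> h, b) * v (enc d H (\<omega>(h := b))))"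
  proof (intro sum.cong refl)
    fix b assume "b \<in> {..<d}"
    then have b: "b < d" by simp
    have "at_site H h A $$ (i, (p * d + b) * R + s) = A $$ (\<omega> h, b)"
      using at_site_index[OF A h iH, of "(p * d + b) * R + s"] lt[OF b] wh b
      unfolding R_def[symmetric] by (simp only: e i parts[OF b] parts[OF wh]) simp
    then show "at_site H h A $$ (i, (p * d + b) * R + s) * v ((p * d + b) * R + s) = A $$ (\<omega> h, b) * v (enc d H (\<omega>(h := b)))"
      by (simp add: e)
  qed
  finally show ?thesis by (simp add: i_def)
qed

section \<open>Spin operators in the basis of configurations\<close>

context
  fixes N :: nat and S :: real
  assumes S: "S = real N / 2"
begin

lemma spin_dim_eq: "spin_dim S = Suc N"
  by (simp add: spin_dim_def S)

lemma spin_carriers: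
  "spin_plus S \<in> carrier_mat (Suc N) (Suc N)" "spin_minus S \<in> carrier_mat (Suc N) (Suc N)"
  "spin1 S \<in> carrier_mat (Suc N) (Suc N)" "spin2 S \<in> carrier_mat (Suc N) (Suc N)"
  "spin3 S \<in> carrier_mat (Suc N) (Suc N)"
  by (auto simp: spin_plus_def spin_minus_def spin1_def spin2_def spin3_def spin_dim_eq)

context
  fixes H :: nat and \<omega> :: "nat \<Rightarrow> nat"
  assumes \<omega>: "\<forall>k\<in>{1..H}. \<omega> k < Suc N"
begin

text \<open>The last hypothesis admits a digit \<open>b0\<close> out of range if its amplitude is 0,
  which lets \<open>inc\<close> be applied without a range condition.\<close>

lemma app_single_entry:
  assumes A: "A \<in> carrier_mat (Suc N) (Suc N)" and h: "1 \<le> h" "h \<le> H"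
    and entries: "\<And>b. b < Suc N \<Longrightarrow> A $$ (\<omega> h, b) = (if b = b0 then z else 0)" and z: "N < b0 \<Longrightarrow> z = 0"
  shows "app (Suc N ^ H) (at_site H h A) v (enc (Suc N) H \<omega>) = z * v (enc (Suc N) H (\<omega>(h := b0)))"
proof -
  have "app (Suc N ^ H) (at_site H h A) v (enc (Suc N) H \<omega>)
      = (\<Sum>b<Suc N. if b = b0 then z * v (enc (Suc N) H (\<omega>(h := b0))) else 0)"
    unfolding app_at_site[OF A h \<omega>] using entries by (intro sum.cong refl) auto
  then show ?thesis using z by (simp only: sum.delta finite_lessThan) auto
qed

lemma app_spin3:
  assumes "1 \<le> h" "h \<le> H"
  shows "app (Suc N ^ H) (at_site H h (spin3 S)) v (enc (Suc N) H \<omega>) = of_real (real (\<omega> h) - S) * v (enc (Suc N) H \<omega>)"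
proof -
  have "\<omega> h < Suc N" using \<omega> assms by simp
  then show ?thesis
    using app_single_entry[OF spin_carriers(5) assms, of "\<omega> h" "of_real (real (\<omega> h) - S)" v]
    by (auto simp: spin3_def spin_dim_eq mag_def)
qed

text \<open>Columns are images of basis vectors, so the coefficient of a raised vector at
  \<open>\<omega>\<close> is read off at the lowered configuration. At \<open>\<omega> h = 0\<close>
  the truncated \<open>dec\<close> is harmless, because the amplitude vanishes.\<close>

lemma app_spin_plus:
  assumes "1 \<le> h" "h \<le> H"
  shows "app (Suc N ^ H) (at_site H h (spin_plus S)) v (enc (Suc N) H \<omega>)
    = of_real (sqrt (real (\<omega> h) * (real N - real (\<omega> h) + 1))) * v (enc (Suc N) H (dec \<omega> h))"
  unfolding dec_def
proof (rule app_single_entry[OF spin_carriers(1) assms])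
  have wh: "\<omega> h < Suc N" using \<omega> assms by simp
  fix b assume b: "b < Suc N"
  have "sqrt ((S - mag S b) * (S + mag S b + 1)) = sqrt (real (\<omega> h) * (real N - real (\<omega> h) + 1))" if "\<omega> h = b + 1"
    using that by (simp add: mag_def S algebra_simps)
  then show "spin_plus S $$ (\<omega> h, b) = (if b = \<omega> h - 1 then of_real (sqrt (real (\<omega> h) * (real N - real (\<omega> h) + 1))) else 0)"
    using wh b by (cases "\<omega> h") (auto simp: spin_plus_def spin_dim_eq)
next
  assume "N < \<omega> h - 1"
  moreover have "\<omega> h < Suc N" using \<omega> assms by simp
  ultimately show "complex_of_real (sqrt (real (\<omega> h) * (real N - real (\<omega> h) + 1))) = 0" by simp
qed

lemma app_spin_minus:
  assumes "1 \<le> h" "h \<le> H"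
  shows "app (Suc N ^ H) (at_site H h (spin_minus S)) v (enc (Suc N) H \<omega>)
    = of_real (sqrt ((real (\<omega> h) + 1) * (real N - real (\<omega> h)))) * v (enc (Suc N) H (inc \<omega> h))"
  unfolding inc_def
proof (rule app_single_entry[OF spin_carriers(2) assms])
  have wh: "\<omega> h < Suc N" using \<omega> assms by simp
  fix b assume b: "b < Suc N"
  have "sqrt ((S + mag S b) * (S - mag S b + 1)) = sqrt ((real (\<omega> h) + 1) * (real N - real (\<omega> h)))" if "b = \<omega> h + 1"
    using that by (simp add: mag_def S algebra_simps)
  then show "spin_minus S $$ (\<omega> h, b) = (if b = Suc (\<omega> h) then of_real (sqrt ((real (\<omega> h) + 1) * (real N - real (\<omega> h)))) else 0)"
    using wh b by (auto simp: spin_minus_def spin_dim_eq)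
next
  assume "N < Suc (\<omega> h)"
  moreover have "\<omega> h < Suc N" using \<omega> assms by simp
  ultimately have "\<omega> h = N" by simp
  then show "complex_of_real (sqrt ((real (\<omega> h) + 1) * (real N - real (\<omega> h)))) = 0" by simp
qed

end

lemma app_at_site_linear:
  assumes AB: "A \<in> carrier_mat (Suc N) (Suc N)" "B \<in> carrier_mat (Suc N) (Suc N)" and h: "1 \<le> h" "h \<le> H" and i: "i < Suc N ^ H"
  shows "app (Suc N ^ H) (at_site H h (c \<cdot>\<^sub>m (A + B))) v i
      = c * (app (Suc N ^ H) (at_site H h A) v i + app (Suc N ^ H) (at_site H h B) v i)"
    and "app (Suc N ^ H) (at_site H h (c \<cdot>\<^sub>m (A - B))) v i
      = c * (app (Suc N ^ H) (at_site H h A) v i - app (Suc N ^ H) (at_site H h B) v i)"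
proof -
  obtain \<omega> where w: "\<forall>k. \<omega> k \<le> (if k \<in> {1..H} then Suc N - 1 else 0)" and e: "enc (Suc N) H \<omega> = i"
    using enc_surj[OF i] by blast
  have d: "\<forall>k\<in>{1..H}. \<omega> k < Suc N"
  proof
    fix k assume "k \<in> {1..H}"
    then show "\<omega> k < Suc N" using w[rule_format, of k] by simp
  qed
  have C: "c \<cdot>\<^sub>m (A + B) \<in> carrier_mat (Suc N) (Suc N)" "c \<cdot>\<^sub>m (A - B) \<in> carrier_mat (Suc N) (Suc N)"
    using AB by auto
  have "\<omega> h < Suc N" using d h by simp
  note sites = app_at_site[OF AB(1) h d] app_at_site[OF AB(2) h d]
    app_at_site[OF C(1) h d] app_at_site[OF C(2) h d]
  show "app (Suc N ^ H) (at_site H h (c \<cdot>\<^sub>m (A + B))) v i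
      = c * (app (Suc N ^ H) (at_site H h A) v i + app (Suc N ^ H) (at_site H h B) v i)"
    unfolding e[symmetric] sites sum.distrib[symmetric] sum_distrib_left
    using AB \<open>\<omega> h < Suc N\<close> by (intro sum.cong refl) (auto simp: algebra_simps)
  show "app (Suc N ^ H) (at_site H h (c \<cdot>\<^sub>m (A - B))) v i
      = c * (app (Suc N ^ H) (at_site H h A) v i - app (Suc N ^ H) (at_site H h B) v i)"
    unfolding e[symmetric] sites sum_subtractf[symmetric] sum_distrib_left
    using AB \<open>\<omega> h < Suc N\<close> by (intro sum.cong refl) (auto simp: algebra_simps)
qed

lemma app_cong: "(\<And>j. j < n \<Longrightarrow> u j = v j) \<Longrightarrow> app n M u i = app n M v i"
  by (simp add: app_def)

lemma app_lin: "app n M (\<lambda>j. c * (u j + v j)) i = c * (app n M u i + app n M v i)"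
  and app_lin_diff: "app n M (\<lambda>j. c * (u j - v j)) i = c * (app n M u i - app n M v i)"
  by (simp_all add: app_def algebra_simps sum_distrib_left sum.distrib sum_subtractf)

text \<open>\<open>S\<^sup>1 S\<^sup>1 + S\<^sup>2 S\<^sup>2 = (S\<^sup>+ S\<^sup>- + S\<^sup>- S\<^sup>+) / 2\<close> on the bond.\<close>

lemma app_exchange:
  assumes h: "1 \<le> h" "h < H" and i: "i < Suc N ^ H"
  defines "P \<equiv> \<lambda>h. app (Suc N ^ H) (at_site H h (spin_plus S))"
    and "M \<equiv> \<lambda>h. app (Suc N ^ H) (at_site H h (spin_minus S))"
  shows "app (Suc N ^ H) (at_site H h (spin1 S) * at_site H (h + 1) (spin1 S)
      + at_site H h (spin2 S) * at_site H (h + 1) (spin2 S)) v i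
    = (P h (M (h + 1) v) i + M h (P (h + 1) v) i) / 2"
proof -
  have hh: "1 \<le> h" "h \<le> H" "1 \<le> h + 1" "h + 1 \<le> H" using h by auto
  have C: "at_site H h (spin1 S) \<in> carrier_mat (Suc N ^ H) (Suc N ^ H)" "at_site H (h + 1) (spin1 S) \<in> carrier_mat (Suc N ^ H) (Suc N ^ H)"
    "at_site H h (spin2 S) \<in> carrier_mat (Suc N ^ H) (Suc N ^ H)" "at_site H (h + 1) (spin2 S) \<in> carrier_mat (Suc N ^ H) (Suc N ^ H)"
    using at_site_carrier[OF spin_carriers(3)] at_site_carrier[OF spin_carriers(4)] hh by auto
  have s1: "app (Suc N ^ H) (at_site H k (spin1 S)) u j = 1 / 2 * (P k u j + M k u j)"
    if "1 \<le> k" "k \<le> H" "j < Suc N ^ H" for k u j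
    unfolding spin1_def P_def M_def by (rule app_at_site_linear(1)[OF spin_carriers(1,2) that])
  have s2: "app (Suc N ^ H) (at_site H k (spin2 S)) u j = 1 / (2 * \<i>) * (P k u j - M k u j)"
    if "1 \<le> k" "k \<le> H" "j < Suc N ^ H" for k u j
    unfolding spin2_def P_def M_def by (rule app_at_site_linear(2)[OF spin_carriers(1,2) that])
  have 1: "app (Suc N ^ H) (at_site H h (spin1 S)) (app (Suc N ^ H) (at_site H (h + 1) (spin1 S)) v) i
      = 1 / 4 * (P h (P (h + 1) v) i + P h (M (h + 1) v) i + (M h (P (h + 1) v) i + M h (M (h + 1) v) i))"
  proof -
    have "app (Suc N ^ H) (at_site H h (spin1 S)) (app (Suc N ^ H) (at_site H (h + 1) (spin1 S)) v) i
      = app (Suc N ^ H) (at_site H h (spin1 S)) (\<lambda>j. 1 / 2 * (P (h + 1) v j + M (h + 1) v j)) i"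
      by (intro app_cong s1 hh)
    also have "\<dots> = 1 / 2 * (P h (\<lambda>j. 1 / 2 * (P (h + 1) v j + M (h + 1) v j)) i + M h (\<lambda>j. 1 / 2 * (P (h + 1) v j + M (h + 1) v j)) i)"
      by (rule s1[OF hh(1,2) i])
    also have "\<dots> = 1 / 4 * (P h (P (h + 1) v) i + P h (M (h + 1) v) i + (M h (P (h + 1) v) i + M h (M (h + 1) v) i))"
      unfolding P_def M_def app_lin distrib_left[symmetric] by (simp only: mult.assoc[symmetric]) simp
    finally show ?thesis .
  qed
  have 2: "app (Suc N ^ H) (at_site H h (spin2 S)) (app (Suc N ^ H) (at_site H (h + 1) (spin2 S)) v) i
      = - 1 / 4 * (P h (P (h + 1) v) i - P h (M (h + 1) v) i - (M h (P (h + 1) v) i - M h (M (h + 1) v) i))"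
  proof -
    have "app (Suc N ^ H) (at_site H h (spin2 S)) (app (Suc N ^ H) (at_site H (h + 1) (spin2 S)) v) i
      = app (Suc N ^ H) (at_site H h (spin2 S)) (\<lambda>j. 1 / (2 * \<i>) * (P (h + 1) v j - M (h + 1) v j)) i"
      by (intro app_cong s2 hh)
    also have "\<dots> = 1 / (2 * \<i>) * (P h (\<lambda>j. 1 / (2 * \<i>) * (P (h + 1) v j - M (h + 1) v j)) i - M h (\<lambda>j. 1 / (2 * \<i>) * (P (h + 1) v j - M (h + 1) v j)) i)"
      by (rule s2[OF hh(1,2) i])
    also have "\<dots> = (1 / (2 * \<i>) * (1 / (2 * \<i>))) * (P h (P (h + 1) v) i - P h (M (h + 1) v) i - (M h (P (h + 1) v) i - M h (M (h + 1) v) i))"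
      unfolding P_def M_def app_lin_diff by (simp add: algebra_simps)
    also have "1 / (2 * \<i>) * (1 / (2 * \<i>)) = - 1 / 4" by simp
    finally show ?thesis .
  qed
  have "1 / 4 * (a + b + (c + e)) + - 1 / 4 * (a - b - (c - e)) = (b + c) / 2" for a b c e :: complex
  proof -
    have "4 * (1 / 4 * x + - 1 / 4 * y) = x - y" for x y :: complex by (simp add: distrib_left)
    from this[of "a + b + (c + e)" "a - b - (c - e)"]
    have "4 * (1 / 4 * (a + b + (c + e)) + - 1 / 4 * (a - b - (c - e))) = 4 * ((b + c) / 2)" by simp
    then show ?thesis by (simp only: mult_cancel_left) simp
  qed
  then show ?thesis
    unfolding app_add[OF mult_carrier_mat[OF C(1,2)] mult_carrier_mat[OF C(3,4)] i] app_mult[OF C(1,2) i] app_mult[OF C(3,4) i] 1 2 .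
qed

lemma app_bond:
  assumes h: "1 \<le> h" "h < H" and \<omega>: "\<forall>k\<in>{1..H}. \<omega> k < Suc N"
  shows "app (Suc N ^ H) (bond_hamiltonian \<Delta> S H h) v (enc (Suc N) H \<omega>) =
    of_real (S\<^sup>2 - (real (\<omega> h) - S) * (real (\<omega> (h + 1)) - S) + S * sqrt (1 - 1 / \<Delta>\<^sup>2) * (real (\<omega> (h + 1)) - real (\<omega> h))) * v (enc (Suc N) H \<omega>)
    - of_real (1 / (2 * \<Delta>)) * (of_real (sqrt (real (\<omega> h) * (real N - real (\<omega> h) + 1)) * sqrt ((real (\<omega> (h + 1)) + 1) * (real N - real (\<omega> (h + 1)))))
          * v (enc (Suc N) H (inc (dec \<omega> h) (h + 1)))
        + of_real (sqrt (real (\<omega> (h + 1)) * (real N - real (\<omega> (h + 1)) + 1)) * sqrt ((real (\<omega> h) + 1) * (real N - real (\<omega> h))))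
          * v (enc (Suc N) H (inc (dec \<omega> (h + 1)) h)))"
proof -
  let ?n = "Suc N ^ H" and ?i = "enc (Suc N) H \<omega>"
  have hh: "1 \<le> h" "h \<le> H" "1 \<le> h + 1" "h + 1 \<le> H" using h by auto
  have i: "?i < ?n" by (rule enc_less[OF \<omega>])
  let ?C = "carrier_mat ?n ?n"
  have C: "at_site H h (spin1 S) \<in> ?C" "at_site H (h + 1) (spin1 S) \<in> ?C"
    "at_site H h (spin2 S) \<in> ?C" "at_site H (h + 1) (spin2 S) \<in> ?C"
    "at_site H h (spin3 S) \<in> ?C" "at_site H (h + 1) (spin3 S) \<in> ?C"
    using at_site_carrier[OF spin_carriers(3)] at_site_carrier[OF spin_carriers(4)] at_site_carrier[OF spin_carriers(5)] hh by auto
  have C2: "at_site H h (spin1 S) * at_site H (h + 1) (spin1 S) + at_site H h (spin2 S) * at_site H (h + 1) (spin2 S) \<in> ?C"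
    "at_site H h (spin3 S) * at_site H (h + 1) (spin3 S) \<in> ?C" "at_site H (h + 1) (spin3 S) - at_site H h (spin3 S) \<in> ?C"
    "(1\<^sub>m ?n :: complex mat) \<in> ?C"
    using C by auto
  have expand: "app ?n (a \<cdot>\<^sub>m 1\<^sub>m ?n - b \<cdot>\<^sub>m X - Y + c \<cdot>\<^sub>m W) v ?i = a * v ?i - b * app ?n X v ?i - app ?n Y v ?i + c * app ?n W v ?i"
    if "X \<in> ?C" "Y \<in> ?C" "W \<in> ?C" for a b c X Y W
  proof -
    have s: "a \<cdot>\<^sub>m 1\<^sub>m ?n \<in> ?C" "b \<cdot>\<^sub>m X \<in> ?C" "c \<cdot>\<^sub>m W \<in> ?C" using that by auto
    have s2: "a \<cdot>\<^sub>m 1\<^sub>m ?n - b \<cdot>\<^sub>m X \<in> ?C" by (rule minus_carrier_mat[OF s(2)])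
    have s3: "a \<cdot>\<^sub>m 1\<^sub>m ?n - b \<cdot>\<^sub>m X - Y \<in> ?C" by (rule minus_carrier_mat[OF that(2)])
    show ?thesis
      unfolding app_add[OF s3 s(3) i] app_diff[OF s2 that(2) i] app_diff[OF s(1,2) i]
        app_smult[OF that(1) i] app_smult[OF that(3) i] app_smult[OF C2(4) i] app_one[OF i] ..
  qed
  have dec: "\<forall>k\<in>{1..H}. dec \<omega> h k < Suc N"
    using \<omega> hh by (auto simp: dec_def less_Suc_eq_le intro: le_diff_conv[THEN iffD2] diff_le_self[THEN order_trans])
  have pm: "app ?n (at_site H h (spin_plus S)) (app ?n (at_site H (h + 1) (spin_minus S)) v) ?i
      = of_real (sqrt (real (\<omega> h) * (real N - real (\<omega> h) + 1)) * sqrt ((real (\<omega> (h + 1)) + 1) * (real N - real (\<omega> (h + 1)))))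
          * v (enc (Suc N) H (inc (dec \<omega> h) (h + 1)))"
    unfolding app_spin_plus[OF \<omega> hh(1,2)] app_spin_minus[OF dec hh(3,4)] by (simp add: dec_def)
  have mp: "app ?n (at_site H h (spin_minus S)) (app ?n (at_site H (h + 1) (spin_plus S)) v) ?i
      = of_real (sqrt (real (\<omega> (h + 1)) * (real N - real (\<omega> (h + 1)) + 1)) * sqrt ((real (\<omega> h) + 1) * (real N - real (\<omega> h))))
          * v (enc (Suc N) H (inc (dec \<omega> (h + 1)) h))"
  \<comment> \<open>For \<open>\<omega> h = N\<close> the configuration
    \<open>inc \<omega> h\<close> leaves the digit range, but its amplitude is zero.\<close>
  proof (cases "\<omega> h = N")
    case True
    then show ?thesis unfolding app_spin_minus[OF \<omega> hh(1,2)] by simp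
  next
    case False
    have inc: "\<forall>k\<in>{1..H}. inc \<omega> h k < Suc N"
    proof
      fix k assume "k \<in> {1..H}"
      then have "\<omega> k < Suc N" using \<omega> by blast
      then show "inc \<omega> h k < Suc N" using False by (cases "k = h") (auto simp: inc_def)
    qed
    have "dec (inc \<omega> h) (h + 1) = inc (dec \<omega> (h + 1)) h" "inc \<omega> h (h + 1) = \<omega> (h + 1)"
      by (auto simp: inc_def dec_def fun_eq_iff)
    then show ?thesis
      unfolding app_spin_minus[OF \<omega> hh(1,2)] app_spin_plus[OF inc hh(3,4)] by simp
  qed
  have z2: "app ?n (at_site H h (spin3 S) * at_site H (h + 1) (spin3 S)) v ?i
      = of_real ((real (\<omega> h) - S) * (real (\<omega> (h + 1)) - S)) * v ?i"
    unfolding app_mult[OF C(5,6) i] app_spin3[OF \<omega> hh(1,2)] app_spin3[OF \<omega> hh(3,4)] by simp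
  have z1: "app ?n (at_site H (h + 1) (spin3 S) - at_site H h (spin3 S)) v ?i
      = of_real (real (\<omega> (h + 1)) - real (\<omega> h)) * v ?i"
    unfolding app_diff[OF C(6,5) i] app_spin3[OF \<omega> hh(1,2)] app_spin3[OF \<omega> hh(3,4)] by (simp add: algebra_simps)
  show ?thesis
    unfolding bond_hamiltonian_def spin_dim_eq expand[OF C2(1,2,3)] app_exchange[OF h i] pm mp z2 z1
    by (simp add: algebra_simps)
qed

lemma xxz_carrier: "xxz_hamiltonian \<Delta> S H \<in> carrier_mat (Suc N ^ H) (Suc N ^ H)"
  by (simp add: xxz_hamiltonian_def spin_dim_eq)

lemma app_xxz:
  assumes "i < Suc N ^ H"
  shows "app (Suc N ^ H) (xxz_hamiltonian \<Delta> S H) v i = (\<Sum>h\<in>{1..<H}. app (Suc N ^ H) (bond_hamiltonian \<Delta> S H h) v i)"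
proof -
  have "{1..H - 1} = {1..<H}" by auto
  then have "app (Suc N ^ H) (xxz_hamiltonian \<Delta> S H) v i
      = (\<Sum>j<Suc N ^ H. \<Sum>h\<in>{1..<H}. bond_hamiltonian \<Delta> S H h $$ (i, j) * v j)"
    unfolding app_def using assms
    by (intro sum.cong refl) (simp add: xxz_hamiltonian_def spin_dim_eq sum_distrib_right)
  also have "\<dots> = (\<Sum>h\<in>{1..<H}. \<Sum>j<Suc N ^ H. bond_hamiltonian \<Delta> S H h $$ (i, j) * v j)"
    by (rule sum.swap)
  finally show ?thesis by (simp add: app_def)
qed

end

section \<open>The kink Hamiltonian as a generator\<close>

lemma choose_step: "real (Suc c) * real (N choose Suc c) = real (N - c) * real (N choose c)"
proof -
  have "Suc c * (N choose Suc c) = (N - c) * (N choose c)"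
    using times_binomial_minus1_eq[of "Suc c" N] binomial_absorb_comp[of N c] by simp
  then show ?thesis by (metis of_nat_mult)
qed

text \<open>The matrix element is the geometric mean of a forward and a backward rate;
  \<open>rel\<close>, detailed balance with rate ratio \<open>r\<^sup>2\<close>, turns it into
  \<open>r\<close> times the forward count.\<close>

lemma amplitude:
  fixes n x y r u u' :: real
  assumes nonneg: "0 \<le> x" "0 \<le> y" "x \<le> n" "y \<le> n" "0 \<le> u" "0 \<le> u'" "0 \<le> r"
    and rel: "u' * ((n - x + 1) * (y + 1)) = u * (x * (n - y)) * r\<^sup>2"
  shows "sqrt (x * (n - x + 1)) * sqrt ((y + 1) * (n - y)) * sqrt u' = r * (x * (n - y)) * sqrt u"
proof -
  have "sqrt (x * (n - x + 1)) * sqrt ((y + 1) * (n - y)) * sqrt u' = sqrt ((x * (n - y)) * (u' * ((n - x + 1) * (y + 1))))"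
    by (simp add: real_sqrt_mult[symmetric] mult_ac)
  also have "\<dots> = sqrt ((r * (x * (n - y)))\<^sup>2 * u)" unfolding rel by (simp add: power2_eq_square mult_ac)
  also have "\<dots> = r * (x * (n - y)) * sqrt u" using nonneg by (simp add: real_sqrt_mult)
  finally show ?thesis .
qed

context spin_rows
begin

section \<open>Detailed balance of the jump process\<close>

definition confs :: "(nat \<Rightarrow> nat) set" where
  "confs = {\<omega>. \<forall>h. \<omega> h \<le> (if h \<in> {1..H} then N else 0)}"

lemma confs_digits: "\<omega> \<in> confs \<Longrightarrow> \<forall>k\<in>{1..H}. \<omega> k < Suc N"
  unfolding confs_def by (auto simp: less_Suc_eq_le dest!: spec split: if_splits)

lemma confsD: "\<omega> \<in> confs \<Longrightarrow> h \<in> {1..H} \<Longrightarrow> \<omega> h \<le> N"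
  using confs_digits[of \<omega>] by (simp add: less_Suc_eq_le)

lemma confs_conf: "\<omega> \<in> confs \<longleftrightarrow> \<omega> \<in> conf N (tot \<omega>)"
  by (simp add: confs_def conf_def)

lemma wt_confs_pos: "\<omega> \<in> confs \<Longrightarrow> 0 < wt N \<omega>"
  using wt_conf_pos confs_conf by blast

lemma mv_confs:
  assumes "\<omega> \<in> confs" "k \<in> {1..H}" "l \<in> {1..H}" "\<omega> l < N" "k \<noteq> l"
  shows "mv k l \<omega> \<in> confs"
  unfolding confs_def
proof (rule CollectI, rule allI)
  fix h
  have "\<omega> h \<le> (if h \<in> {1..H} then N else 0)" using assms(1) unfolding confs_def by blast
  then show "mv k l \<omega> h \<le> (if h \<in> {1..H} then N else 0)"
    using assms(2-) by (auto simp: mv_def inc_def dec_def)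
qed

text \<open>Comes from the ratio of consecutive binomial coefficients, \<open>choose_step\<close>,
  in the two columns concerned.\<close>

lemma wt_mv:
  assumes kl: "k \<in> {1..H}" "l \<in> {1..H}" "k \<noteq> l" and le: "1 \<le> \<omega> k" "\<omega> k \<le> N" "\<omega> l \<le> N"
  shows "wt N (mv k l \<omega>) * ((real N - real (\<omega> k) + 1) * (real (\<omega> l) + 1)) * w ^ k
    = wt N \<omega> * (real (\<omega> k) * (real N - real (\<omega> l))) * w ^ l"
proof -
  define P where "P = (\<Prod>h\<in>{1..H} - {k} - {l}. real (N choose \<omega> h) * (w ^ h) ^ \<omega> h)"
  have split: "wt N \<eta> = (real (N choose \<eta> k) * (w ^ k) ^ \<eta> k) * ((real (N choose \<eta> l) * (w ^ l) ^ \<eta> l) *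
      (\<Prod>h\<in>{1..H} - {k} - {l}. real (N choose \<eta> h) * (w ^ h) ^ \<eta> h))" for \<eta>
  proof -
    have "wt N \<eta> = (real (N choose \<eta> k) * (w ^ k) ^ \<eta> k) * (\<Prod>h\<in>{1..H} - {k}. real (N choose \<eta> h) * (w ^ h) ^ \<eta> h)"
      unfolding wt_def using kl by (intro prod.remove) auto
    also have "(\<Prod>h\<in>{1..H} - {k}. real (N choose \<eta> h) * (w ^ h) ^ \<eta> h) = (real (N choose \<eta> l) * (w ^ l) ^ \<eta> l) *
      (\<Prod>h\<in>{1..H} - {k} - {l}. real (N choose \<eta> h) * (w ^ h) ^ \<eta> h)"
      using kl by (intro prod.remove) auto
    finally show ?thesis .
  qed
  obtain x where x: "\<omega> k = Suc x" using le(1) by (cases "\<omega> k") auto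
  have P: "(\<Prod>h\<in>{1..H} - {k} - {l}. real (N choose mv k l \<omega> h) * (w ^ h) ^ mv k l \<omega> h) = P"
    unfolding P_def by (intro prod.cong) (auto simp: mv_def inc_def dec_def)
  have mvk: "mv k l \<omega> k = x" "mv k l \<omega> l = Suc (\<omega> l)" using kl x by (auto simp: mv_def inc_def dec_def)
  define cx cx' cy cy' where "cx = real (N choose Suc x)" and "cx' = real (N choose x)"
    and "cy = real (N choose \<omega> l)" and "cy' = real (N choose Suc (\<omega> l))"
  have c: "(real x + 1) * cx = (real N - real x) * cx'" "(real (\<omega> l) + 1) * cy' = (real N - real (\<omega> l)) * cy"
    using choose_step[of x N] choose_step[of "\<omega> l" N] le x
    by (simp_all add: cx_def cx'_def cy_def cy'_def of_nat_diff add.commute)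
  have "wt N (mv k l \<omega>) * ((real N - real (\<omega> k) + 1) * (real (\<omega> l) + 1)) * w ^ k
      = ((real N - real x) * cx') * ((real (\<omega> l) + 1) * cy') * ((w ^ k) ^ Suc x * (w ^ l) ^ \<omega> l * P) * w ^ l"
    unfolding split[of "mv k l \<omega>"] P mvk by (simp add: x cx'_def cy'_def mult_ac)
  also have "\<dots> = ((real x + 1) * cx) * ((real N - real (\<omega> l)) * cy) * ((w ^ k) ^ Suc x * (w ^ l) ^ \<omega> l * P) * w ^ l"
    unfolding c ..
  also have "\<dots> = wt N \<omega> * (real (\<omega> k) * (real N - real (\<omega> l))) * w ^ l"
    unfolding split[of \<omega>] P_def[symmetric] by (simp add: x cx_def cy_def mult_ac add.commute)
  finally show ?thesis .
qed

text \<open>\<open>r\<close> will be \<open>q\<close> for a jump up and \<open>1 / q\<close> for a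
  jump down. If \<open>k\<close> is empty or \<open>l\<close> is full, both sides vanish.\<close>

lemma amplitude_move:
  assumes w: "\<omega> \<in> confs" and kl: "k \<in> {1..H}" "l \<in> {1..H}" "k \<noteq> l" and r: "0 \<le> r" "w ^ l = w ^ k * r\<^sup>2"
  shows "sqrt (real (\<omega> k) * (real N - real (\<omega> k) + 1)) * sqrt ((real (\<omega> l) + 1) * (real N - real (\<omega> l)))
      * sqrt (wt N (mv k l \<omega>)) = r * jump k l \<omega> * sqrt (wt N \<omega>)"
proof (cases "\<omega> k = 0 \<or> \<omega> l = N")
  case False
  have le: "\<omega> k \<le> N" "\<omega> l \<le> N" using confsD[OF w] kl by auto
  have "mv k l \<omega> \<in> confs" using mv_confs[OF w kl(1,2) _ kl(3)] False le by auto
  note pos = wt_confs_pos[OF this] wt_confs_pos[OF w]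
  have "wt N (mv k l \<omega>) * ((real N - real (\<omega> k) + 1) * (real (\<omega> l) + 1)) * w ^ k
      = wt N \<omega> * (real (\<omega> k) * (real N - real (\<omega> l))) * r\<^sup>2 * w ^ k"
    using wt_mv[OF kl, of \<omega>] False le unfolding r(2) by (simp add: mult_ac)
  then have "wt N (mv k l \<omega>) * ((real N - real (\<omega> k) + 1) * (real (\<omega> l) + 1))
      = wt N \<omega> * (real (\<omega> k) * (real N - real (\<omega> l))) * r\<^sup>2"
    unfolding mult_right_cancel[OF less_imp_neq[OF zero_less_power[OF w_pos, of k], symmetric]] .
  from amplitude[OF _ _ _ _ _ _ _ this] show ?thesis
    using le pos r(1) by (simp add: jump_def)
qed (auto simp: jump_def)

definition gen_c :: "((nat \<Rightarrow> nat) \<Rightarrow> complex) \<Rightarrow> (nat \<Rightarrow> nat) \<Rightarrow> complex" where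
  "gen_c f \<omega> = (\<Sum>h\<in>{1..<H}. of_real (up_rate * jump h (Suc h) \<omega>) * (f (mv h (Suc h) \<omega>) - f \<omega>)
     + of_real (down_rate * jump (Suc h) h \<omega>) * (f (mv (Suc h) h \<omega>) - f \<omega>))"

lemma gen_Re: "gen (\<lambda>\<eta>. Re (f \<eta>)) \<omega> = Re (gen_c f \<omega>)" and gen_Im: "gen (\<lambda>\<eta>. Im (f \<eta>)) \<omega> = Im (gen_c f \<omega>)"
  by (simp_all add: gen_def gen_c_def)

lemma gen_c_of_real: "gen_c (\<lambda>\<eta>. of_real (f \<eta>)) \<omega> = of_real (gen f \<omega>)"
  by (simp add: gen_def gen_c_def)

section \<open>Conjugation of the Hamiltonian into the generator\<close>

context
  fixes \<Delta> S :: real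
  assumes \<Delta>: "2 * \<Delta> * q = 1 + w" and S: "S = real N / 2"
begin

lemma \<Delta>_rates: "up_rate = q / (2 * \<Delta>)" "down_rate = 1 / q / (2 * \<Delta>)" "sqrt (1 - 1 / \<Delta>\<^sup>2) = down_rate - up_rate"
proof -
  have w1: "1 + w \<noteq> 0" using w_pos by simp
  have "\<Delta> = (1 + w) / (2 * q)" using \<Delta> q_pos by (simp add: field_simps)
  then have D: "1 / \<Delta> = 2 * q / (1 + w)" by simp
  have "q / (2 * \<Delta>) = q / 2 * (1 / \<Delta>)" by simp
  then show "up_rate = q / (2 * \<Delta>)" unfolding D by (simp add: up_rate_def w_def power2_eq_square)
  have "1 / q / (2 * \<Delta>) = 1 / q / 2 * (1 / \<Delta>)" by simp
  then show "down_rate = 1 / q / (2 * \<Delta>)" unfolding D using q_pos by (simp add: down_rate_def)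
  have "1 - 1 / \<Delta>\<^sup>2 = 1 - (1 / \<Delta>)\<^sup>2" by (simp add: power_divide)
  also have "\<dots> = ((1 + w)\<^sup>2 - 4 * w) / (1 + w)\<^sup>2" unfolding D using w1 by (simp add: power_divide power_mult_distrib diff_divide_distrib w_def)
  also have "(1 + w)\<^sup>2 - 4 * w = (1 - w)\<^sup>2" by (simp add: power2_eq_square algebra_simps)
  finally have "sqrt (1 - 1 / \<Delta>\<^sup>2) = \<bar>(1 - w) / (1 + w)\<bar>" by (simp add: power_divide[symmetric])
  also have "\<dots> = (1 - w) / (1 + w)" using w_pos w_less by (intro abs_of_nonneg) simp
  also have "\<dots> = down_rate - up_rate" by (simp add: down_rate_def up_rate_def diff_divide_distrib)
  finally show "sqrt (1 - 1 / \<Delta>\<^sup>2) = down_rate - up_rate" .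
qed

text \<open>The boundary field is just what makes the diagonal the total exit rate of the bond, so
  that the conjugated operator annihilates constants.\<close>

lemma bond_diagonal:
  "S\<^sup>2 - (x - S) * (y - S) + S * sqrt (1 - 1 / \<Delta>\<^sup>2) * (y - x) = up_rate * (x * (real N - y)) + down_rate * (y * (real N - x))"
proof -
  have d: "down_rate = 1 - up_rate" using rates_sum by simp
  show ?thesis unfolding \<Delta>_rates(3) d S by (simp add: power2_eq_square field_simps)
qed

lemma hop_amplitude:
  fixes v :: "nat \<Rightarrow> complex" and f :: "(nat \<Rightarrow> nat) \<Rightarrow> complex"
  assumes v: "\<And>\<eta>. \<eta> \<in> confs \<Longrightarrow> v (enc (Suc N) H \<eta>) = of_real (sqrt (wt N \<eta>)) * f \<eta>" and w: "\<omega> \<in> confs"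
    and kl: "k \<in> {1..H}" "l \<in> {1..H}" "k \<noteq> l" and r: "0 \<le> r" "w ^ l = w ^ k * r\<^sup>2"
  shows "of_real (1 / (2 * \<Delta>)) * (of_real (sqrt (real (\<omega> k) * (real N - real (\<omega> k) + 1)) * sqrt ((real (\<omega> l) + 1) * (real N - real (\<omega> l))))
      * v (enc (Suc N) H (mv k l \<omega>))) = of_real (sqrt (wt N \<omega>)) * (of_real (r / (2 * \<Delta>) * jump k l \<omega>) * f (mv k l \<omega>))"
proof (cases "\<omega> l = N")
  case True
  then show ?thesis by (simp add: jump_def)
next
  case False
  then have ev: "v (enc (Suc N) H (mv k l \<omega>)) = of_real (sqrt (wt N (mv k l \<omega>))) * f (mv k l \<omega>)"
    using mv_confs[OF w kl(1,2) _ kl(3)] confsD[OF w kl(2)] by (intro v) simp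
  define A where "A = sqrt (real (\<omega> k) * (real N - real (\<omega> k) + 1)) * sqrt ((real (\<omega> l) + 1) * (real N - real (\<omega> l)))"
  have "1 / (2 * \<Delta>) * (A * sqrt (wt N (mv k l \<omega>))) = sqrt (wt N \<omega>) * (r / (2 * \<Delta>) * jump k l \<omega>)"
    using amplitude_move[OF w kl r] by (simp add: A_def mult_ac)
  then have "(of_real (1 / (2 * \<Delta>) * (A * sqrt (wt N (mv k l \<omega>)))) :: complex) = of_real (sqrt (wt N \<omega>) * (r / (2 * \<Delta>) * jump k l \<omega>))"
    by (rule arg_cong[where f = of_real])
  from arg_cong[OF this, of "\<lambda>z. z * f (mv k l \<omega>)"] show ?thesis
    unfolding ev A_def[symmetric] by (simp only: of_real_mult mult.assoc)
qed

lemma xxz_action: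
  assumes v: "\<And>\<eta>. \<eta> \<in> confs \<Longrightarrow> v (enc (Suc N) H \<eta>) = of_real (sqrt (wt N \<eta>)) * f \<eta>" and w: "\<omega> \<in> confs"
  shows "app (Suc N ^ H) (xxz_hamiltonian \<Delta> S H) v (enc (Suc N) H \<omega>) = - (of_real (sqrt (wt N \<omega>)) * gen_c f \<omega>)"
proof -
  note dig = confs_digits[OF w]
  have "app (Suc N ^ H) (bond_hamiltonian \<Delta> S H h) v (enc (Suc N) H \<omega>) =
      - (of_real (sqrt (wt N \<omega>)) * (of_real (up_rate * jump h (Suc h) \<omega>) * (f (mv h (Suc h) \<omega>) - f \<omega>)
         + of_real (down_rate * jump (Suc h) h \<omega>) * (f (mv (Suc h) h \<omega>) - f \<omega>)))" if h: "h \<in> {1..<H}" for h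
  proof -
    have hH: "h \<in> {1..H}" "Suc h \<in> {1..H}" "1 \<le> h" "h < H" using h by auto
    define A where "A = sqrt (real (\<omega> h) * (real N - real (\<omega> h) + 1)) * sqrt ((real (\<omega> (h + 1)) + 1) * (real N - real (\<omega> (h + 1))))"
    define B where "B = sqrt (real (\<omega> (h + 1)) * (real N - real (\<omega> (h + 1)) + 1)) * sqrt ((real (\<omega> h) + 1) * (real N - real (\<omega> h)))"
    have up: "of_real (1 / (2 * \<Delta>)) * (of_real A * v (enc (Suc N) H (inc (dec \<omega> h) (h + 1))))
        = of_real (sqrt (wt N \<omega>)) * (of_real (up_rate * jump h (Suc h) \<omega>) * f (mv h (Suc h) \<omega>))"
      using hop_amplitude[OF v w hH(1,2), of q] q_pos by (simp add: A_def \<Delta>_rates mv_def w_def)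
    have down: "of_real (1 / (2 * \<Delta>)) * (of_real B * v (enc (Suc N) H (inc (dec \<omega> (h + 1)) h)))
        = of_real (sqrt (wt N \<omega>)) * (of_real (down_rate * jump (Suc h) h \<omega>) * f (mv (Suc h) h \<omega>))"
      using hop_amplitude[OF v w hH(2,1), of "1 / q"] q_pos by (simp add: B_def \<Delta>_rates mv_def w_def power_divide)
    have diag: "S\<^sup>2 - (real (\<omega> h) - S) * (real (\<omega> (h + 1)) - S) + S * sqrt (1 - 1 / \<Delta>\<^sup>2) * (real (\<omega> (h + 1)) - real (\<omega> h))
        = up_rate * jump h (Suc h) \<omega> + down_rate * jump (Suc h) h \<omega>"
      unfolding bond_diagonal jump_def by simp
    show ?thesis
      unfolding app_bond[OF S hH(3,4) dig] diag A_def[symmetric] B_def[symmetric] distrib_left[of "of_real (1 / (2 * \<Delta>))"] up down v[OF w]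
      by (simp add: algebra_simps)
  qed
  then show ?thesis
    unfolding app_xxz[OF S enc_less[OF dig]] gen_c_def sum_distrib_left sum_negf[symmetric]
    by (intro sum.cong refl) auto
qed

lemma enc_confs_surj: "i < Suc N ^ H \<Longrightarrow> \<exists>\<omega>\<in>confs. enc (Suc N) H \<omega> = i"
  using enc_surj[of i "Suc N" H] unfolding confs_def diff_Suc_1 by blast

lemma enc_confs_inj:
  assumes "\<omega> \<in> confs" "\<eta> \<in> confs" "enc (Suc N) H \<omega> = enc (Suc N) H \<eta>"
  shows "\<omega> = \<eta>"
proof
  fix k
  show "\<omega> k = \<eta> k"
  proof (cases "k \<in> {1..H}")
    case True
    then show ?thesis using enc_inj[OF assms(3)] confs_digits[OF assms(1)] confs_digits[OF assms(2)] by blast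
  next
    case False
    have "\<omega> k \<le> (if k \<in> {1..H} then N else 0)" "\<eta> k \<le> (if k \<in> {1..H} then N else 0)"
      using assms(1,2) unfolding confs_def by blast+
    then show ?thesis using False by (simp only: if_False)
  qed
qed

section \<open>Passing between eigenvectors of the matrix and eigenfunctions of the
  generator\<close>

lemma eigenvalue_lower_bound:
  assumes H: "1 \<le> H" and x: "x \<noteq> 0" and ev: "eigenvalue (xxz_hamiltonian \<Delta> S H) (complex_of_real x)"
  shows "row_gap * overlap / 28 * N \<le> x"
proof -
  let ?A = "xxz_hamiltonian \<Delta> S H" and ?n = "Suc N ^ H"
  have A: "?A \<in> carrier_mat ?n ?n" by (rule xxz_carrier[OF S])
  then have dim: "dim_row ?A = ?n" by simp
  obtain v where v: "v \<in> carrier_vec ?n" "v \<noteq> 0\<^sub>v ?n" "?A *\<^sub>v v = complex_of_real x \<cdot>\<^sub>v v"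
    using ev unfolding eigenvalue_def eigenvector_def dim by blast
  define f where "f \<omega> = v $ enc (Suc N) H \<omega> / of_real (sqrt (wt N \<omega>))" for \<omega>
  have vf: "v $ enc (Suc N) H \<eta> = of_real (sqrt (wt N \<eta>)) * f \<eta>" if "\<eta> \<in> confs" for \<eta>
    using wt_confs_pos[OF that] by (simp add: f_def)
  have gen: "gen_c f \<omega> = - of_real x * f \<omega>" if w: "\<omega> \<in> confs" for \<omega>
  proof -
    have i: "enc (Suc N) H \<omega> < ?n" by (rule enc_less[OF confs_digits[OF w]])
    have "of_real x * v $ enc (Suc N) H \<omega> = (?A *\<^sub>v v) $ enc (Suc N) H \<omega>" using v(1) i by (simp add: v(3))
    also have "\<dots> = - (of_real (sqrt (wt N \<omega>)) * gen_c f \<omega>)"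
      unfolding mult_mat_vec_app[OF A v(1) i] by (rule xxz_action[OF vf w])
    finally have "of_real (sqrt (wt N \<omega>)) * gen_c f \<omega> = of_real (sqrt (wt N \<omega>)) * (- of_real x * f \<omega>)"
      unfolding vf[OF w] by (simp add: mult.left_commute)
    moreover have "complex_of_real (sqrt (wt N \<omega>)) \<noteq> 0" using wt_confs_pos[OF w] by simp
    ultimately show ?thesis using mult_left_cancel by blast
  qed
  have "\<exists>i<?n. v $ i \<noteq> 0"
  proof (rule ccontr)
    assume "\<not> (\<exists>i<?n. v $ i \<noteq> 0)"
    then have "v = 0\<^sub>v ?n" using v(1) by (intro eq_vecI) auto
    then show False using v(2) by simp
  qed
  then obtain i where i: "i < ?n" "v $ i \<noteq> 0" by blast
  then obtain \<omega> where w: "\<omega> \<in> confs" "enc (Suc N) H \<omega> = i" using enc_confs_surj by blast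
  have "f \<omega> \<noteq> 0" using vf[OF w(1)] w(2) i(2) by auto
  \<comment> \<open>The generator has real coefficients, so real and imaginary part are
    eigenfunctions separately; one of them is nonzero in the particle sector of
    \<open>\<omega>\<close>.\<close>
  then consider "Re (f \<omega>) \<noteq> 0" | "Im (f \<omega>) \<noteq> 0" by (auto simp: complex_eq_iff)
  then show ?thesis
  proof cases
    case 1
    show ?thesis
    proof (rule generator_gap[of "tot \<omega>" "\<lambda>\<eta>. Re (f \<eta>)" x \<omega>])
      show "gen (\<lambda>\<eta>. Re (f \<eta>)) \<eta> = - x * Re (f \<eta>)" if "\<eta> \<in> conf N (tot \<omega>)" for \<eta>
        using that gen[of \<eta>] by (simp add: gen_Re confs_def conf_def)
    qed (use H x 1 w confs_conf in auto)
  next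
    case 2
    show ?thesis
    proof (rule generator_gap[of "tot \<omega>" "\<lambda>\<eta>. Im (f \<eta>)" x \<omega>])
      show "gen (\<lambda>\<eta>. Im (f \<eta>)) \<eta> = - x * Im (f \<eta>)" if "\<eta> \<in> conf N (tot \<omega>)" for \<eta>
        using that gen[of \<eta>] by (simp add: gen_Im confs_def conf_def)
    qed (use H x 2 w confs_conf in auto)
  qed
qed

lemma generator_eigenvalue:
  assumes gen: "\<And>\<omega>. \<omega> \<in> confs \<Longrightarrow> gen f \<omega> = - x * f \<omega>" and nz: "\<omega>0 \<in> confs" "f \<omega>0 \<noteq> 0"
  shows "eigenvalue (xxz_hamiltonian \<Delta> S H) (complex_of_real x)"
proof -
  let ?A = "xxz_hamiltonian \<Delta> S H" and ?n = "Suc N ^ H"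
  have A: "?A \<in> carrier_mat ?n ?n" by (rule xxz_carrier[OF S])
  then have dim: "dim_row ?A = ?n" by simp
  define v where "v = vec ?n (\<lambda>i. let \<omega> = the_inv_into confs (enc (Suc N) H) i in of_real (sqrt (wt N \<omega>) * f \<omega>) :: complex)"
  have v: "v \<in> carrier_vec ?n" by (simp add: v_def)
  have inj: "inj_on (enc (Suc N) H) confs" using enc_confs_inj by (auto simp: inj_on_def)
  have vf: "v $ enc (Suc N) H \<eta> = of_real (sqrt (wt N \<eta>)) * of_real (f \<eta>)" if "\<eta> \<in> confs" for \<eta>
    using enc_less[OF confs_digits[OF that]] the_inv_into_f_f[OF inj that] by (simp add: v_def)
  have "?A *\<^sub>v v = complex_of_real x \<cdot>\<^sub>v v"
  proof (rule eq_vecI)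
    fix i assume "i < dim_vec (complex_of_real x \<cdot>\<^sub>v v)"
    then have i: "i < ?n" using v by simp
    then obtain \<omega> where w: "\<omega> \<in> confs" "enc (Suc N) H \<omega> = i" using enc_confs_surj by blast
    have "(?A *\<^sub>v v) $ i = - (of_real (sqrt (wt N \<omega>)) * gen_c (\<lambda>\<eta>. of_real (f \<eta>)) \<omega>)"
      unfolding mult_mat_vec_app[OF A v i] using xxz_action[OF vf w(1)] by (simp only: w(2))
    also have "\<dots> = of_real x * v $ i" unfolding w(2)[symmetric] vf[OF w(1)] gen_c_of_real gen[OF w(1)] by simp
    finally show "(?A *\<^sub>v v) $ i = (complex_of_real x \<cdot>\<^sub>v v) $ i" using v i by simp
  qed (use v dim in simp)
  moreover have "v \<noteq> 0\<^sub>v ?n"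
  proof
    assume "v = 0\<^sub>v ?n"
    then have "v $ enc (Suc N) H \<omega>0 = 0" using enc_less[OF confs_digits[OF nz(1)]] by simp
    then show False using vf[OF nz(1)] nz wt_confs_pos[OF nz(1)] by simp
  qed
  ultimately show ?thesis unfolding eigenvalue_def eigenvector_def dim using v by blast
qed

end

text \<open>In the sector with one particle the increments \<open>g (h + 1) - g h\<close> of an eigenfunction solve
  a second-order recursion with Dirichlet boundary conditions, whence the sine.\<close>

lemma one_particle_eigenfunction:
  assumes H: "2 \<le> H"
  shows "\<exists>x f \<omega>0. 0 < x \<and> x \<le> real (2 * N) \<and> \<omega>0 \<in> confs \<and> f \<omega>0 \<noteq> 0 \<and> (\<forall>\<omega>. gen f \<omega> = - x * f \<omega>)"
proof -
  define x where "x = real N * (1 - 2 * q / (1 + w) * cos (pi / H))"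
  have w1: "0 < 1 + w" using w_pos by simp
  have q1: "2 * q / (1 + w) < 1" using row_gap_pos by (simp add: row_gap_def)
  have q0: "0 < 2 * q / (1 + w)" using q_pos w1 by simp
  have "2 * q / (1 + w) * cos (pi / H) \<le> 2 * q / (1 + w) * 1" using q0 by (intro mult_left_mono) auto
  then have x0: "0 < x" using q1 N_pos unfolding x_def by (intro mult_pos_pos) auto
  have "2 * q / (1 + w) * (- 1) \<le> 2 * q / (1 + w) * cos (pi / H)" using q0 by (intro mult_left_mono) auto
  then have "1 - 2 * q / (1 + w) * cos (pi / H) \<le> 2" using q1 by simp
  from mult_left_mono[OF this, of "real N"] have x2: "x \<le> 2 * N" unfolding x_def by (simp add: mult.commute)
  define t where "t = pi / H"
  \<comment> \<open>The factor \<open>(1 / q) ^ h\<close> symmetrizes the rates up and down, and the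
    frequency \<open>pi / H\<close> makes the sine vanish at 0 and \<open>H\<close>.\<close>
  define D where "D h = (1 / q) ^ h * sin (t * h)" for h :: nat
  have D0: "D 0 = 0" "D H = 0" using H by (simp_all add: D_def t_def)
  have rec: "x * D h = N * (D h - up_rate * D (Suc h) - down_rate * D (h - 1))" if h1: "1 \<le> h" for h
  proof -
    obtain k where k: "h = Suc k" using h1 by (cases h) auto
    have r: "up_rate * (1 / q) = q / (1 + w)" "down_rate = q / (1 + w) * (1 / q)"
      using q_pos by (simp_all add: up_rate_def down_rate_def w_def power2_eq_square)
    have "up_rate * D (Suc h) = (up_rate * (1 / q)) * (1 / q) ^ h * sin (t * h + t)"
      by (simp add: D_def algebra_simps)
    moreover have "down_rate * D (h - 1) = q / (1 + w) * (1 / q) ^ h * sin (t * h - t)"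
    proof -
      have "t * real h - t = t * real k" by (simp add: k algebra_simps)
      then show ?thesis unfolding r(2) by (simp only: D_def k diff_Suc_1 power_Suc mult.assoc)
    qed
    ultimately have "up_rate * D (Suc h) + down_rate * D (h - 1) = q / (1 + w) * (1 / q) ^ h * (sin (t * h + t) + sin (t * h - t))"
      unfolding r(1) by (simp only: distrib_left)
    also have "\<dots> = 2 * q / (1 + w) * cos t * D h"
      by (simp add: sin_add sin_diff D_def)
    finally have e: "up_rate * D (Suc h) + down_rate * D (h - 1) = 2 * q / (1 + w) * cos t * D h" .
    have "x * D h = N * (D h - 2 * q / (1 + w) * cos t * D h)" by (simp add: x_def t_def algebra_simps)
    then show ?thesis unfolding e[symmetric] by simp
  qed
  \<comment> \<open>Forced by the eigenvalue equation at site \<open>h\<close>,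
    \<open>N * (up_rate * D h - down_rate * D (h - 1)) = - x * g h\<close>. That \<open>D\<close>
    gives the increments of \<open>g\<close> is then just the recursion for
    \<open>D\<close>.\<close>
  define g where "g h = - (N / x) * (up_rate * D h - down_rate * D (h - 1))" for h
  have incr: "g (Suc h) - g h = D h" if "1 \<le> h" for h
  proof -
    have "g (Suc h) - g h = N / x * ((up_rate + down_rate) * D h - up_rate * D (Suc h) - down_rate * D (h - 1))"
      by (simp add: g_def algebra_simps)
    also have "\<dots> = (x * D h) / x" unfolding rec[OF that] rates_sum by simp
    finally show ?thesis using x0 by simp
  qed
  define f where "f \<omega> = (if tot \<omega> = 1 then \<Sum>h\<in>{1..H}. real (\<omega> h) * g h else 0)" for \<omega>
  define e1 :: "nat \<Rightarrow> nat" where "e1 h = (if h = 1 then 1 else 0)" for h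
  have tote: "tot e1 = 1" using H by (simp add: tot_def e1_def)
  have "f e1 = (\<Sum>h\<in>{1..H}. real (e1 h) * g h)" by (simp add: f_def tote)
  also have "\<dots> = (\<Sum>h\<in>{1..H}. if h = 1 then g h else 0)" by (intro sum.cong refl) (simp add: e1_def)
  also have "\<dots> = g 1" using H by simp
  finally have fe: "f e1 = g 1" .
  have "t \<le> pi / 2" unfolding t_def using H by (intro divide_left_mono) auto
  then have "t < pi" using pi_gt_zero by linarith
  moreover have "0 < t" using H by (simp add: t_def)
  ultimately have "0 < sin t" by (intro sin_gt_zero)
  then have "g 1 \<noteq> 0" using x0 N_pos up_rate_pos q_pos by (simp add: g_def D0 D_def)
  moreover have "e1 \<in> confs" using H N_pos by (auto simp: confs_def e1_def)
  moreover have "gen f \<omega> = - x * f \<omega>" for \<omega>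
  proof -
    have jump0: "jump k l \<omega> = 0" if "\<omega> k = 0" for k l using that by (simp add: jump_def)
    have totmv: "tot (mv k l \<omega>) = tot \<omega>" if "k \<in> {1..H}" "l \<in> {1..H}" "1 \<le> \<omega> k" for k l
      using tot_dec[of k \<omega>] tot_inc[of l "dec \<omega> k"] that by (simp add: mv_def)
    show ?thesis
    proof (cases "tot \<omega> = 1")
      case False
      have "jump k l \<omega> * (f (mv k l \<omega>) - f \<omega>) = 0" if "k \<in> {1..H}" "l \<in> {1..H}" for k l
        using jump0[of k l] totmv[OF that] False by (cases "\<omega> k") (auto simp: f_def)
      note key = this
      have "gen f \<omega> = 0" unfolding gen_def
      proof (rule sum.neutral, rule ballI)
        fix h assume "h \<in> {1..<H}"
        then show "up_rate * jump h (Suc h) \<omega> * (f (mv h (Suc h) \<omega>) - f \<omega>)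
            + down_rate * jump (Suc h) h \<omega> * (f (mv (Suc h) h \<omega>) - f \<omega>) = 0"
          using key[of h "Suc h"] key[of "Suc h" h] by auto
      qed
      then show ?thesis using False by (simp add: f_def)
    next
      case True
      have "\<exists>k\<in>{1..H}. \<omega> k \<noteq> 0"
      proof (rule ccontr)
        assume "\<not> (\<exists>k\<in>{1..H}. \<omega> k \<noteq> 0)"
        then have "tot \<omega> = 0" unfolding tot_def by (intro sum.neutral) blast
        then show False using True by simp
      qed
      then obtain k where k: "k \<in> {1..H}" "\<omega> k \<noteq> 0" by blast
      have "tot \<omega> = \<omega> k + sum \<omega> ({1..H} - {k})" unfolding tot_def using k by (intro sum.remove) auto
      then have sk: "\<omega> k = 1" "sum \<omega> ({1..H} - {k}) = 0" using True k(2) by linarith+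
      have z: "\<omega> h = 0" if "h \<in> {1..H}" "h \<noteq> k" for h
      proof -
        have "\<forall>h\<in>{1..H} - {k}. \<omega> h = 0" using sk(2) by (subst (asm) sum_eq_0_iff) auto
        then show ?thesis using that by blast
      qed
      have jk: "jump k l \<omega> = N" if "l \<in> {1..H}" "l \<noteq> k" for l using sk z[OF that] by (simp add: jump_def)
      have fmv: "f (mv k l \<omega>) - f \<omega> = g l - g k" if l: "l \<in> {1..H}" "l \<noteq> k" for l
      proof -
        have "tot (mv k l \<omega>) = 1" using totmv[OF k(1) l(1)] sk True by simp
        then have "f (mv k l \<omega>) - f \<omega> = (\<Sum>h\<in>{1..H}. (real (mv k l \<omega> h) - real (\<omega> h)) * g h)"
          using True by (simp add: f_def sum_subtractf left_diff_distrib)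
        also have "\<dots> = (\<Sum>h\<in>{1..H}. (if h = l then g h else 0) - (if h = k then g h else 0))"
          using l sk by (intro sum.cong refl) (auto simp: mv_def inc_def dec_def)
        finally show ?thesis using l k by (simp add: sum_subtractf)
      qed
      have fk: "f \<omega> = g k"
      proof -
        have "f \<omega> = (\<Sum>h\<in>{1..H}. real (\<omega> h) * g h)" using True by (simp add: f_def)
        also have "\<dots> = (\<Sum>h\<in>{1..H}. if h = k then g h else 0)"
          using sk z by (intro sum.cong refl) auto
        finally show ?thesis using k by simp
      qed
      have "gen f \<omega> = (\<Sum>h\<in>{1..<H}. (if h = k then up_rate * N * D k else 0) - (if h = k - 1 then if Suc h = k then down_rate * N * D h else 0 else 0))"
        unfolding gen_def
      proof (intro sum.cong refl)
        fix h assume h: "h \<in> {1..<H}"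
        have "up_rate * jump h (Suc h) \<omega> * (f (mv h (Suc h) \<omega>) - f \<omega>) = (if h = k then up_rate * N * D k else 0)"
          using h jk[of "Suc h"] fmv[of "Suc h"] incr[of h] jump0[of h "Suc h"] z[of h] by auto
        moreover have "down_rate * jump (Suc h) h \<omega> * (f (mv (Suc h) h \<omega>) - f \<omega>) = - (if Suc h = k then down_rate * N * D h else 0)"
        proof (cases "Suc h = k")
          case True
          have "g h - g (Suc h) = - D h" using incr[of h] h by simp
          then show ?thesis using True h jk[of h] fmv[of h] by auto
        next
          case False
          then show ?thesis using h jump0[of "Suc h" h] z[of "Suc h"] by auto
        qed
        ultimately show "up_rate * jump h (Suc h) \<omega> * (f (mv h (Suc h) \<omega>) - f \<omega>)
            + down_rate * jump (Suc h) h \<omega> * (f (mv (Suc h) h \<omega>) - f \<omega>)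
          = (if h = k then up_rate * N * D k else 0) - (if h = k - 1 then if Suc h = k then down_rate * N * D h else 0 else 0)"
          by auto
      qed
      also have "\<dots> = (if k \<in> {1..<H} then up_rate * N * D k else 0)
          - (if k - 1 \<in> {1..<H} then if Suc (k - 1) = k then down_rate * N * D (k - 1) else 0 else 0)"
        unfolding sum_subtractf by (simp only: sum.delta finite_atLeastLessThan)
      \<comment> \<open>At the ends \<open>k = H\<close> and \<open>k = 1\<close> one bond is
        missing, and its term vanishes since \<open>D H = D 0 = 0\<close>.\<close>
      also have "\<dots> = up_rate * N * D k - down_rate * N * D (k - 1)"
      proof -
        have "(if k \<in> {1..<H} then up_rate * N * D k else 0) = up_rate * N * D k"
          using k D0 by (cases "k = H") auto
        moreover have "(if k - 1 \<in> {1..<H} then if Suc (k - 1) = k then down_rate * N * D (k - 1) else 0 else 0) = down_rate * N * D (k - 1)"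
          using k D0 by (cases "k = 1") auto
        ultimately show ?thesis by simp
      qed
      also have "\<dots> = - x * f \<omega>" unfolding fk g_def using x0 by (simp add: algebra_simps)
      finally show ?thesis .
    qed
  qed
  ultimately show ?thesis using x0 x2 fe
    by (intro exI[of _ x] exI[of _ f] exI[of _ e1]) simp
qed

end

section \<open>The two-sided bound on the spectral gap\<close>

lemma finite_real_eigenvalues:
  assumes "(A :: complex mat) \<in> carrier_mat n n"
  shows "finite {x :: real. eigenvalue A (complex_of_real x)}"
proof -
  have "char_poly A \<noteq> 0" using degree_monic_char_poly[OF assms] by auto
  then have "finite {z. poly (char_poly A) z = 0}" by (rule poly_roots_finite)
  then have "finite (complex_of_real -` {z. poly (char_poly A) z = 0})"
    by (rule finite_vimageI) (simp add: inj_of_real)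
  moreover have "{x :: real. eigenvalue A (complex_of_real x)} = complex_of_real -` {z. poly (char_poly A) z = 0}"
    using eigenvalue_root_char_poly[OF assms] by auto
  ultimately show ?thesis by simp
qed

theorem theorem4p1:
  fixes \<Delta> :: real
  assumes "\<Delta> > 1"
  shows "\<exists>\<delta>>0. \<forall>S\<in>half_naturals. \<forall>H\<ge>(2::nat).
           \<delta> * S \<le> spectral_gap (xxz_hamiltonian \<Delta> S H) \<and>
           spectral_gap (xxz_hamiltonian \<Delta> S H) \<le> inverse \<delta> * S"
proof -
  define r where "r = sqrt (\<Delta>\<^sup>2 - 1)"
  \<comment> \<open>The root of \<open>q\<^sup>2 - 2 * \<Delta> * q + 1 = 0\<close> in the unit
    interval.\<close>
  define q where "q = \<Delta> - r"
  have D2: "1 < \<Delta>\<^sup>2" using assms by (simp add: one_less_power)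
  have r2: "r\<^sup>2 = \<Delta>\<^sup>2 - 1" using D2 by (simp add: r_def)
  have r0: "0 \<le> r" using D2 by (simp add: r_def)
  have "r\<^sup>2 < \<Delta>\<^sup>2" unfolding r2 by simp
  then have "r < \<Delta>" by (rule power2_less_imp_less) (use assms in simp)
  then have q0: "0 < q" by (simp add: q_def)
  have "(\<Delta> - 1)\<^sup>2 < r\<^sup>2" unfolding r2 using assms by (simp add: power2_eq_square algebra_simps)
  then have "\<Delta> - 1 < r" using r0 by (rule power2_less_imp_less)
  then have q1: "q < 1" by (simp add: q_def)
  have Dq: "2 * \<Delta> * q = 1 + q\<^sup>2" using r2 by (simp add: q_def power2_eq_square algebra_simps)
  \<comment> \<open>\<open>row_gap\<close> and \<open>overlap\<close> depend on \<open>q\<close>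
    alone; the instance with \<open>H = 0\<close> makes them available before \<open>H\<close> and
    \<open>N\<close> are chosen.\<close>
  interpret rows: asymmetric_rows 0 q using q0 q1 by unfold_locales
  \<comment> \<open>28 is halved because \<open>N = 2 * S\<close>. For the upper bound
    \<open>\<delta> \<le> 1 / 4\<close> suffices, as the one-particle eigenvalue is at most
    \<open>2 * N = 4 * S\<close>.\<close>
  define \<delta> where "\<delta> = rows.row_gap * rows.overlap / 14"
  have \<delta>: "0 < \<delta>" using rows.row_gap_pos rows.overlap_pos by (simp add: \<delta>_def)
  have "rows.row_gap * rows.overlap \<le> 1 * 1"
    using rows.row_gap_pos rows.overlap_pos rows.row_gap_le_1 rows.overlap_le_1 by (intro mult_mono) auto
  then have \<delta>4: "\<delta> \<le> 1 / 4" unfolding \<delta>_def by linarith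
  show ?thesis
  proof (intro exI[of _ \<delta>] conjI \<delta> ballI allI impI)
    fix S :: real and H :: nat assume "S \<in> half_naturals" and H: "2 \<le> H"
    then obtain N where N: "1 \<le> N" and S: "S = real N / 2" by (auto simp: half_naturals_def)
    interpret spin_rows H q N using q0 q1 N by unfold_locales
    have D: "2 * \<Delta> * q = 1 + w" using Dq by (simp add: w_def)

    let ?A = "xxz_hamiltonian \<Delta> S H"
    let ?E = "{x :: real. x \<noteq> 0 \<and> eigenvalue ?A (complex_of_real x)}"
    have fin: "finite ?E"
      by (rule finite_subset[OF _ finite_real_eigenvalues[OF xxz_carrier[OF S]]]) auto
    obtain x :: real and f :: "(nat \<Rightarrow> nat) \<Rightarrow> real" and \<omega>0
      where x: "0 < x" "x \<le> real (2 * N)" "\<omega>0 \<in> confs" "f \<omega>0 \<noteq> 0" "\<forall>\<omega>. gen f \<omega> = - x * f \<omega>"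
      using one_particle_eigenfunction[OF H] by (elim exE conjE) (rule that)
    have "eigenvalue ?A (complex_of_real x)"
      by (rule generator_eigenvalue[OF D S, of f x \<omega>0]) (use x(3-5) in blast)+
    then have xE: "x \<in> ?E" using x(1) by simp
    have "\<delta> * S \<le> y" if "y \<in> ?E" for y
    proof -
      have "row_gap * overlap / 28 * N \<le> y"
        by (rule eigenvalue_lower_bound[OF D S]) (use that H in auto)
      also have "row_gap * overlap / 28 * N = \<delta> * S" by (simp add: \<delta>_def S)
      finally show ?thesis .
    qed
    then show "\<delta> * S \<le> spectral_gap ?A"
      unfolding spectral_gap_def using fin xE by (subst Min_ge_iff) auto
    have "spectral_gap ?A \<le> x" unfolding spectral_gap_def using fin xE by (rule Min_le)
    also have "x \<le> 4 * S" using x(2) by (simp add: S)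
    also have "4 * S \<le> inverse \<delta> * S"
    proof (rule mult_right_mono)
      show "4 \<le> inverse \<delta>" using \<delta> \<delta>4 by (simp add: inverse_eq_divide le_divide_eq)
    qed (simp add: S)
    finally show "spectral_gap ?A \<le> inverse \<delta> * S" .
  qed
qed

end
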